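(* Let $p,q\ge 2$ be integers and $f(z,w)=z^p+w^q$. There is a subset $\mathcal{B}\subset\mathbb{C}^2$, contained in the union of the zero sets of finitely many real-valued functions of the polar coordinates $(|a|,\arg a,|b|,\arg b)$ none of which vanishes identically, such that for every $(a,b)\in\mathbb{C}^2\setminus\mathcal{B}$ there exists a linear deformation $f_t$, $t\in[0,1]$, of $f$ with $f_1(z,w)=f(z,w)+a\bar z+b\bar w$ and such that $f_t:\mathbb{R}^4\to\mathbb{R}^2$ is an excellent map for every $t\in(0,1]$. Moreover, for every $t\in(0,1]$, every singular point of $f_t$ is either an indefinite fold or a cusp (in particular $f_t$ has no definite fold).
   Context: Complex polynomials in $(z,w)\in\mathbb{C}^2$ (possibly involving $\bar z,\bar w$) are regarded as smooth maps $\mathbb{R}^4\to\mathbb{R}^2$. A linear deformation of $f$ is a family $f_t(z,w)=f(z,w)+a_1(t)z+b_1(t)w+a_2(t)\bar z+b_2(t)\bar w$, $t\in[0,1]$, where $a_1,b_1,a_2,b_2$ are real-analytic complex-valued functions of $t$ vanishing at $t=0$. A smooth map $g:X^4\to Y^2$ between 4- and 2-dimensional manifolds is an excellent map if for every $x\in X$ there are local coordinates $(x_1,x_2,x_3,x_4)$ centered at $x$ and $(y_1,y_2)$ centered at $g(x)$ in which $g$ takes one of the forms: (1) $(x_1,x_2)$ (regular point); (2) $(x_1,x_2^2+x_3^2+x_4^2)$ (definite fold); (3) $(x_1,x_2^2+x_3^2-x_4^2)$ (indefinite fold); (4) $(x_1,x_2^2\pm x_3^2+x_1x_4+x_4^3)$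 (cusp). A singular point is a point where the real differential has rank $<2$. *)

theory Defs
  imports "HOL-Analysis.Analysis"
begin

definition real_analytic_fun_on :: "real set \<Rightarrow> (real \<Rightarrow> complex) \<Rightarrow> bool" where
  "real_analytic_fun_on U a \<longleftrightarrow>
     (\<forall>t0\<in>U. \<exists>r>0. \<exists>c::nat \<Rightarrow> complex. \<forall>t\<in>ball t0 r.
        ((\<lambda>n. c n * of_real ((t - t0) ^ n)) has_sum a t) UNIV)"

definition real_analytic_on_unit_interval :: "(real \<Rightarrow> complex) \<Rightarrow> bool" where
  "real_analytic_on_unit_interval a \<longleftrightarrow>
     (\<exists>U. open U \<and> {0..1} \<subseteq> U \<and> real_analytic_fun_on U a)"

definition real_analytic_multi_on :: "(real ^ 'n) set \<Rightarrow> (real ^ 'n \<Rightarrow> real) \<Rightarrow> bool" where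
  "real_analytic_multi_on U g \<longleftrightarrow>
     (\<forall>x\<in>U. \<exists>r>0. \<exists>c::('n \<Rightarrow> nat) \<Rightarrow> real. \<forall>y\<in>ball x r.
        ((\<lambda>\<alpha>. c \<alpha> * (\<Prod>i\<in>UNIV. (y $ i - x $ i) ^ \<alpha> i)) has_sum g y) UNIV)"

definition polar_coords :: "complex \<Rightarrow> complex \<Rightarrow> real ^ 4" where
  "polar_coords a b = vector [cmod a, Arg a, cmod b, Arg b]"

fun iter_dir_deriv :: "'a::real_normed_vector list \<Rightarrow> ('a \<Rightarrow> 'b::real_normed_vector) \<Rightarrow> 'a \<Rightarrow> 'b" where
  "iter_dir_deriv [] f = f"
| "iter_dir_deriv (v # vs) f = (\<lambda>x. frechet_derivative (iter_dir_deriv vs f) (at x) v)"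

definition smooth_on :: "'a::euclidean_space set \<Rightarrow> ('a \<Rightarrow> 'b::euclidean_space) \<Rightarrow> bool" where
  "smooth_on S f \<longleftrightarrow> open S \<and> (\<forall>vs. iter_dir_deriv vs f differentiable_on S)"

definition diffeo_between :: "('a::euclidean_space \<Rightarrow> 'b::euclidean_space) \<Rightarrow> 'a set \<Rightarrow> 'b set \<Rightarrow> bool" where
  "diffeo_between \<phi> U V \<longleftrightarrow> open U \<and> open V \<and> bij_betw \<phi> U V \<and> smooth_on U \<phi>
     \<and> smooth_on V (inv_into U \<phi>)"

text \<open>Maps R^4 \<rightarrow> R^2 are represented as maps C^2 \<rightarrow> C.
  g has local normal form N at x: there are local coordinates (x1,..,x4) centred at x
  and (y1,y2) centred at g x in which g equals N.\<close>
definition has_local_form :: "(complex \<times> complex \<Rightarrow> complex) \<Rightarrow> (real ^ 4 \<Rightarrow> real ^ 2)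
    \<Rightarrow> complex \<times> complex \<Rightarrow> bool" where
  "has_local_form g N x \<longleftrightarrow>
     (\<exists>U V \<phi> W W' \<psi>. x \<in> U \<and> diffeo_between (\<phi> :: complex \<times> complex \<Rightarrow> real ^ 4) U V \<and> \<phi> x = 0
        \<and> g x \<in> W \<and> diffeo_between (\<psi> :: complex \<Rightarrow> real ^ 2) W W' \<and> \<psi> (g x) = 0
        \<and> g ` U \<subseteq> W \<and> (\<forall>y\<in>U. \<psi> (g y) = N (\<phi> y)))"

definition regular_form :: "real ^ 4 \<Rightarrow> real ^ 2" where
  "regular_form x = vector [x$1, x$2]"

definition definite_fold_form :: "real ^ 4 \<Rightarrow> real ^ 2" where
  "definite_fold_form x = vector [x$1, (x$2)^2 + (x$3)^2 + (x$4)^2]"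

definition indefinite_fold_form :: "real ^ 4 \<Rightarrow> real ^ 2" where
  "indefinite_fold_form x = vector [x$1, (x$2)^2 + (x$3)^2 - (x$4)^2]"

definition cusp_plus_form :: "real ^ 4 \<Rightarrow> real ^ 2" where
  "cusp_plus_form x = vector [x$1, (x$2)^2 + (x$3)^2 + x$1 * x$4 + (x$4)^3]"

definition cusp_minus_form :: "real ^ 4 \<Rightarrow> real ^ 2" where
  "cusp_minus_form x = vector [x$1, (x$2)^2 - (x$3)^2 + x$1 * x$4 + (x$4)^3]"

definition is_cusp :: "(complex \<times> complex \<Rightarrow> complex) \<Rightarrow> complex \<times> complex \<Rightarrow> bool" where
  "is_cusp g x \<longleftrightarrow> has_local_form g cusp_plus_form x \<or> has_local_form g cusp_minus_form x"

definition excellent_map :: "(complex \<times> complex \<Rightarrow> complex) \<Rightarrow> bool" where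
  "excellent_map g \<longleftrightarrow> smooth_on UNIV g \<and>
     (\<forall>x. has_local_form g regular_form x \<or> has_local_form g definite_fold_form x
        \<or> has_local_form g indefinite_fold_form x \<or> is_cusp g x)"

definition singular_point :: "(complex \<times> complex \<Rightarrow> complex) \<Rightarrow> complex \<times> complex \<Rightarrow> bool" where
  "singular_point g x \<longleftrightarrow> dim (range (frechet_derivative g (at x))) < 2"

definition lin_deform ::
  "(complex \<times> complex \<Rightarrow> complex) \<Rightarrow> (real \<Rightarrow> complex) \<Rightarrow> (real \<Rightarrow> complex) \<Rightarrow> (real \<Rightarrow> complex)
    \<Rightarrow> (real \<Rightarrow> complex) \<Rightarrow> real \<Rightarrow> complex \<times> complex \<Rightarrow> complex" where
  "lin_deform f a1 b1 a2 b2 t = (\<lambda>(z, w). f (z, w) + a1 t * z + b1 t * w + a2 t * cnj z + b2 t * cnj w)"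

definition is_linear_deformation_coeffs :: "(real \<Rightarrow> complex) \<Rightarrow> bool" where
  "is_linear_deformation_coeffs a \<longleftrightarrow> real_analytic_on_unit_interval a \<and> a 0 = 0"

end

theory Submission
  imports Defs "HOL-Complex_Analysis.Complex_Analysis"
begin

text \<open>
  Put $g = z^p + w^q + a \bar z + b \bar w$. Scaling $z$ and $w$ by $t^q$ and $t^p$ shows that the deformation
  with coefficients $t^{q(p-1)} a$ and $t^{p(q-1)} b$ is, for every $t > 0$, equivalent to $g$, so it suffices
  to study $g$ itself.

  At a singular point there is a unit $c$ such that $\mathrm{Re}(c \cdot dg) = 0$. For real $s$ put $C = c(1 + is)$.
  Then $\mathrm{Re}(C g)$ is the real part of the holomorphic function $C z^p + \overline{C a} z$ plus the
  analogous function of $w$, whose critical points are nondegenerate and explicit functions of $s$; its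
  critical value is an explicit function $K(s)$, and the deviation from it is the real part of $\zeta^2 + \omega^2$
  for Morse coordinates $\zeta$ of $z$ and $\omega$ of $w$. Choosing $s$ as a function of $w$ that makes $\mathrm{Re}(\omega^2)$ vanish turns
  $g$ into $(\eta, s \eta + K(s) + X^2 - Y^2)$ with local coordinates $(\eta, s, X, Y)$. Dividing $K$ by a monic polynomial
  of degree 2 or 3 with free coefficients, by means of Cauchy's formula, yields the indefinite fold if
  $K''(0) \neq 0$ and the cusp if $K''(0) = 0 \neq K'''(0)$.

  If $K''(0) = K'''(0) = 0$ at some singular point, eliminating the point leaves a polynomial relation between
  a cosine of a combination of the arguments and a fractional power of the moduli of $a$ and $b$; the product
  of its conjugates under roots of unity is analytic in the polar coordinates.
\<close>

section \<open>Smooth germs\<close>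

text \<open>The obstacle is the cusp, whose reduction in the smooth category calls for a preparation
  theorem. It is met by making all dependence on s holomorphic. Replacing c by c(1 + is) merges the
  two components into one pencil, since Re(C x) = Re(c x) - s Im(c x) for real s, and the critical
  points of the pencil move by explicit powers of (1 - is)/(1 + is). Division then amounts to
  differentiating Cauchy integrals in their parameters, and every coordinate system comes from the
  inverse function theorem. Definite folds cannot occur because the complex square of the
  z-coordinate always contributes one positive and one negative real square. Parameters with a = 0
  or b = 0 are set aside: a critical point may then be 0, and the Morse coordinates are built from
  the ratio of the variable to its critical point. For fixed (a, b) the singular points form a set
  with one real parameter, the angle of c, up to finitely many choices of z and w. Degeneracy
  imposes two real equations on it, which is why the exceptional parameters should satisfy one real
  equation.\<close>

primrec k_smooth :: "nat \<Rightarrow> 'a::euclidean_space set \<Rightarrow> ('a \<Rightarrow> 'b::euclidean_space) \<Rightarrow> bool" where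
  "k_smooth 0 S f \<longleftrightarrow> f differentiable_on S"
| "k_smooth (Suc k) S f \<longleftrightarrow> f differentiable_on S
     \<and> (\<forall>v. k_smooth k S (\<lambda>x. frechet_derivative f (at x) v))"

text \<open>\<open>iter_dir_deriv\<close> differentiates in the last direction of its list first, so
  removing that direction is what matches the recursion of \<open>k_smooth\<close>.\<close>

lemma iter_dir_deriv_snoc:
  "iter_dir_deriv (us @ [v]) f = iter_dir_deriv us (\<lambda>x. frechet_derivative f (at x) v)"
  by (induction us) auto

lemma k_smooth_iff_iter_dir_deriv:
  "k_smooth k S f \<longleftrightarrow> (\<forall>vs. length vs \<le> k \<longrightarrow> iter_dir_deriv vs f differentiable_on S)"
proof (induction k arbitrary: f)
  case (Suc k)
  have "(\<forall>vs. length vs \<le> Suc k \<longrightarrow> iter_dir_deriv vs f differentiable_on S) \<longleftrightarrow>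
      f differentiable_on S \<and>
      (\<forall>us v. length us \<le> k \<longrightarrow> iter_dir_deriv (us @ [v]) f differentiable_on S)" (is "?L \<longleftrightarrow> ?R")
  proof
    assume ?L
    then show ?R
      by (auto dest: spec[of _ "[]"])
  next
    assume R: ?R
    show ?L
    proof (intro allI impI)
      fix vs :: "'a list" assume "length vs \<le> Suc k"
      then show "iter_dir_deriv vs f differentiable_on S"
        using R by (cases vs rule: rev_cases) auto
    qed
  qed
  then show ?case
    by (auto simp: Suc.IH iter_dir_deriv_snoc)
qed auto

lemma smooth_on_iff_k_smooth: "smooth_on S f \<longleftrightarrow> open S \<and> (\<forall>k. k_smooth k S f)"
  unfolding smooth_on_def k_smooth_iff_iter_dir_deriv by blast

lemma k_smooth_imp_differentiable_on: "k_smooth k S f \<Longrightarrow> f differentiable_on S"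
  by (cases k) auto

lemma k_smooth_has_derivative:
  assumes "k_smooth k S f" "open S" "x \<in> S"
  shows "(f has_derivative frechet_derivative f (at x)) (at x)"
  using assms k_smooth_imp_differentiable_on
  by (metis differentiable_on_eq_differentiable_at frechet_derivative_works)

lemma k_smooth_SucD: "k_smooth (Suc k) S f \<Longrightarrow> k_smooth k S f"
  by (induction k arbitrary: f) auto

lemma k_smooth_cong:
  assumes "open S" "\<And>x. x \<in> S \<Longrightarrow> f x = g x" "k_smooth k S f"
  shows "k_smooth k S g"
  using assms(2,3)
proof (induction k arbitrary: f g)
  case 0
  have "(g has_derivative frechet_derivative f (at x)) (at x)" if "x \<in> S" for x
    using has_derivative_transform_within_open[OF k_smooth_has_derivative[OF 0(2) assms(1) that] assms(1) that]
      0(1) by auto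
  then show ?case
    using assms(1) by (auto simp: differentiable_on_eq_differentiable_at differentiable_def)
next
  case (Suc k)
  have d: "(g has_derivative frechet_derivative f (at x)) (at x)" if "x \<in> S" for x
    using has_derivative_transform_within_open[OF k_smooth_has_derivative[OF Suc.prems(2) assms(1) that] assms(1) that]
      Suc.prems(1) by auto
  have "frechet_derivative g (at x) = frechet_derivative f (at x)" if "x \<in> S" for x
    using d[OF that] frechet_derivative_at by metis
  then have "k_smooth k S (\<lambda>x. frechet_derivative g (at x) v)" for v
    using Suc.IH[of "\<lambda>x. frechet_derivative f (at x) v"] Suc.prems(2) by simp
  moreover have "g differentiable_on S"
    using d assms(1) by (auto simp: differentiable_on_eq_differentiable_at differentiable_def)
  ultimately show ?case by simp
qed

lemma k_smooth_SucI:
  assumes "open S" "\<And>x. x \<in> S \<Longrightarrow> (f has_derivative f' x) (at x)"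
    and "\<And>v. k_smooth k S (\<lambda>x. f' x v)"
  shows "k_smooth (Suc k) S f"
proof -
  have "frechet_derivative f (at x) = f' x" if "x \<in> S" for x
    using assms(2)[OF that] frechet_derivative_at by metis
  then have "k_smooth k S (\<lambda>x. frechet_derivative f (at x) v)" for v
    using k_smooth_cong[OF assms(1) _ assms(3)[of v]] by simp
  moreover have "f differentiable_on S"
    using assms by (auto simp: differentiable_on_eq_differentiable_at differentiable_def)
  ultimately show ?thesis by simp
qed

lemma k_smooth_0I:
  assumes "open S" "\<And>x. x \<in> S \<Longrightarrow> (f has_derivative f' x) (at x)"
  shows "k_smooth 0 S f"
  using assms by (auto simp: differentiable_on_eq_differentiable_at differentiable_def)

lemma k_smooth_const: "open S \<Longrightarrow> k_smooth k S (\<lambda>x. c)"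
proof (induction k arbitrary: c)
  case (Suc k)
  then show ?case by (intro k_smooth_SucI[where f'="\<lambda>_ _. 0"]) auto
qed auto

lemma k_smooth_linear:
  assumes "bounded_linear L" "open S"
  shows "k_smooth k S L"
proof -
  have "k_smooth (Suc k) S L"
    by (rule k_smooth_SucI[where f'="\<lambda>_. L", OF assms(2)])
       (use assms in \<open>simp_all add: bounded_linear_imp_has_derivative k_smooth_const\<close>)
  then show ?thesis by (rule k_smooth_SucD)
qed

lemma k_smooth_add:
  assumes "open S" "k_smooth k S f" "k_smooth k S g"
  shows "k_smooth k S (\<lambda>x. f x + g x)"
  using assms(2,3)
proof (induction k arbitrary: f g)
  case 0
  then show ?case by (auto intro: differentiable_on_add)
next
  case (Suc k)
  show ?case
    by (rule k_smooth_SucI[OF assms(1) has_derivative_add[OF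
          k_smooth_has_derivative[OF Suc.prems(1)] k_smooth_has_derivative[OF Suc.prems(2)]]])
       (use Suc assms(1) in auto)
qed

lemma k_smooth_sum:
  assumes "open S" "\<And>i. i \<in> I \<Longrightarrow> k_smooth k S (f i)"
  shows "k_smooth k S (\<lambda>x. \<Sum>i\<in>I. f i x)"
  using assms(2)
  by (induction I rule: infinite_finite_induct) (auto intro: k_smooth_const k_smooth_add assms(1) simp del: k_smooth.simps)

lemma k_smooth_bilinear:
  assumes "bounded_bilinear B" "open S" "k_smooth k S f" "k_smooth k S g"
  shows "k_smooth k S (\<lambda>x. B (f x) (g x))"
  using assms(3,4)
proof (induction k arbitrary: f g)
  case 0
  show ?case
    by (rule k_smooth_0I[OF assms(2) bounded_bilinear.FDERIV[OF assms(1)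
          k_smooth_has_derivative[OF 0(1) assms(2)] k_smooth_has_derivative[OF 0(2) assms(2)]]])
next
  case (Suc k)
  show ?case
  proof (rule k_smooth_SucI[OF assms(2) bounded_bilinear.FDERIV[OF assms(1)
          k_smooth_has_derivative[OF Suc.prems(1) assms(2)] k_smooth_has_derivative[OF Suc.prems(2) assms(2)]]])
    fix v
    have "k_smooth k S (\<lambda>x. frechet_derivative f (at x) v)" "k_smooth k S (\<lambda>x. frechet_derivative g (at x) v)"
      using Suc.prems by auto
    then show "k_smooth k S (\<lambda>x. B (f x) (frechet_derivative g (at x) v) + B (frechet_derivative f (at x) v) (g x))"
      by (intro k_smooth_add assms(2) Suc.IH Suc.prems[THEN k_smooth_SucD])
  qed
qed

lemma linear_Basis_expansion:
  fixes L :: "'a::euclidean_space \<Rightarrow> 'b::real_vector"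
  assumes "linear L"
  shows "L v = (\<Sum>b\<in>Basis. (v \<bullet> b) *\<^sub>R L b)"
  using linear_sum[OF assms] linear_scale[OF assms]
  by (smt (verit) euclidean_representation sum.cong)

lemma k_smooth_compose:
  fixes f :: "'a::euclidean_space \<Rightarrow> 'b::euclidean_space" and g :: "'b \<Rightarrow> 'c::euclidean_space"
  assumes "open S" "open T" "f ` S \<subseteq> T" "k_smooth k S f" "k_smooth k T g"
  shows "k_smooth k S (\<lambda>x. g (f x))"
  using assms(3-5)
proof (induction k arbitrary: f g)
  case 0
  have "((\<lambda>x. g (f x)) has_derivative (\<lambda>h. frechet_derivative g (at (f x)) (frechet_derivative f (at x) h))) (at x)"
    if "x \<in> S" for x
    by (rule has_derivative_compose[OF k_smooth_has_derivative[OF 0(2)] k_smooth_has_derivative[OF 0(3)]])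
       (use that assms(1,2) 0(1) in auto)
  then show ?case by (rule k_smooth_0I[OF assms(1)])
next
  case (Suc k)
  have d: "((\<lambda>x. g (f x)) has_derivative (\<lambda>h. frechet_derivative g (at (f x)) (frechet_derivative f (at x) h))) (at x)"
    if "x \<in> S" for x
    by (rule has_derivative_compose[OF k_smooth_has_derivative[OF Suc.prems(2)] k_smooth_has_derivative[OF Suc.prems(3)]])
       (use that assms(1,2) Suc.prems(1) in auto)
  show ?case
  proof (rule k_smooth_SucI[OF assms(1) d])
    fix v
    \<comment> \<open>The chain rule applies the derivative of g to a vector that itself varies with
      x, which the induction hypothesis does not cover. Expanding this vector in the basis leaves
      only the fixed directions b.\<close>
    have *: "(\<Sum>b\<in>Basis. (frechet_derivative f (at x) v \<bullet> b) *\<^sub>R frechet_derivative g (at (f x)) b)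
        = frechet_derivative g (at (f x)) (frechet_derivative f (at x) v)" if "x \<in> S" for x
    proof -
      have "linear (frechet_derivative g (at (f x)))"
        using k_smooth_has_derivative[OF Suc.prems(3) assms(2), of "f x"] Suc.prems(1) that
          has_derivative_linear by blast
      then show ?thesis by (rule linear_Basis_expansion[symmetric])
    qed
    have "k_smooth k S (\<lambda>x. \<Sum>b\<in>Basis. (frechet_derivative f (at x) v \<bullet> b) *\<^sub>R frechet_derivative g (at (f x)) b)"
    proof (intro k_smooth_sum k_smooth_bilinear[OF bounded_bilinear_scaleR] k_smooth_bilinear[OF bounded_bilinear_inner]
        assms(1) k_smooth_const)
      show "k_smooth k S (\<lambda>x. frechet_derivative f (at x) v)"
        using Suc.prems(2) by simp
      show "k_smooth k S (\<lambda>x. frechet_derivative g (at (f x)) b)" for b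
        by (rule Suc.IH) (use Suc.prems in \<open>auto intro: k_smooth_SucD\<close>)
    qed
    then show "k_smooth k S (\<lambda>x. frechet_derivative g (at (f x)) (frechet_derivative f (at x) v))"
      by (rule k_smooth_cong[OF assms(1), rotated]) (rule *)
  qed
qed

lemma k_smooth_holomorphic:
  assumes "open S" "f holomorphic_on S"
  shows "k_smooth k S f"
  using assms(2)
proof (induction k arbitrary: f)
  case 0
  have "(f has_derivative (*) (deriv f x)) (at x)" if "x \<in> S" for x
    using holomorphic_derivI[OF 0 assms(1) that] has_field_derivative_def by blast
  then show ?case by (rule k_smooth_0I[OF assms(1)])
next
  case (Suc k)
  show ?case
  proof (rule k_smooth_SucI[OF assms(1)])
    show "(f has_derivative (*) (deriv f x)) (at x)" if "x \<in> S" for x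
      using holomorphic_derivI[OF Suc.prems assms(1) that] has_field_derivative_def by blast
    show "k_smooth k S (\<lambda>x. deriv f x * v)" for v
      by (rule k_smooth_bilinear[OF bounded_bilinear_mult assms(1) Suc.IH k_smooth_const[OF assms(1)]])
         (rule holomorphic_deriv[OF Suc.prems assms(1)])
  qed
qed

lemma k_smooth_subset:
  assumes "k_smooth k S f" "open S" "open T" "T \<subseteq> S"
  shows "k_smooth k T f"
  using assms(1)
proof (induction k arbitrary: f)
  case (Suc k)
  then show ?case by (auto intro: differentiable_on_subset[OF _ assms(4)])
qed (auto intro: differentiable_on_subset[OF _ assms(4)])

section \<open>Germs of smooth maps at a point and their closure properties\<close>

definition smooth_at :: "'a::euclidean_space \<Rightarrow> ('a \<Rightarrow> 'b::euclidean_space) \<Rightarrow> bool" where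
  "smooth_at x f \<longleftrightarrow> (\<exists>U. x \<in> U \<and> smooth_on U f)"

lemma smooth_atE:
  assumes "smooth_at x f"
  obtains U where "x \<in> U" "open U" "\<And>k. k_smooth k U f"
  using assms unfolding smooth_at_def smooth_on_iff_k_smooth by blast

lemma smooth_atI:
  assumes "x \<in> U" "open U" "\<And>k. k_smooth k U f"
  shows "smooth_at x f"
  using assms unfolding smooth_at_def smooth_on_iff_k_smooth by blast

lemma smooth_at_cong:
  assumes "smooth_at x f" "\<forall>\<^sub>F y in nhds x. f y = g y"
  shows "smooth_at x g"
proof -
  obtain U where U: "x \<in> U" "open U" "\<And>k. k_smooth k U f" by (rule smooth_atE[OF assms(1)]) blast
  obtain V where V: "open V" "x \<in> V" "\<And>y. y \<in> V \<Longrightarrow> f y = g y"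
    using assms(2) unfolding eventually_nhds by blast
  have o: "open (U \<inter> V)" using U V by blast
  have "k_smooth k (U \<inter> V) g" for k
    by (rule k_smooth_cong[OF o _ k_smooth_subset[OF U(3) U(2) o]]) (use V(3) in auto)
  then show ?thesis using smooth_atI[OF _ o] U(1) V(2) by blast
qed

lemma smooth_at_differentiable: "smooth_at x f \<Longrightarrow> f differentiable (at x)"
  by (erule smooth_atE) (metis k_smooth.simps(1) differentiable_on_eq_differentiable_at)

lemma smooth_at_has_derivative:
  "smooth_at x f \<Longrightarrow> (f has_derivative frechet_derivative f (at x)) (at x)"
  using smooth_at_differentiable frechet_derivative_works by blast

lemma smooth_at_isCont: "smooth_at x f \<Longrightarrow> isCont f x"
  using smooth_at_has_derivative has_derivative_continuous by blast

lemma smooth_at_compose: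
  assumes "smooth_at x f" "smooth_at (f x) g"
  shows "smooth_at x (\<lambda>y. g (f y))"
proof -
  obtain U where U: "x \<in> U" "open U" "\<And>k. k_smooth k U f" by (rule smooth_atE[OF assms(1)]) blast
  obtain V where V: "f x \<in> V" "open V" "\<And>k. k_smooth k V g" by (rule smooth_atE[OF assms(2)]) blast
  have "continuous_on U f"
    using U(3)[of 0] by (simp add: differentiable_imp_continuous_on)
  then have o: "open (U \<inter> f -` V)"
    using U(2) V(2) by (simp add: continuous_on_open_vimage Int_commute continuous_open_preimage)
  have "k_smooth k (U \<inter> f -` V) (\<lambda>y. g (f y))" for k
    by (rule k_smooth_compose[OF o V(2) _ k_smooth_subset[OF U(3) U(2) o] V(3)]) auto
  then show ?thesis
    using smooth_atI[OF _ o] U(1) V(1) by blast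
qed

lemma smooth_at_const: "smooth_at x (\<lambda>y. c)"
  by (rule smooth_atI[OF UNIV_I open_UNIV k_smooth_const[OF open_UNIV]])

lemma smooth_at_linear: "bounded_linear L \<Longrightarrow> smooth_at x L"
  by (rule smooth_atI[OF UNIV_I open_UNIV k_smooth_linear[OF _ open_UNIV]])

lemma smooth_at_common:
  assumes "smooth_at x f" "smooth_at x g"
  obtains U where "x \<in> U" "open U" "\<And>k. k_smooth k U f" "\<And>k. k_smooth k U g"
proof -
  obtain U where U: "x \<in> U" "open U" "\<And>k. k_smooth k U f" by (rule smooth_atE[OF assms(1)]) blast
  obtain V where V: "x \<in> V" "open V" "\<And>k. k_smooth k V g" by (rule smooth_atE[OF assms(2)]) blast
  have o: "open (U \<inter> V)" using U V by blast
  show ?thesis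
    by (rule that[OF _ o k_smooth_subset[OF U(3) U(2) o] k_smooth_subset[OF V(3) V(2) o]]) (use U V in auto)
qed

lemma smooth_at_bilinear:
  assumes "bounded_bilinear B" "smooth_at x f" "smooth_at x g"
  shows "smooth_at x (\<lambda>y. B (f y) (g y))"
proof -
  obtain U where U: "x \<in> U" "open U" "\<And>k. k_smooth k U f" "\<And>k. k_smooth k U g"
    by (rule smooth_at_common[OF assms(2,3)]) blast
  then show ?thesis
    using smooth_atI[OF U(1,2)] k_smooth_bilinear[OF assms(1) U(2)] by blast
qed

lemma smooth_at_add:
  assumes "smooth_at x f" "smooth_at x g"
  shows "smooth_at x (\<lambda>y. f y + g y)"
proof -
  obtain U where U: "x \<in> U" "open U" "\<And>k. k_smooth k U f" "\<And>k. k_smooth k U g"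
    by (rule smooth_at_common[OF assms]) blast
  then show ?thesis
    using smooth_atI[OF U(1,2)] k_smooth_add[OF U(2)] by blast
qed

lemma smooth_at_linear_compose:
  "bounded_linear L \<Longrightarrow> smooth_at x f \<Longrightarrow> smooth_at x (\<lambda>y. L (f y))"
  using smooth_at_compose smooth_at_linear by blast

lemma smooth_at_analytic_compose:
  fixes h :: "complex \<Rightarrow> complex"
  assumes "smooth_at x f" "h analytic_on {f x}"
  shows "smooth_at x (\<lambda>y. h (f y))"
proof (rule smooth_at_compose[OF assms(1)])
  show "smooth_at (f x) h"
    using assms(2) analytic_at[of h "f x"] k_smooth_holomorphic smooth_atI by metis
qed

named_theorems smooth_intros

lemmas [smooth_intros] = smooth_at_const smooth_at_add
  smooth_at_bilinear[OF bounded_bilinear_mult] smooth_at_bilinear[OF bounded_bilinear_scaleR]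
  smooth_at_linear[OF bounded_linear_ident]
  smooth_at_linear_compose[OF bounded_linear_fst] smooth_at_linear_compose[OF bounded_linear_snd]
  smooth_at_linear_compose[OF bounded_linear_Re] smooth_at_linear_compose[OF bounded_linear_Im]
  smooth_at_linear_compose[OF bounded_linear_cnj] smooth_at_linear_compose[OF bounded_linear_of_real]

lemma smooth_at_minus [smooth_intros]: "smooth_at x f \<Longrightarrow> smooth_at x (\<lambda>y. - f y)"
  by (rule smooth_at_linear_compose[OF bounded_linear_minus[OF bounded_linear_ident]])

lemma smooth_at_diff [smooth_intros]:
  "smooth_at x f \<Longrightarrow> smooth_at x g \<Longrightarrow> smooth_at x (\<lambda>y. f y - g y)"
  using smooth_at_add[OF _ smooth_at_minus] by force

lemma smooth_at_Pair [smooth_intros]: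
  assumes "smooth_at x f" "smooth_at x g"
  shows "smooth_at x (\<lambda>y. (f y, g y))"
proof -
  have "smooth_at x (\<lambda>y. (f y, 0) + (0, g y))"
    by (intro smooth_at_add smooth_at_linear_compose[OF bounded_linear_Pair[OF bounded_linear_ident bounded_linear_zero]]
       smooth_at_linear_compose[OF bounded_linear_Pair[OF bounded_linear_zero bounded_linear_ident]] assms)
  then show ?thesis by simp
qed

lemma smooth_at_power [smooth_intros]:
  fixes f :: "'a::euclidean_space \<Rightarrow> 'b::{euclidean_space, real_normed_algebra_1}"
  shows "smooth_at x f \<Longrightarrow> smooth_at x (\<lambda>y. f y ^ n)"
  by (induction n) (auto intro: smooth_intros)

lemma smooth_at_sum [smooth_intros]:
  "(\<And>i. i \<in> I \<Longrightarrow> smooth_at x (f i)) \<Longrightarrow> smooth_at x (\<lambda>y. \<Sum>i\<in>I. f i y)"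
  by (induction I rule: infinite_finite_induct) (auto intro: smooth_intros)

lemma smooth_at_complex_divide [smooth_intros]:
  fixes f g :: "'a::euclidean_space \<Rightarrow> complex"
  assumes "smooth_at x f" "smooth_at x g" "g x \<noteq> 0"
  shows "smooth_at x (\<lambda>y. f y / g y)"
proof -
  have "smooth_at x (\<lambda>y. f y * inverse (g y))"
    by (intro smooth_intros smooth_at_analytic_compose[of x g inverse] analytic_intros assms)
       (use assms in auto)
  then show ?thesis by (simp add: divide_inverse)
qed

lemma smooth_at_real_divide [smooth_intros]:
  fixes f g :: "'a::euclidean_space \<Rightarrow> real"
  assumes "smooth_at x f" "smooth_at x g" "g x \<noteq> 0"
  shows "smooth_at x (\<lambda>y. f y / g y)"
proof -
  have "smooth_at x (\<lambda>y. Re (of_real (f y) / of_real (g y)))"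
    by (intro smooth_intros assms) (use assms in auto)
  then show ?thesis by (simp flip: of_real_divide)
qed

text \<open>Near a positive value the real root is the restriction of the holomorphic
  \<open>csqrt\<close>, so smoothness is inherited from analyticity, as for quotients.\<close>

lemma smooth_at_sqrt [smooth_intros]:
  fixes f :: "'a::euclidean_space \<Rightarrow> real"
  assumes "smooth_at x f" "f x > 0"
  shows "smooth_at x (\<lambda>y. sqrt (f y))"
proof (rule smooth_at_cong)
  show "smooth_at x (\<lambda>y. Re (csqrt (of_real (f y))))"
    by (intro smooth_intros smooth_at_analytic_compose[of x "\<lambda>y. of_real (f y)" csqrt] assms)
       (use assms in \<open>auto intro!: analytic_intros\<close>)
  have "\<forall>\<^sub>F y in nhds x. f y > 0"
    using smooth_at_isCont[OF assms(1)] assms(2) by (simp add: eventually_nhds_conv_at order_tendstoD(1) isCont_def)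
  then show "\<forall>\<^sub>F y in nhds x. Re (csqrt (of_real (f y))) = sqrt (f y)"
    by eventually_elim simp
qed

section \<open>The smooth inverse function theorem\<close>

text \<open>This is the formula - A^(-1) (dA) A^(-1) for the derivative of an inverse matrix,
  obtained without determinants: (x, u) |-> (x, A(x) u) has the inverse (x, v) |-> (x, A(x)^(-1) v),
  whose derivative comes from \<open>has_derivative_inverse_strong\<close>. Fixing v isolates the
  second component.\<close>

lemma has_derivative_inverse_operator:
  fixes f :: "'a::euclidean_space \<Rightarrow> 'a"
  assumes S: "open S" "k_smooth 1 S f"
    and bij: "\<And>x. x \<in> S \<Longrightarrow> bij (frechet_derivative f (at x))" and x: "x \<in> S"
  shows "((\<lambda>x. inv (frechet_derivative f (at x)) v) has_derivative
     (\<lambda>w. - inv (frechet_derivative f (at x)) (\<Sum>b\<in>Basis. (inv (frechet_derivative f (at x)) v \<bullet> b) *\<^sub>R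
        frechet_derivative (\<lambda>y. frechet_derivative f (at y) b) (at x) w))) (at x)"
proof -
  define A where "A x = frechet_derivative f (at x)" for x
  define A2 where "A2 b x = frechet_derivative (\<lambda>y. A y b) (at x)" for b x
  have linA: "linear (A x)" if "x \<in> S" for x
    using k_smooth_has_derivative[OF S(2,1) that] has_derivative_linear unfolding A_def by blast
  have dA: "((\<lambda>y. A y b) has_derivative A2 b x) (at x)" if "x \<in> S" for x b
    using k_smooth_has_derivative[of 0 S "\<lambda>y. A y b" x] S that unfolding A_def A2_def by simp
  have Ainv: "inv (A x) (A x u) = u" "A x (inv (A x) u) = u" if "x \<in> S" for x u
    using bij[OF that] unfolding A_def by (simp_all add: bij_is_inj bij_is_surj inv_f_f surj_f_inv_f)
  \<comment> \<open>In the basis expansion x enters only through the functions \<open>A x b\<close>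
    with b fixed, whose derivatives are the known \<open>A2\<close>.\<close>
  define E where "E xu = (\<Sum>b\<in>Basis. (snd xu \<bullet> b) *\<^sub>R A (fst xu) b)" for xu :: "'a \<times> 'a"
  have E: "E (y, u) = A y u" if "y \<in> S" for y u
    unfolding E_def using linear_Basis_expansion[OF linA[OF that], of u] by simp
  define F where "F xu = (fst xu, E xu)" for xu
  define G where "G xv = (fst xv, inv (A (fst xv)) (snd xv))" for xv
  define M where "M u w = (\<Sum>b\<in>Basis. (u \<bullet> b) *\<^sub>R A2 b x w)" for u w
  define u where "u = inv (A x) v"
  have dF: "(F has_derivative (\<lambda>h. (fst h, \<Sum>b\<in>Basis. (snd xu \<bullet> b) *\<^sub>R A2 b (fst xu) (fst h) + (snd h \<bullet> b) *\<^sub>R A (fst xu) b))) (at xu)"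
    if "fst xu \<in> S" for xu
    unfolding F_def E_def
    by (auto intro!: derivative_eq_intros has_derivative_compose[OF _ dA] that simp: that)
  have oS: "open (S \<times> (UNIV :: 'a set))" using S by (simp add: open_Times)
  have inv_lin: "linear (inv (A x))"
    using inj_linear_imp_inv_linear[OF linA[OF x]] bij[OF x] by (simp add: A_def bij_is_inj)
  have "(G has_derivative (\<lambda>h. (fst h, inv (A x) (snd h - M u (fst h))))) (at (F (x, u)))"
  proof (rule has_derivative_inverse_strong[OF oS, of "(x,u)"])
    show "continuous_on (S \<times> UNIV) F"
      by (intro continuous_at_imp_continuous_on ballI has_derivative_continuous[OF dF]) auto
    show "G (F xu) = xu" if "xu \<in> S \<times> UNIV" for xu
      using that unfolding G_def F_def by (cases xu) (auto simp: E Ainv)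
    show "(F has_derivative (\<lambda>h. (fst h, M u (fst h) + A x (snd h)))) (at (x, u))"
      using dF[of "(x,u)"] x
      by (simp add: M_def sum.distrib linear_Basis_expansion[OF linA[OF x], symmetric])
    show "(\<lambda>h. (fst h, M u (fst h) + A x (snd h))) \<circ> (\<lambda>h. (fst h, inv (A x) (snd h - M u (fst h)))) = id"
      by (auto simp: fun_eq_iff Ainv[OF x])
  qed (use x in auto)
  moreover have "F (x, u) = (x, v)"
    unfolding F_def using x by (simp add: E u_def Ainv)
  ultimately have dG: "(G has_derivative (\<lambda>h. (fst h, inv (A x) (snd h - M u (fst h))))) (at (x, v))"
    by simp
  have "((\<lambda>y. snd (G (y, v))) has_derivative (\<lambda>w. snd (w, inv (A x) (0 - M u w)))) (at x)"
    by (intro has_derivative_snd)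
      (auto intro!: has_derivative_eq_rhs[OF has_derivative_compose[of "\<lambda>y. (y,v)", OF _ dG]] derivative_eq_intros)
  moreover have "snd (w, inv (A x) (0 - M u w)) = - inv (A x) (M u w)" for w
    using linear_neg[OF inv_lin] by simp
  ultimately show ?thesis
    unfolding G_def M_def u_def A_def A2_def by simp
qed

text \<open>The derivative of x |-> A(x)^(-1) v is assembled from A(x)^(-1) at fixed basis vectors
  and from second derivatives of f, so each order of smoothness yields the next.\<close>

lemma k_smooth_inverse_operator:
  fixes f :: "'a::euclidean_space \<Rightarrow> 'a"
  assumes S: "open S" "\<And>k. k_smooth k S f"
    and bij: "\<And>x. x \<in> S \<Longrightarrow> bij (frechet_derivative f (at x))"
  shows "k_smooth k S (\<lambda>x. inv (frechet_derivative f (at x)) v)"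
proof (induction k arbitrary: v)
  case 0
  then show ?case
    by (rule k_smooth_0I[OF S(1) has_derivative_inverse_operator[OF S bij]])
next
  case (Suc k)
  define \<Phi> where "\<Phi> v x = inv (frechet_derivative f (at x)) v" for v x
  define D where "D w b x = frechet_derivative (\<lambda>y. frechet_derivative f (at y) b) (at x) w" for w b x
  have IH: "k_smooth k S (\<Phi> v)" for v using Suc unfolding \<Phi>_def by simp
  have D: "k_smooth k S (D w b)" for w b
    using S(2)[of "Suc (Suc k)"] unfolding D_def by simp
  have lin: "linear (\<lambda>v. \<Phi> v x)" if "x \<in> S" for x
  proof -
    have l: "linear (frechet_derivative f (at x))"
      using k_smooth_has_derivative[OF S(2,1) that] has_derivative_linear by blast
    show ?thesis
      unfolding \<Phi>_def
      using bij[OF that] inj_linear_imp_inv_linear[OF l] by (simp add: bij_is_inj)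
  qed
  show ?case
  proof (rule k_smooth_SucI[OF S(1) has_derivative_inverse_operator[OF S bij]])
    fix w
    have "k_smooth k S (\<lambda>x. \<Sum>b\<in>Basis. (\<Phi> v x \<bullet> b) *\<^sub>R (\<Sum>b'\<in>Basis. (D w b x \<bullet> b') *\<^sub>R \<Phi> b' x))"
      by (intro k_smooth_sum k_smooth_bilinear[OF bounded_bilinear_scaleR] k_smooth_bilinear[OF bounded_bilinear_inner]
        S(1) k_smooth_const IH D)
    then have "k_smooth k S (\<lambda>x. (-1) *\<^sub>R (\<Sum>b\<in>Basis. (\<Phi> v x \<bullet> b) *\<^sub>R (\<Sum>b'\<in>Basis. (D w b x \<bullet> b') *\<^sub>R \<Phi> b' x)))"
      by (intro k_smooth_bilinear[OF bounded_bilinear_scaleR] S(1) k_smooth_const)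
    moreover have "(-1) *\<^sub>R (\<Sum>b\<in>Basis. (\<Phi> v x \<bullet> b) *\<^sub>R (\<Sum>b'\<in>Basis. (D w b x \<bullet> b') *\<^sub>R \<Phi> b' x))
       = - \<Phi> (\<Sum>b\<in>Basis. (\<Phi> v x \<bullet> b) *\<^sub>R D w b x) x" if "x \<in> S" for x
      by (simp add: linear_sum[OF lin[OF that]] linear_scale[OF lin[OF that]] linear_Basis_expansion[OF lin[OF that], symmetric])
    ultimately show "k_smooth k S (\<lambda>x. - inv (frechet_derivative f (at x))
         (\<Sum>b\<in>Basis. (inv (frechet_derivative f (at x)) v \<bullet> b) *\<^sub>R
           frechet_derivative (\<lambda>y. frechet_derivative f (at y) b) (at x) w))"
      unfolding \<Phi>_def D_def by (rule k_smooth_cong[OF S(1), rotated])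
  qed
qed

text \<open>The C^1 inverse function theorem gives a local inverse g with derivative Df(g y)^(-1).
  This is a smooth operator function composed with g, so the smoothness of g bootstraps.\<close>

lemma smooth_inverse_function:
  fixes f :: "'a::euclidean_space \<Rightarrow> 'a"
  assumes "smooth_at x f" "inj (frechet_derivative f (at x))"
  obtains U V g where "open U" "x \<in> U" "open V" "homeomorphism U V f g" "smooth_on U f" "smooth_on V g"
proof -
  obtain S where S: "x \<in> S" "open S" "\<And>k. k_smooth k S f" by (rule smooth_atE[OF assms(1)]) blast
  define f' where "f' y = Blinfun (frechet_derivative f (at y))" for y
  have der: "(f has_derivative frechet_derivative f (at y)) (at y)" if "y \<in> S" for y
    using k_smooth_has_derivative[OF S(3,2) that] .
  have f': "blinfun_apply (f' y) = frechet_derivative f (at y)" if "y \<in> S" for y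
    unfolding f'_def using has_derivative_bounded_linear[OF der[OF that]] by (rule bounded_linear_Blinfun_apply)
  have "continuous_on S (\<lambda>y. frechet_derivative f (at y) b)" for b
    using S(3)[of 1] by (simp add: differentiable_imp_continuous_on)
  then have "continuous_on S f'"
    by (intro continuous_on_blinfun_componentwise) (simp add: f' cong: continuous_on_cong)
  moreover obtain h where h: "linear h" "h \<circ> frechet_derivative f (at x) = id"
    using linear_injective_left_inverse[OF has_derivative_linear[OF der[OF S(1)]] assms(2)] by blast
  have "Blinfun h o\<^sub>L f' x = id_blinfun"
    using h S(1) linear_conv_bounded_linear[of h]
    by (intro blinfun_eqI) (simp add: f' bounded_linear_Blinfun_apply fun_eq_iff)
  ultimately obtain U V g g' where U: "open U" "U \<subseteq> S" "x \<in> U" "open V" "f x \<in> V" "homeomorphism U V f g"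
    "\<And>y. y \<in> V \<Longrightarrow> (g has_derivative (g' y)) (at y)"
    "\<And>y. y \<in> V \<Longrightarrow> g' y = inv (blinfun_apply (f' (g y)))"
    "\<And>y. y \<in> V \<Longrightarrow> bij (blinfun_apply (f'(g y)))"
    using inverse_function_theorem[of S f f' x "Blinfun h"] der f' S(1,2) by metis
  have kU: "k_smooth k U f" for k using k_smooth_subset[OF S(3,2) U(1,2)] .
  have gU: "g y \<in> U" if "y \<in> V" for y using U(6) that unfolding homeomorphism_def by blast
  have "bij (frechet_derivative f (at y))" if "y \<in> U" for y
    using U(9)[of "f y"] U(2,6) that f'[of y] unfolding homeomorphism_def by auto
  note sm = k_smooth_inverse_operator[OF U(1) kU this]
  have "k_smooth k V g" for k
  proof (induction k)
    case 0
    show ?case by (rule k_smooth_0I[OF U(4,7)])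
  next
    case (Suc k)
    show ?case
    proof (rule k_smooth_SucI[OF U(4,7)])
      fix v
      have "k_smooth k V (\<lambda>y. inv (frechet_derivative f (at (g y))) v)"
        by (rule k_smooth_compose[OF U(4,1) _ Suc sm]) (use gU in auto)
      then show "k_smooth k V (\<lambda>y. g' y v)"
        by (rule k_smooth_cong[OF U(4), rotated]) (use U(2,8) gU f' in \<open>simp add: subset_iff\<close>)
    qed
  qed
  then show ?thesis
    using that[OF U(1,3,4,6)] kU U(1,4) unfolding smooth_on_iff_k_smooth by blast
qed

section \<open>Local diffeomorphisms and charts\<close>

definition local_diffeo_at :: "'a::euclidean_space \<Rightarrow> ('a \<Rightarrow> 'b::euclidean_space) \<Rightarrow> bool" where
  "local_diffeo_at x f \<longleftrightarrow> smooth_at x f \<and> inj (frechet_derivative f (at x))"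

lemma local_diffeo_atI:
  assumes "smooth_at x f" "(f has_derivative f') (at x)" "\<And>h. f' h = 0 \<Longrightarrow> h = 0"
  shows "local_diffeo_at x f"
  unfolding local_diffeo_at_def
  using assms frechet_derivative_at[OF assms(2)] linear_injective_0[OF has_derivative_linear[OF assms(2)]]
  by metis

lemma local_diffeo_atE:
  assumes "local_diffeo_at x f"
  obtains f' where "smooth_at x f" "(f has_derivative f') (at x)" "linear f'" "\<And>h. f' h = 0 \<Longrightarrow> h = 0"
proof -
  have d: "(f has_derivative frechet_derivative f (at x)) (at x)"
    using assms smooth_at_has_derivative unfolding local_diffeo_at_def by blast
  then show ?thesis
    using that[OF _ d has_derivative_linear[OF d]] assms linear_injective_0[OF has_derivative_linear[OF d]]
    unfolding local_diffeo_at_def by blast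
qed

lemma local_diffeo_at_compose:
  assumes "local_diffeo_at x f" "local_diffeo_at (f x) g"
  shows "local_diffeo_at x (\<lambda>y. g (f y))"
proof -
  obtain f' where f: "smooth_at x f" "(f has_derivative f') (at x)" "linear f'" "\<And>h. f' h = 0 \<Longrightarrow> h = 0"
    by (rule local_diffeo_atE[OF assms(1)]) blast
  obtain g' where g: "smooth_at (f x) g" "(g has_derivative g') (at (f x))" "linear g'" "\<And>h. g' h = 0 \<Longrightarrow> h = 0"
    by (rule local_diffeo_atE[OF assms(2)]) blast
  show ?thesis
    by (rule local_diffeo_atI[OF smooth_at_compose[OF f(1) g(1)] has_derivative_compose[OF f(2) g(2)]])
       (use f(4) g(4) in blast)
qed

lemma local_diffeo_at_linear:
  "bounded_linear L \<Longrightarrow> (\<And>h. L h = 0 \<Longrightarrow> h = 0) \<Longrightarrow> local_diffeo_at x L"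
  using local_diffeo_atI[OF smooth_at_linear bounded_linear_imp_has_derivative] .

text \<open>Source and target have equal dimension but may have different types, while the inverse
  function theorem lives on a single space; a linear isometry L carries it over. The set W allows
  the chart domain to be made as small as desired.\<close>

theorem local_diffeo_at_imp_diffeo_between:
  fixes f :: "'a::euclidean_space \<Rightarrow> 'b::euclidean_space"
  assumes "local_diffeo_at x f" "DIM('a) = DIM('b)" "open W" "x \<in> W"
  obtains U V where "x \<in> U" "U \<subseteq> W" "diffeo_between f U V"
proof -
  obtain L :: "'b \<Rightarrow> 'a" and L' where "linear L" "linear L'" "\<And>x. norm (L x) = norm x"
      "\<And>y. norm (L' y) = norm y" and L: "\<And>x. L' (L x) = x" "\<And>y. L (L' y) = y"
    by (rule isomorphisms_UNIV_UNIV[OF assms(2)[symmetric]]) metis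
  then have L: "bounded_linear L" "bounded_linear L'" "\<And>x. L' (L x) = x" "\<And>y. L (L' y) = y"
    by (auto simp: linear_conv_bounded_linear)
  have L0: "h = 0" if "L h = 0" for h
    using L(3)[of h] that bounded_linear.linear[OF L(2), THEN linear_0] by simp
  have "local_diffeo_at x (\<lambda>y. L (f y))"
    by (rule local_diffeo_at_compose[OF assms(1) local_diffeo_at_linear[OF L(1) L0]])
  then obtain U V g where U: "open U" "x \<in> U" "open V" "homeomorphism U V (\<lambda>y. L (f y)) g"
      "smooth_on U (\<lambda>y. L (f y))" "smooth_on V g"
    using smooth_inverse_function unfolding local_diffeo_at_def by blast
  define U' where "U' = U \<inter> W"
  define V' where "V' = L -` {y \<in> V. g y \<in> W}"
  have op: "open {y \<in> V. g y \<in> W}"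
  proof -
    have "{y \<in> V. g y \<in> W} = V \<inter> g -` W" by auto
    moreover have "continuous_on V g" using U(4) unfolding homeomorphism_def by blast
    ultimately show ?thesis using continuous_open_preimage[OF _ U(3) assms(3)] by metis
  qed
  have oU': "open U'" unfolding U'_def using U(1) assms(3) by blast
  have oV': "open V'" unfolding V'_def
    by (rule continuous_open_vimage[OF op]) (rule linear_continuous_at[OF L(1)])
  have gf: "g (L (f y)) = y" "L (f y) \<in> V" if "y \<in> U" for y
    using U(4) that unfolding homeomorphism_def by blast+
  have fg: "L (f (g y)) = y" "g y \<in> U" if "y \<in> V" for y
    using U(4) that unfolding homeomorphism_def by blast+
  have fgL: "f (g (L y)) = y" if "L y \<in> V" for y
    using fg(1)[OF that] L(3) by metis
  have bij: "bij_betw f U' V'"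
    by (rule bij_betwI[where g="\<lambda>y. g (L y)"]) (auto simp: U'_def V'_def gf fg fgL)
  have inv: "inv_into U' f y = g (L y)" if "y \<in> V'" for y
    using that bij_betw_imp_inj_on[OF bij] by (intro inv_into_f_eq) (auto simp: U'_def V'_def gf fg fgL)
  have kU': "k_smooth k U' f" for k
  proof -
    have "k_smooth k U' (\<lambda>y. L' (L (f y)))"
      using U(5) unfolding smooth_on_iff_k_smooth U'_def
      by (intro k_smooth_compose[OF _ open_UNIV _ _ k_smooth_linear[OF L(2)]])
         (use oU' k_smooth_subset[of k U "\<lambda>y. L (f y)" "U \<inter> W"] in \<open>auto simp: U'_def\<close>)
    then show ?thesis by (simp add: L)
  qed
  have kV': "k_smooth k V' (inv_into U' f)" for k
  proof -
    have "k_smooth k V' (\<lambda>y. g (L y))"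
      by (rule k_smooth_compose[OF oV' U(3) _ k_smooth_linear[OF L(1) oV']])
         (use U(6) in \<open>auto simp: smooth_on_iff_k_smooth V'_def\<close>)
    then show ?thesis by (rule k_smooth_cong[OF oV', rotated]) (simp add: inv)
  qed
  show ?thesis
    by (rule that[of U' V']) (use U(2) assms(4) oU' oV' kU' kV' bij in
        \<open>auto simp: diffeo_between_def smooth_on_iff_k_smooth, auto simp: U'_def\<close>)
qed

text \<open>Differentiating f (g y) = y at f x shows that the derivative of g is injective too, so g
  is again a local diffeomorphism and not merely smooth.\<close>

lemma local_diffeo_at_inverse:
  fixes f :: "'a::euclidean_space \<Rightarrow> 'b::euclidean_space"
  assumes "local_diffeo_at x f" "DIM('a) = DIM('b)"
  obtains g where "local_diffeo_at (f x) g" "g (f x) = x"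
    "\<forall>\<^sub>F y in nhds x. g (f y) = y" "\<forall>\<^sub>F y in nhds (f x). f (g y) = y"
proof -
  obtain U V where U: "x \<in> U" "diffeo_between f U V"
    using local_diffeo_at_imp_diffeo_between[OF assms open_UNIV UNIV_I] by metis
  define g where "g = inv_into U f"
  have U': "open U" "open V" "bij_betw f U V" "smooth_on V g"
    using U(2) unfolding diffeo_between_def g_def by auto
  have fx: "f x \<in> V" using U(1) U'(3) bij_betwE by metis
  have gf: "g (f y) = y" if "y \<in> U" for y
    unfolding g_def using that U'(3) bij_betw_inv_into_left by metis
  have fg: "f (g y) = y" if "y \<in> V" for y
    unfolding g_def using that U'(3) bij_betw_inv_into_right by metis
  have e1: "\<forall>\<^sub>F y in nhds x. g (f y) = y"
    using U(1) U'(1) gf unfolding eventually_nhds by blast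
  have e2: "\<forall>\<^sub>F y in nhds (f x). f (g y) = y"
    using fx U'(2) fg unfolding eventually_nhds by blast
  have sg: "smooth_at (f x) g" unfolding smooth_at_def using U'(4) fx by blast
  obtain g' where g': "(g has_derivative g') (at (f x))" using smooth_at_has_derivative[OF sg] by blast
  obtain f' where f': "(f has_derivative f') (at x)" using assms(1) local_diffeo_atE by metis
  have "((\<lambda>y. f (g y)) has_derivative (\<lambda>h. f' (g' h))) (at (f x))"
    using has_derivative_compose[OF g', of f f'] f' gf[OF U(1)] by simp
  then have "((\<lambda>y. y) has_derivative (\<lambda>h. f' (g' h))) (at (f x))"
    by (rule has_derivative_transform_within_open[OF _ U'(2) fx]) (rule fg)
  then have id: "(\<lambda>h. f' (g' h)) = (\<lambda>h. h)"
    using has_derivative_unique[OF _ has_derivative_ident] by blast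
  have "local_diffeo_at (f x) g"
    by (rule local_diffeo_atI[OF sg g']) (metis id has_derivative_linear[OF f'] linear_0)
  then show ?thesis using that gf[OF U(1)] e1 e2 by blast
qed

text \<open>The germ version of the definition: the chart on the source is shrunk until the identity
  holds on it and g maps it into the domain of the target chart.\<close>

lemma has_local_formI:
  fixes \<phi> :: "complex \<times> complex \<Rightarrow> real ^ 4" and \<psi> :: "complex \<Rightarrow> real ^ 2"
  assumes \<phi>: "local_diffeo_at x \<phi>" "\<phi> x = 0" and \<psi>: "local_diffeo_at (g x) \<psi>" "\<psi> (g x) = 0"
    and g: "isCont g x" and eq: "\<forall>\<^sub>F y in nhds x. \<psi> (g y) = N (\<phi> y)"
  shows "has_local_form g N x"
proof -
  obtain W W' where W: "g x \<in> W" "diffeo_between \<psi> W W'"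
    using local_diffeo_at_imp_diffeo_between[OF \<psi>(1) _ open_UNIV UNIV_I] by auto
  have "open W" using W(2) unfolding diffeo_between_def by blast
  then have "\<forall>\<^sub>F y in nhds x. g y \<in> W"
    using g W(1) topological_tendstoD[of g "g x" "nhds x"] by (simp add: isCont_def tendsto_at_iff_tendsto_nhds)
  with eq have "\<forall>\<^sub>F y in nhds x. g y \<in> W \<and> \<psi> (g y) = N (\<phi> y)" by eventually_elim blast
  then obtain O' where O': "open O'" "x \<in> O'" "\<And>y. y \<in> O' \<Longrightarrow> g y \<in> W \<and> \<psi> (g y) = N (\<phi> y)"
    unfolding eventually_nhds by blast
  obtain U V where "x \<in> U" "U \<subseteq> O'" "diffeo_between \<phi> U V"
    using local_diffeo_at_imp_diffeo_between[OF \<phi>(1) _ O'(1,2)] by auto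
  then show ?thesis
    unfolding has_local_form_def using W \<phi>(2) \<psi>(2) O'(3)
    by (intro exI[of _ U] exI[of _ V] exI[of _ \<phi>] exI[of _ W] exI[of _ W'] exI[of _ \<psi>]) auto
qed

section \<open>Parameter integrals and division by a polynomial\<close>

lemma k_smooth_local:
  assumes "open S" "\<And>x. x \<in> S \<Longrightarrow> \<exists>T. open T \<and> x \<in> T \<and> k_smooth k T f"
  shows "k_smooth k S f"
  using assms(2)
proof (induction k arbitrary: f)
  case 0
  show ?case
    unfolding k_smooth.simps differentiable_on_eq_differentiable_at[OF assms(1)]
    using 0 by (metis differentiable_on_eq_differentiable_at k_smooth.simps(1))
next
  case (Suc k)
  have "f differentiable_on S"
    unfolding differentiable_on_eq_differentiable_at[OF assms(1)]
    using Suc.prems by (metis differentiable_on_eq_differentiable_at k_smooth.simps(2))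
  moreover have "k_smooth k S (\<lambda>x. frechet_derivative f (at x) v)" for v
  proof (rule Suc.IH)
    fix x assume "x \<in> S"
    then obtain T where "open T" "x \<in> T" "k_smooth (Suc k) T f" using Suc.prems by blast
    then show "\<exists>T. open T \<and> x \<in> T \<and> k_smooth k T (\<lambda>x. frechet_derivative f (at x) v)" by auto
  qed
  ultimately show ?case by simp
qed

lemma k_smooth_imp_continuous_on: "k_smooth k S f \<Longrightarrow> continuous_on S f"
  using k_smooth_imp_differentiable_on differentiable_imp_continuous_on by blast

text \<open>Differentiation under the integral sign. \<open>leibniz_rule\<close> asks for a
  continuous family of bounded linear maps, hence the passage to \<open>Blinfun\<close> and
  back.\<close>

lemma has_derivative_parametric_integral:
  fixes H :: "'a::euclidean_space \<times> real \<Rightarrow> 'b::euclidean_space"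
  assumes U: "open U" "open W" "U \<times> {0..1} \<subseteq> W" and H: "k_smooth 1 W H" and x: "x \<in> U"
  shows "((\<lambda>x. integral {0..1} (\<lambda>t. H (x, t))) has_derivative
           (\<lambda>v. integral {0..1} (\<lambda>t. frechet_derivative H (at (x, t)) (v, 0)))) (at x)"
proof -
  obtain e where e: "e > 0" "ball x e \<subseteq> U" using U(1) x by (meson openE)
  define fx where "fx y t = Blinfun (\<lambda>v. frechet_derivative H (at (y, t)) (v, 0))" for y t
  have der: "(H has_derivative frechet_derivative H (at (y, t))) (at (y, t))" if "y \<in> ball x e" "t \<in> {0..1}" for y t
    using k_smooth_has_derivative[OF H U(2), of "(y,t)"] that e(2) U(3) by blast
  have fx: "blinfun_apply (fx y t) = (\<lambda>v. frechet_derivative H (at (y, t)) (v, 0))"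
    if "y \<in> ball x e" "t \<in> {0..1}" for y t
    unfolding fx_def
  proof (rule bounded_linear_Blinfun_apply)
    show "bounded_linear (\<lambda>v. frechet_derivative H (at (y, t)) (v, 0))"
      by (rule bounded_linear_compose[OF has_derivative_bounded_linear[OF der[OF that]]
           bounded_linear_Pair[OF bounded_linear_ident bounded_linear_zero]])
  qed
  have sub: "ball x e \<times> {0..1} \<subseteq> W" using e(2) U(3) by blast
  have cont: "continuous_on (ball x e \<times> {0..1}) (\<lambda>(y, t). fx y t)"
  proof (rule continuous_on_blinfun_componentwise)
    fix i
    have "continuous_on W (\<lambda>p. frechet_derivative H (at p) (i, 0))"
      using H by (simp add: differentiable_imp_continuous_on)
    then have "continuous_on (ball x e \<times> {0..1}) (\<lambda>p. frechet_derivative H (at p) (i, 0))"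
      using sub continuous_on_subset by blast
    then show "continuous_on (ball x e \<times> {0..1}) (\<lambda>p. blinfun_apply (case p of (y, t) \<Rightarrow> fx y t) i)"
      by (rule continuous_on_eq) (auto simp: fx)
  qed
  have contH: "continuous_on {0..1} (\<lambda>t. H (y, t))" if "y \<in> ball x e" for y
    by (rule continuous_on_compose2[OF k_smooth_imp_continuous_on[OF H]])
       (use that sub in \<open>auto intro!: continuous_intros\<close>)
  have "((\<lambda>x. integral (cbox 0 1) (\<lambda>t. H (x, t))) has_derivative integral (cbox 0 1) (fx x)) (at x within ball x e)"
  proof (rule leibniz_rule)
    show "((\<lambda>y. H (y, t)) has_derivative blinfun_apply (fx y t)) (at y within ball x e)"
      if "y \<in> ball x e" "t \<in> cbox 0 1" for y t
    proof -
      have t: "t \<in> {0..1}" using that(2) by simp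
      have "((\<lambda>y. H (y, t)) has_derivative (\<lambda>v. frechet_derivative H (at (y, t)) (v, 0))) (at y)"
        by (rule has_derivative_compose[of "\<lambda>y. (y,t)", OF _ der[OF that(1) t]]) (auto intro!: derivative_eq_intros)
      then show ?thesis
        unfolding fx[OF that(1) t] by (rule has_derivative_at_withinI)
    qed
  qed (use e contH cont in \<open>auto intro!: integrable_continuous_interval\<close>)
  then have "((\<lambda>x. integral {0..1} (\<lambda>t. H (x, t))) has_derivative blinfun_apply (integral {0..1} (fx x))) (at x)"
    using e(1) by (simp add: at_within_open_NO_MATCH)
  moreover have "blinfun_apply (integral {0..1} (fx x)) v = integral {0..1} (\<lambda>t. frechet_derivative H (at (x, t)) (v, 0))" for v
  proof -
    have "continuous_on {0..1} (\<lambda>t. case (x,t) of (y,t) \<Rightarrow> fx y t)"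
      by (rule continuous_on_compose2[OF cont]) (use e in \<open>auto intro!: continuous_intros\<close>)
    then have "fx x integrable_on {0..1}"
      by (auto intro!: integrable_continuous_interval)
    then have "blinfun_apply (integral {0..1} (fx x)) v = integral {0..1} (\<lambda>t. blinfun_apply (fx x t) v)"
      using integral_linear[of "fx x" "{0..1}" "\<lambda>f. blinfun_apply f v"]
      by (simp add: o_def blinfun.bounded_linear_left)
    also have "\<dots> = integral {0..1} (\<lambda>t. frechet_derivative H (at (x, t)) (v, 0))"
      by (intro integral_cong) (use fx[of x] e(1) in auto)
    finally show ?thesis .
  qed
  ultimately show ?thesis
    by (auto elim!: has_derivative_eq_rhs)
qed

lemma k_smooth_parametric_integral:
  fixes H :: "'a::euclidean_space \<times> real \<Rightarrow> 'b::euclidean_space"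
  assumes "open U" "open W" "U \<times> {0..1} \<subseteq> W" "\<And>k. k_smooth k W H"
  shows "k_smooth k U (\<lambda>x. integral {0..1} (\<lambda>t. H (x, t)))"
  using assms(4)
proof (induction k arbitrary: H)
  case 0
  show ?case by (rule k_smooth_0I[OF assms(1) has_derivative_parametric_integral[OF assms(1-3) 0]])
next
  case (Suc k)
  show ?case
  proof (rule k_smooth_SucI[OF assms(1) has_derivative_parametric_integral[OF assms(1-3) Suc.prems]])
    fix v
    show "k_smooth k U (\<lambda>x. integral {0..1} (\<lambda>t. frechet_derivative H (at (x, t)) (v, 0)))"
    proof (rule Suc.IH)
      show "k_smooth j W (\<lambda>p. frechet_derivative H (at p) (v, 0))" for j
        using Suc.prems[of "Suc j"] by simp
    qed
  qed
qed

text \<open>The points where H is smooth form an open set containing the segment over x; since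
  [0, 1] is compact, the tube lemma provides one neighbourhood of x that serves all t.\<close>

lemma smooth_at_parametric_integral:
  fixes H :: "'a::euclidean_space \<times> real \<Rightarrow> 'b::euclidean_space"
  assumes "\<And>t. t \<in> {0..1} \<Longrightarrow> smooth_at (x, t) H"
  shows "smooth_at x (\<lambda>x. integral {0..1} (\<lambda>t. H (x, t)))"
proof -
  define W where "W = {p. smooth_at p H}"
  have W: "open W"
  proof (subst open_subopen, intro ballI)
    fix p assume "p \<in> W"
    then obtain T where T: "p \<in> T" "open T" "\<And>k. k_smooth k T H"
      unfolding W_def by (auto elim: smooth_atE)
    then show "\<exists>T. open T \<and> p \<in> T \<and> T \<subseteq> W"
      unfolding W_def using smooth_atI[OF _ T(2,3)] by blast
  qed
  have kW: "k_smooth k W H" for k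
  proof (rule k_smooth_local[OF W])
    fix p assume "p \<in> W"
    then show "\<exists>T. open T \<and> p \<in> T \<and> k_smooth k T H"
      unfolding W_def by (auto elim: smooth_atE)
  qed
  obtain U where U: "open U" "x \<in> U" "U \<times> {0..1} \<subseteq> W"
  proof -
    have "{x} \<times> {0..1} \<subseteq> W" using assms unfolding W_def by auto
    then show ?thesis using Elementary_Topology.tube_lemma[of "{0..1::real}" W x] W that by blast
  qed
  show ?thesis
    by (rule smooth_atI[OF U(2,1) k_smooth_parametric_integral[OF U(1) W U(3) kW]])
qed


section \<open>Cauchy integrals over a circle and division by a monic polynomial\<close>

definition circ :: "real \<Rightarrow> real \<Rightarrow> complex" where
  "circ r t = of_real r * exp (2 * of_real pi * \<i> * of_real t)"

text \<open>The contour integral of F over the circle divided by 2 pi i, since dw = 2 pi i w dt. In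
  this form it is an integral over [0, 1] to which the smoothness of parameter integrals
  applies.\<close>

definition circle_mean :: "real \<Rightarrow> (complex \<Rightarrow> complex) \<Rightarrow> complex" where
  "circle_mean r F = integral {0..1} (\<lambda>t. F (circ r t) * circ r t)"

lemma contour_integral_circlepath_eq_circle_mean:
  "contour_integral (circlepath 0 r) F = 2 * of_real pi * \<i> * circle_mean r F"
proof -
  have "contour_integral (circlepath 0 r) F = integral {0..1} (\<lambda>t. 2 * of_real pi * \<i> *
      (F (circ r t) * (circ r t)))"
    unfolding contour_integral_integral vector_derivative_circlepath
    by (simp add: circlepath circ_def algebra_simps)
  then show ?thesis
    unfolding circle_mean_def by (simp only: integral_mult_right)
qed

lemma on_circle: "r \<ge> 0 \<Longrightarrow> circ r t \<in> sphere 0 r"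
  by (simp add: circ_def norm_mult)

lemma circle_mean_diff:
  assumes "r > 0" "continuous_on (sphere 0 r) F" "continuous_on (sphere 0 r) G"
  shows "circle_mean r (\<lambda>w. F w - G w) = circle_mean r F - circle_mean r G"
proof -
  have "(\<lambda>t. F (circ r t) * (circ r t)) integrable_on {0..1}"
    if "continuous_on (sphere 0 r) F" for F
    by (intro integrable_continuous_interval continuous_intros continuous_on_compose2[OF that])
       (use on_circle assms(1) in \<open>auto intro!: continuous_intros simp: circ_def norm_mult\<close>)
  then show ?thesis
    using assms unfolding circle_mean_def by (simp add: left_diff_distrib integral_diff)
qed

lemma circle_mean_cmult: "circle_mean r (\<lambda>w. c * F w) = c * circle_mean r F"
  unfolding circle_mean_def by (simp only: mult.assoc integral_mult_right)

lemma circle_mean_cong: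
  assumes "r > 0" "\<And>w. w \<in> sphere 0 r \<Longrightarrow> F w = G w"
  shows "circle_mean r F = circle_mean r G"
  unfolding circle_mean_def using assms on_circle[of r] by (auto intro!: integral_cong)

lemma circle_mean_Cauchy:
  assumes "K holomorphic_on ball 0 R" "0 < r" "r < R" "norm x < r"
  shows "circle_mean r (\<lambda>w. K w / (w - x) ^ Suc k) = (deriv ^^ k) K x / fact k"
proof -
  have "contour_integral (circlepath 0 r) (\<lambda>w. K w / (w - x) ^ Suc k) = (2 * pi * \<i>) * (deriv ^^ k) K x / fact k"
    by (rule Cauchy_contour_integral_circlepath)
       (use assms in \<open>auto intro!: holomorphic_on_imp_continuous_on holomorphic_on_subset[OF assms(1)]\<close>)
  then show ?thesis
    unfolding contour_integral_circlepath_eq_circle_mean by (simp add: field_simps)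
qed

text \<open>One expression for both degrees: a general monic cubic for d = 3, and a monic quadratic
  for d = 2 as long as the last coefficient is 0, a condition that is carried along
  explicitly.\<close>

definition wpoly :: "nat \<Rightarrow> real \<times> real \<times> real \<Rightarrow> complex \<Rightarrow> complex" where
  "wpoly d \<alpha> w = w ^ d - of_real (snd (snd \<alpha>)) * w\<^sup>2 - of_real (fst (snd \<alpha>)) * w - of_real (fst \<alpha>)"

text \<open>For j = 0 this is the Cauchy quotient of K by the polynomial, evaluated at
  \<open>snd y\<close>. At the point 0 the additional powers of w give the integrals of K / (P w^(j
  + 1)) of which the remainder is made.\<close>

definition wquot :: "(complex \<Rightarrow> complex) \<Rightarrow> real \<Rightarrow> nat \<Rightarrow> nat \<Rightarrow> (real \<times> real \<times> real) \<times> real \<Rightarrow> complex" where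
  "wquot K r d j y = circle_mean r (\<lambda>w. K w / (wpoly d (fst y) w * w ^ j * (w - of_real (snd y))))"

lemma smooth_at_wquot:
  assumes K: "K holomorphic_on ball 0 R" and r: "0 < r" "r < R"
    and P: "\<And>w. w \<in> sphere 0 r \<Longrightarrow> wpoly d (fst y) w \<noteq> 0" and x: "\<bar>snd y\<bar> < r"
  shows "smooth_at y (wquot K r d j)"
proof -
  let ?w = "\<lambda>p::((real \<times> real \<times> real) \<times> real) \<times> real. circ r (snd p)"
  have "smooth_at y (\<lambda>y. integral {0..1} (\<lambda>t. (\<lambda>p. K (?w p) / (wpoly d (fst (fst p)) (?w p) * ?w p ^ j *
      (?w p - of_real (snd (fst p)))) * ?w p) (y, t)))"
  proof (rule smooth_at_parametric_integral)
    fix t :: real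
    have w: "smooth_at (y, t) ?w"
      unfolding circ_def by (intro smooth_intros smooth_at_analytic_compose[where h=exp] analytic_intros)
    have s: "?w (y, t) \<in> sphere 0 r" using on_circle[of r t] r by simp
    have "K analytic_on {?w (y, t)}"
      using K s r(2) by (intro analytic_on_subset[OF analytic_on_open[THEN iffD2, OF open_ball K]]) auto
    then have KK: "smooth_at (y, t) (\<lambda>p. K (?w p))"
      by (rule smooth_at_analytic_compose[OF w])
    have ne: "?w (y, t) - of_real (snd y) \<noteq> 0"
      using s x norm_of_real[of "snd y", where 'a=complex] by (auto simp: eq_iff_diff_eq_0[symmetric])
    show "smooth_at (y, t) (\<lambda>p. K (?w p) / (wpoly d (fst (fst p)) (?w p) * ?w p ^ j * (?w p - of_real (snd (fst p)))) * ?w p)"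
      unfolding wpoly_def
      by (intro smooth_intros KK w) (use P[OF s] ne r s in \<open>auto simp: wpoly_def\<close>)
  qed
  then show ?thesis
    by (simp add: wquot_def[abs_def] circle_mean_def)
qed

text \<open>P(x) times the quotient differs from K(x) by the integral of K(w) (P(w) - P(x)) / ((w -
  x) P(w)), a polynomial in x of degree below d. The vanishing derivatives of K at 0 remove the part
  of it that is free of a0, a1, a2; what is left is triangular in these coefficients, with the
  integral \<open>U 0\<close> on the diagonal.\<close>

lemma wpoly_division:
  assumes K: "K holomorphic_on ball 0 R" and r: "0 < r" "r < R"
    and K0: "K 0 = 0" "deriv K 0 = 0" "d = 3 \<Longrightarrow> (deriv ^^ 2) K 0 = 0"
    and d: "d = 2 \<and> a2 = 0 \<or> d = 3"
    and P: "\<And>w. w \<in> sphere 0 r \<Longrightarrow> wpoly d (a0, a1, a2) w \<noteq> 0" and x: "\<bar>x\<bar> < r"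
  defines "U \<equiv> \<lambda>j. wquot K r d j ((a0, a1, a2), 0)"
  shows "wpoly d (a0, a1, a2) x * wquot K r d 0 ((a0, a1, a2), x) =
     K x - of_real a0 * U 0 - x * (of_real a1 * U 0 + of_real a0 * U 1)
      - (if d = 3 then x\<^sup>2 * (of_real a2 * U 0 + of_real a1 * U 1 + of_real a0 * U 2) else 0)"
proof -
  let ?P = "wpoly d (a0, a1, a2)"
  let ?C = "continuous_on (sphere 0 r)"
  define F where "F j w = K w / (?P w * w ^ j * (w - of_real 0))" for j w
  \<comment> \<open>Switches the x^2 terms off in degree 2, so that one computation covers both
    degrees.\<close>
  define e :: complex where "e = (if d = 3 then 1 else 0)"
  define Q where "Q k w = K w / (w - 0) ^ Suc k" for k w
  have cK: "?C K"
    by (intro holomorphic_on_imp_continuous_on holomorphic_on_subset[OF K]) (use r in auto)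
  have cP: "?C ?P" unfolding wpoly_def by (intro continuous_intros)
  have w0: "w \<noteq> 0" if "w \<in> sphere 0 r" for w :: complex using that r by auto
  have wx: "w - of_real x \<noteq> 0" if "w \<in> sphere 0 r" for w :: complex
    using that x by auto
  have cF: "?C (F j)" for j
    unfolding F_def by (intro continuous_intros cK cP) (use P w0 in auto)
  have cQ: "?C (Q k)" for k
    unfolding Q_def by (intro continuous_intros cK) (use w0 in auto)
  have cX: "?C (\<lambda>w. K w / (w - of_real x))"
    by (intro continuous_intros cK) (use wx in auto)
  have id: "?P x * (K w / (?P w * w ^ 0 * (w - of_real x))) =
       K w / (w - of_real x) - Q 0 w - x * Q 1 w - e * x\<^sup>2 * Q 2 w - a0 * F 0 w
       - x * a1 * F 0 w - x * a0 * F 1 w - e * x\<^sup>2 * a2 * F 0 w - e * x\<^sup>2 * a1 * F 1 w - e * x\<^sup>2 * a0 * F 2 w"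
    if w: "w \<in> sphere 0 r" for w
  proof -
    have Pw: "?P w \<noteq> 0" using P[OF w] .
    have 1: "Q 0 w + a0 * F 0 w = K w * ((?P w + a0) / w) / ?P w"
      unfolding Q_def F_def using Pw w0[OF w] by (simp add: field_simps)
    have 2: "Q 1 w + a1 * F 0 w + a0 * F 1 w = K w * ((?P w + a0 + a1 * w) / w\<^sup>2) / ?P w"
      unfolding Q_def F_def using Pw w0[OF w] by (simp add: field_simps power2_eq_square)
    have 3: "Q 2 w + a2 * F 0 w + a1 * F 1 w + a0 * F 2 w = K w * ((?P w + a0 + a1 * w + a2 * w\<^sup>2) / w ^ 3) / ?P w"
      unfolding Q_def F_def using Pw w0[OF w] by (simp add: field_simps power2_eq_square power3_eq_cube)
    \<comment> \<open>The expansion of (P(w) - P(x)) / (w - x) in powers of x: the coefficient of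
      x^i is P(w) without its terms of degree at most i, divided by w^(i + 1).\<close>
    have 4: "?P w - ?P x = (w - x) * ((?P w + a0) / w + x * ((?P w + a0 + a1 * w) / w\<^sup>2)
        + e * x\<^sup>2 * ((?P w + a0 + a1 * w + a2 * w\<^sup>2) / w ^ 3))"
    proof (cases "d = 3")
      case True
      have "(?P w + a0) / w = w\<^sup>2 - a2 * w - a1" "(?P w + a0 + a1 * w) / w\<^sup>2 = w - a2"
        "(?P w + a0 + a1 * w + a2 * w\<^sup>2) / w ^ 3 = 1"
        unfolding wpoly_def using w0[OF w] True by (auto simp: field_simps power2_eq_square power3_eq_cube)
      then show ?thesis
        by (simp only:) (simp add: wpoly_def True e_def algebra_simps power2_eq_square power3_eq_cube)
    next
      case False
      then have dd: "d = 2" "a2 = 0" using d by auto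
      have "(?P w + a0) / w = w - a1" "(?P w + a0 + a1 * w) / w\<^sup>2 = 1"
        unfolding wpoly_def using w0[OF w] dd by (auto simp: field_simps power2_eq_square)
      then show ?thesis
        by (simp only:) (simp add: wpoly_def dd e_def algebra_simps power2_eq_square)
    qed
    have "C * (k / (B * w ^ 0 * A)) = k / A - k * (B - C) / (A * B)" if "A \<noteq> 0" "B \<noteq> 0" for A B C k :: complex
      using that by (simp add: field_simps)
    from this[OF wx[OF w] Pw]
    have "?P x * (K w / (?P w * w ^ 0 * (w - of_real x))) = K w / (w - of_real x) - K w * (?P w - ?P x) / ((w - x) * ?P w)" .
    also have "K w * (?P w - ?P x) / ((w - x) * ?P w) = (Q 0 w + a0 * F 0 w) + x * (Q 1 w + a1 * F 0 w + a0 * F 1 w)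
        + e * x\<^sup>2 * (Q 2 w + a2 * F 0 w + a1 * F 1 w + a0 * F 2 w)"
    proof -
      have "k * (A * (X + c * Y + E * Z)) / (A * B) = k * X / B + c * (k * Y / B) + E * (k * Z / B)"
        if "A \<noteq> 0" "B \<noteq> 0" for A B X Y Z E c k :: complex
        using that by (simp add: field_simps)
      from this[OF wx[OF w] Pw] show ?thesis unfolding 1 2 3 4 .
    qed
    finally show ?thesis by (simp add: algebra_simps)
  qed
  have U: "circle_mean r (F j) = U j" for j
    unfolding F_def U_def wquot_def by simp
  have Q: "circle_mean r (Q k) = (deriv ^^ k) K 0 / fact k" for k
    unfolding Q_def by (rule circle_mean_Cauchy[OF K r]) (use r in simp)
  have X: "circle_mean r (\<lambda>w. K w / (w - of_real x)) = K x"
    using circle_mean_Cauchy[OF K r, of "of_real x" 0] x by simp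
  have "?P x * wquot K r d 0 ((a0, a1, a2), x) = circle_mean r (\<lambda>w. ?P x * (K w / (?P w * w ^ 0 * (w - of_real x))))"
    unfolding circle_mean_cmult wquot_def by simp
  also have "\<dots> = circle_mean r (\<lambda>w. K w / (w - of_real x) - Q 0 w - x * Q 1 w - e * x\<^sup>2 * Q 2 w - a0 * F 0 w
       - x * a1 * F 0 w - x * a0 * F 1 w - e * x\<^sup>2 * a2 * F 0 w - e * x\<^sup>2 * a1 * F 1 w - e * x\<^sup>2 * a0 * F 2 w)"
    by (rule circle_mean_cong[OF r(1) id])
  also have "\<dots> = K x - circle_mean r (Q 0) - x * circle_mean r (Q 1) - e * x\<^sup>2 * circle_mean r (Q 2) - a0 * U 0
       - x * a1 * U 0 - x * a0 * U 1 - e * x\<^sup>2 * a2 * U 0 - e * x\<^sup>2 * a1 * U 1 - e * x\<^sup>2 * a0 * U 2"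
    by (simp add: circle_mean_diff circle_mean_cmult r(1) cF cQ cX X U continuous_intros)
  finally show ?thesis
    using Q[of 0] Q[of 1] Q[of 2] K0 by (auto simp: e_def algebra_simps)
qed

section \<open>Fold and cusp normal forms\<close>

lemma eventually_nhds_isCont:
  assumes "isCont f x" "\<forall>\<^sub>F y in nhds (f x). P y"
  shows "\<forall>\<^sub>F y in nhds x. P (f y)"
  using assms unfolding isCont_def tendsto_at_iff_tendsto_nhds
  by (rule filterlim_iff[THEN iffD1, rule_format])

lemma eventually_nhds_less:
  fixes f :: "'a::t2_space \<Rightarrow> real"
  assumes "isCont f x" "f x < c"
  shows "\<forall>\<^sub>F y in nhds x. f y < c"
  using assms unfolding isCont_def tendsto_at_iff_tendsto_nhds by (rule order_tendstoD(2))

text \<open>Here y stands for ((eta, t), s): with the coefficients A(eta, t), the function Re K(s) +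
  eta s - t is divisible by the polynomial in s, with quotient u. This is a Weierstrass polynomial
  and its unit, for this one family.\<close>

definition division_identity where
  "division_identity K d A u y \<longleftrightarrow> (\<forall>a0 a1 a2. A (fst y) = (a0, a1, a2 :: real) \<longrightarrow>
     (snd y ^ d - a2 * (snd y)\<^sup>2 - a1 * snd y - a0) * u (A (fst y), snd y)
       = Re (K (of_real (snd y) :: complex)) + fst (fst y) * snd y - snd (fst y) \<and> (d = (2::nat) \<longrightarrow> a2 = 0))"

text \<open>Only K is divided, by a polynomial with undetermined coefficients; these are then chosen
  so that the remainder is t - eta s. The inverse function theorem applies because the map from
  coefficients to remainder has, up to order, a triangular derivative at 0 with diagonal entries
  plus or minus Re K^(d)(0) / d!, and 1 in the spare slot when d = 2. All coefficients being real,
  taking real parts of the complex division is harmless.\<close>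

lemma weierstrass_germ:
  assumes K: "K holomorphic_on ball 0 R" "R > 0"
    and K0: "K 0 = 0" "deriv K 0 = 0" "d = 3 \<Longrightarrow> (deriv ^^ 2) K 0 = 0"
    and d: "d = 2 \<or> d = 3" and Kd: "Re ((deriv ^^ d) K 0) \<noteq> 0"
  obtains A :: "real \<times> real \<Rightarrow> real \<times> real \<times> real" and A'
      and u :: "(real \<times> real \<times> real) \<times> real \<Rightarrow> real"
    where "smooth_at 0 A" "A 0 = 0" "smooth_at 0 u" "u 0 = Re ((deriv ^^ d) K 0) / fact d"
      "(A has_derivative A') (at 0)"
      "\<And>h. fst (A' h) = 0 \<Longrightarrow> fst (snd (A' h)) = 0 \<Longrightarrow> h = 0"
      "\<And>h. fst (A' h) = 0 \<longleftrightarrow> snd h = 0"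
      "\<forall>\<^sub>F y in nhds 0. division_identity K d A u y"
proof -
  define r where "r = R / 2"
  have r: "0 < r" "r < R" using K(2) by (auto simp: r_def)
  define u where "u y = Re (wquot K r d 0 y)" for y
  define U where "U j \<alpha> = Re (wquot K r d j (\<alpha>, 0))" for j \<alpha>
  have P0: "wpoly d (fst 0) w \<noteq> 0" if "w \<in> sphere 0 r" for w
    using that r by (auto simp: wpoly_def)
  have sw: "smooth_at 0 (wquot K r d j)" for j
    by (rule smooth_at_wquot[OF K(1) r P0]) (use r in auto)
  have su: "smooth_at 0 u" unfolding u_def by (intro smooth_intros sw)
  have sU: "smooth_at 0 (U j)" for j
    unfolding U_def
    by (intro smooth_intros smooth_at_compose[where f="\<lambda>\<alpha>. (\<alpha>, 0)" and g="wquot K r d j"])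
       (use sw[of j] in \<open>simp add: zero_prod_def\<close>)
  define k0 where "k0 = Re ((deriv ^^ d) K 0) / fact d"
  have U0: "U 0 0 = k0"
  proof -
    have "circle_mean r (\<lambda>w. K w / (w - 0) ^ Suc d) = (deriv ^^ d) K 0 / fact d"
      by (rule circle_mean_Cauchy[OF K(1) r]) (use r in simp)
    then show ?thesis
      unfolding U_def k0_def wquot_def wpoly_def
      using Re_divide_of_real[of "(deriv ^^ d) K 0" "fact d"] by (simp add: mult.commute)
  qed
  have k0: "k0 \<noteq> 0" using Kd by (simp add: k0_def)
  \<comment> \<open>Solving c(alpha) = (eta, t, 0) prescribes the remainder t - eta s. In degree 2
    the third entry is a2 itself, so the same equation forces a2 = 0.\<close>
  define c where "c \<alpha> = (- (fst (snd \<alpha>) * U 0 \<alpha>) - fst \<alpha> * U 1 \<alpha>, fst \<alpha> * U 0 \<alpha>,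
     if d = 3 then - (snd (snd \<alpha>) * U 0 \<alpha>) - fst (snd \<alpha>) * U 1 \<alpha> - fst \<alpha> * U 2 \<alpha> else snd (snd \<alpha>))" for \<alpha>
  define c' where "c' h = (- (fst (snd h) * k0) - fst h * U 1 0, fst h * k0,
     if d = 3 then - (snd (snd h) * k0) - fst (snd h) * U 1 0 - fst h * U 2 0 else snd (snd h))" for h
  have sc: "smooth_at 0 c"
    unfolding c_def by (cases "d = 3") (auto intro!: smooth_intros sU)
  have dU: "(U j has_derivative frechet_derivative (U j) (at 0)) (at 0)" for j
    by (rule smooth_at_has_derivative[OF sU])
  have dc: "(c has_derivative c') (at 0)"
  proof -
    have 1: "((\<lambda>\<alpha>. fst \<alpha> * U j \<alpha>) has_derivative (\<lambda>h. fst h * U j 0)) (at 0)"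
      "((\<lambda>\<alpha>. fst (snd \<alpha>) * U j \<alpha>) has_derivative (\<lambda>h. fst (snd h) * U j 0)) (at 0)"
      "((\<lambda>\<alpha>. snd (snd \<alpha>) * U j \<alpha>) has_derivative (\<lambda>h. snd (snd h) * U j 0)) (at 0)" for j
      by (auto intro!: derivative_eq_intros dU)
    have e: "c' = (\<lambda>h. (- (fst (snd h) * U 0 0) - fst h * U 1 0, fst h * U 0 0,
     if d = 3 then - (snd (snd h) * U 0 0) - fst (snd h) * U 1 0 - fst h * U 2 0 else snd (snd h)))"
      unfolding c'_def U0 ..
    show ?thesis
      unfolding c_def e
      by (cases "d = 3") (auto intro!: has_derivative_Pair has_derivative_diff has_derivative_minus 1 derivative_eq_intros)
  qed
  have ld: "local_diffeo_at 0 c"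
    by (rule local_diffeo_atI[OF sc dc]) (use k0 in \<open>auto simp: c'_def prod_eq_iff split: if_splits\<close>)
  have c0: "c 0 = 0" by (simp add: c_def zero_prod_def)
  obtain B where B: "local_diffeo_at 0 B" "B 0 = 0" and cB: "\<forall>\<^sub>F y in nhds 0. c (B y) = y"
    by (rule local_diffeo_at_inverse[OF ld refl]) (auto simp: c0)
  obtain B' where B': "smooth_at 0 B" "(B has_derivative B') (at 0)"
    using B(1) by (auto elim!: local_diffeo_atE)
  have cB': "c' (B' h) = h" for h
  proof -
    obtain T where T: "open T" "0 \<in> T" "\<And>y. y \<in> T \<Longrightarrow> c (B y) = y"
      using cB unfolding eventually_nhds by blast
    have "((\<lambda>y. c (B y)) has_derivative (\<lambda>h. c' (B' h))) (at 0)"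
      by (rule has_derivative_compose[OF B'(2)]) (simp add: B(2) dc)
    then have "((\<lambda>y. y) has_derivative (\<lambda>h. c' (B' h))) (at 0)"
      by (rule has_derivative_transform_within_open[OF _ T(1,2)]) (rule T(3))
    then have "(\<lambda>h. c' (B' h)) = (\<lambda>h. h)"
      using has_derivative_unique[OF _ has_derivative_ident] by blast
    then show ?thesis by meson
  qed
  define A where "A y = B (fst y, snd y, 0)" for y :: "real \<times> real"
  define A' where "A' h = B' (fst h, snd h, 0)" for h :: "real \<times> real"
  have sA: "smooth_at 0 A"
    unfolding A_def
    by (rule smooth_at_compose[where g=B]) (auto intro!: smooth_intros B'(1) simp flip: zero_prod_def)
  have dA: "(A has_derivative A') (at 0)"
    unfolding A_def A'_def
    by (rule has_derivative_compose[of "\<lambda>y. (fst y, snd y, 0)"])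
       (auto intro!: derivative_eq_intros simp: B'(2) simp flip: zero_prod_def)
  have A0: "A 0 = 0" using B(2) by (simp add: A_def flip: zero_prod_def)
  \<comment> \<open>For small coefficients the leading term w^d dominates on the circle, so the
    integrands of all the Cauchy integrals stay finite.\<close>
  have good: "\<forall>\<^sub>F \<alpha> in nhds 0. \<forall>w\<in>sphere 0 r. wpoly d \<alpha> w \<noteq> 0"
  proof -
    have "isCont (\<lambda>\<alpha>::real\<times>real\<times>real. \<bar>fst \<alpha>\<bar> + \<bar>fst (snd \<alpha>)\<bar> * r + \<bar>snd (snd \<alpha>)\<bar> * r\<^sup>2) 0"
      by (intro continuous_intros)
    then have "\<forall>\<^sub>F \<alpha> in nhds (0::real\<times>real\<times>real). \<bar>fst \<alpha>\<bar> + \<bar>fst (snd \<alpha>)\<bar> * r + \<bar>snd (snd \<alpha>)\<bar> * r\<^sup>2 < r ^ d"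
      by (rule eventually_nhds_less) (use r in simp)
    then show ?thesis
    proof eventually_elim
      case (elim \<alpha>)
      show ?case
      proof (intro ballI notI)
        fix w :: complex assume w: "w \<in> sphere 0 r" and "wpoly d \<alpha> w = 0"
        then have "w ^ d = of_real (snd (snd \<alpha>)) * w\<^sup>2 + of_real (fst (snd \<alpha>)) * w + of_real (fst \<alpha>)"
          by (simp add: wpoly_def algebra_simps)
        then have "norm w ^ d \<le> norm (of_real (snd (snd \<alpha>)) * w\<^sup>2) + norm (of_real (fst (snd \<alpha>)) * w) + norm (of_real (fst \<alpha>) :: complex)"
          by (metis norm_power norm_triangle_mono norm_triangle_ineq order_refl)
        then show False using elim w by (simp add: norm_mult norm_power)
      qed
    qed
  qed
  have contA: "isCont (\<lambda>y :: (real \<times> real) \<times> real. A (fst y)) 0"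
    using smooth_at_isCont[OF smooth_at_compose[where f=fst and g=A and x="0::(real \<times> real) \<times> real"]] sA
    by (simp add: smooth_at_linear[OF bounded_linear_fst])
  have "\<forall>\<^sub>F y in nhds (0::(real \<times> real) \<times> real). \<forall>w\<in>sphere 0 r. wpoly d (A (fst y)) w \<noteq> 0"
    using good by (intro eventually_nhds_isCont[OF contA]) (simp add: A0)
  moreover have "\<forall>\<^sub>F y in nhds (0::(real \<times> real) \<times> real). \<bar>snd y\<bar> < r"
    by (rule eventually_nhds_less) (use r in \<open>auto intro!: continuous_intros\<close>)
  moreover have "\<forall>\<^sub>F y in nhds (0::(real \<times> real) \<times> real). c (A (fst y)) = (fst (fst y), snd (fst y), 0)"
    unfolding A_def
    by (rule eventually_nhds_isCont[where P="\<lambda>z. c (B z) = z"])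
       (use cB in \<open>auto intro!: continuous_intros simp flip: zero_prod_def\<close>)
  ultimately have main: "\<forall>\<^sub>F y in nhds 0. division_identity K d A u y"
  proof eventually_elim
    case (elim y)
    show ?case
      unfolding division_identity_def
    proof (intro allI impI)
      fix a0 a1 a2 assume a: "A (fst y) = (a0, a1, a2)"
      let ?s = "snd y" and ?U = "\<lambda>j. wquot K r d j ((a0, a1, a2), 0)"
      have c: "c (a0, a1, a2) = (fst (fst y), snd (fst y), 0)" using elim(3) a by simp
      then have a2: "d = 2 \<Longrightarrow> a2 = 0" by (simp add: c_def)
      have "wpoly d (a0, a1, a2) (of_real ?s) * wquot K r d 0 ((a0, a1, a2), ?s) =
         K (of_real ?s) - of_real a0 * ?U 0 - of_real ?s * (of_real a1 * ?U 0 + of_real a0 * ?U 1)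
         - (if d = 3 then (of_real ?s)\<^sup>2 * (of_real a2 * ?U 0 + of_real a1 * ?U 1 + of_real a0 * ?U 2) else 0)"
        by (rule wpoly_division[OF K(1) r K0]) (use d a2 elim a in auto)
      moreover have "wpoly d (a0, a1, a2) (of_real ?s) = of_real (?s ^ d - a2 * ?s\<^sup>2 - a1 * ?s - a0)"
        by (simp add: wpoly_def)
      ultimately have "Re (of_real (?s ^ d - a2 * ?s\<^sup>2 - a1 * ?s - a0) * wquot K r d 0 ((a0, a1, a2), ?s)) =
        Re (K (of_real ?s) - of_real a0 * ?U 0 - of_real ?s * (of_real a1 * ?U 0 + of_real a0 * ?U 1)
         - of_real (?s\<^sup>2) * (if d = 3 then (of_real a2 * ?U 0 + of_real a1 * ?U 1 + of_real a0 * ?U 2) else 0))"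
        by (auto simp del: of_real_diff)
      then have "(?s ^ d - a2 * ?s\<^sup>2 - a1 * ?s - a0) * u ((a0, a1, a2), ?s) =
          Re (K (of_real ?s)) - a0 * U 0 (a0, a1, a2) - ?s * (a1 * U 0 (a0, a1, a2) + a0 * U 1 (a0, a1, a2))
          - ?s\<^sup>2 * (if d = 3 then a2 * U 0 (a0, a1, a2) + a1 * U 1 (a0, a1, a2) + a0 * U 2 (a0, a1, a2) else 0)"
        unfolding u_def U_def by (cases "d = 3") (simp_all del: of_real_power)
      moreover have "a0 * U 0 (a0, a1, a2) = snd (fst y)"
         "a1 * U 0 (a0, a1, a2) + a0 * U 1 (a0, a1, a2) = - fst (fst y)"
         "(if d = 3 then a2 * U 0 (a0, a1, a2) + a1 * U 1 (a0, a1, a2) + a0 * U 2 (a0, a1, a2) else 0) = 0"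
        using c by (auto simp: c_def)
      ultimately show "(?s ^ d - a2 * ?s\<^sup>2 - a1 * ?s - a0) * u (A (fst y), ?s)
           = Re (K (of_real ?s)) + fst (fst y) * ?s - snd (fst y) \<and> (d = 2 \<longrightarrow> a2 = 0)"
        using a a2 by (simp only: a) (simp add: mult.commute)
    qed
  qed
  show ?thesis
  proof (rule that[OF sA A0 su _ dA _ _ main])
    show "u 0 = Re ((deriv ^^ d) K 0) / fact d"
      using U0 by (simp add: u_def U_def k0_def zero_prod_def)
    show "h = 0" if "fst (A' h) = 0" "fst (snd (A' h)) = 0" for h
      using cB'[of "(fst h, snd h, 0)"] that by (auto simp: A'_def c'_def prod_eq_iff)
    show "fst (A' h) = 0 \<longleftrightarrow> snd h = 0" for h
      using cB'[of "(fst h, snd h, 0)"] k0 by (auto simp: A'_def c'_def prod_eq_iff)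
  qed
qed


text \<open>The model germ, with slope s and with X, Y the real and imaginary parts of a Morse
  coordinate. K may take complex values; only its real part on the real axis enters. The sign e will
  be matched to the sign of the leading derivative of Re K.\<close>

definition quad_map :: "(complex \<Rightarrow> complex) \<Rightarrow> real \<Rightarrow> real \<times> real \<times> real \<times> real \<Rightarrow> real \<times> real" where
  "quad_map K e = (\<lambda>(\<eta>, s, X, Y). (\<eta>, s * \<eta> + Re (K (of_real s)) + e * (X\<^sup>2 - Y\<^sup>2)))"

lemma quad_map_eq: "quad_map K e = (\<lambda>p. (fst p, fst (snd p) * fst p + Re (K (of_real (fst (snd p))))
   + e * ((fst (snd (snd p)))\<^sup>2 - (snd (snd (snd p)))\<^sup>2)))"
  by (auto simp: quad_map_def)

definition prepared where
  "prepared K e d A w p \<longleftrightarrow> (\<forall>\<eta> s X Y a0 a1 a2. p = (\<eta>, s, X, Y) \<longrightarrow> A (quad_map K e p) = (a0, a1, a2 :: real) \<longrightarrow>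
     s ^ d - a2 * s\<^sup>2 - a1 * s - a0 = (Y * w p)\<^sup>2 - (X * w p)\<^sup>2 \<and> (d = (2::nat) \<longrightarrow> a2 = 0))"

text \<open>On the image of the model, t - s eta - Re K(s) equals e (X^2 - Y^2), so the division
  identity becomes P(s) u = - e (X^2 - Y^2). Near 0 the product e u is positive, and w = (e
  u)^(-1/2) absorbs it into X and Y.\<close>

lemma prepared_quad_map:
  assumes K: "K holomorphic_on ball 0 R" "R > 0"
    and K0: "K 0 = 0" "deriv K 0 = 0" "d = 3 \<Longrightarrow> (deriv ^^ 2) K 0 = 0"
    and d: "d = 2 \<or> d = 3" and e: "e = 1 \<or> e = -1" and Kd: "e * Re ((deriv ^^ d) K 0) > 0"
  obtains A :: "real \<times> real \<Rightarrow> real \<times> real \<times> real" and A'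
      and w :: "real \<times> real \<times> real \<times> real \<Rightarrow> real"
    where "smooth_at 0 A" "A 0 = 0" "(A has_derivative A') (at 0)"
      "\<And>h. fst (A' h) = 0 \<Longrightarrow> fst (snd (A' h)) = 0 \<Longrightarrow> h = 0"
      "\<And>h. fst (A' h) = 0 \<longleftrightarrow> snd h = 0"
      "smooth_at 0 w" "w 0 \<noteq> 0"
      "smooth_at 0 (\<lambda>p. A (quad_map K e p))" "((\<lambda>p. A (quad_map K e p)) has_derivative (\<lambda>h. A' (fst h, 0))) (at 0)"
      "\<forall>\<^sub>F p in nhds 0. prepared K e d A w p"
proof -
  have nz: "Re ((deriv ^^ d) K 0) \<noteq> 0" using Kd by auto
  obtain A A' u where A: "smooth_at 0 A" "A 0 = 0" and u: "smooth_at 0 u" "u 0 = Re ((deriv ^^ d) K 0) / fact d"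
      and A': "(A has_derivative A') (at 0)"
      "\<And>h. fst (A' h) = 0 \<Longrightarrow> fst (snd (A' h)) = 0 \<Longrightarrow> h = 0"
      "\<And>h. fst (A' h) = 0 \<longleftrightarrow> snd h = 0"
      and ev: "\<forall>\<^sub>F y in nhds 0. division_identity K d A u y"
    by (rule weierstrass_germ[OF K K0 d nz]) auto
  have Kan: "K analytic_on {0}"
    using K by (intro analytic_on_subset[OF analytic_on_open[THEN iffD2, OF open_ball K(1)]]) auto
  have sK: "smooth_at 0 (\<lambda>p::real \<times> real \<times> real \<times> real. K (of_real (fst (snd p))))"
    by (rule smooth_at_analytic_compose[where h=K]) (auto intro!: smooth_intros Kan)
  have sq: "smooth_at 0 (quad_map K e)"
    unfolding quad_map_eq by (intro smooth_intros sK)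
  have q0: "quad_map K e 0 = 0" using K0 by (simp add: quad_map_eq zero_prod_def)
  have dK: "(K has_field_derivative 0) (at 0)"
    using holomorphic_derivI[OF K(1) open_ball, of 0] K(2) K0 by simp
  have dRK: "((\<lambda>p::real \<times> real \<times> real \<times> real. K (of_real (fst (snd p)))) has_derivative (\<lambda>h. 0)) (at 0)"
  proof -
    have d1: "((\<lambda>p::real \<times> real \<times> real \<times> real. complex_of_real (fst (snd p))) has_derivative (\<lambda>h. of_real (fst (snd h)))) (at 0)"
      by (auto intro!: derivative_eq_intros)
    have d2: "(K has_derivative (\<lambda>z. 0)) (at (complex_of_real (fst (snd (0::real \<times> real \<times> real \<times> real)))))"
      using dK by (simp add: has_field_derivative_def lambda_zero)
    show ?thesis
      by (rule has_derivative_compose[OF d1 d2])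
  qed
  have dq: "(quad_map K e has_derivative (\<lambda>h. (fst h, 0))) (at 0)"
    unfolding quad_map_eq by (auto intro!: derivative_eq_intros dRK)
  have sAq: "smooth_at 0 (\<lambda>p. A (quad_map K e p))"
    by (rule smooth_at_compose[OF sq]) (simp add: q0 A)
  have dAq: "((\<lambda>p. A (quad_map K e p)) has_derivative (\<lambda>h. A' (fst h, 0))) (at 0)"
    by (rule has_derivative_compose[OF dq]) (simp add: q0 A')
  define U where "U p = e * u (A (quad_map K e p), fst (snd p))" for p
  have sU: "smooth_at 0 U"
    unfolding U_def
    by (intro smooth_intros smooth_at_compose[where g=u and f="\<lambda>p. (A (quad_map K e p), fst (snd p))"] sAq)
       (simp add: q0 A u flip: zero_prod_def)
  have U0: "U 0 > 0" using Kd by (simp add: U_def q0 A u flip: zero_prod_def)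
  define w where "w p = 1 / sqrt (U p)" for p
  have sw: "smooth_at 0 w" unfolding w_def by (intro smooth_intros sU) (use U0 in auto)
  have "\<forall>\<^sub>F p in nhds 0. - U p < 0"
    by (rule eventually_nhds_less) (use U0 smooth_at_isCont[OF sU] in auto)
  moreover have "isCont (\<lambda>p. (quad_map K e p, fst (snd p))) 0"
    by (intro continuous_intros smooth_at_isCont[OF sq])
  from eventually_nhds_isCont[OF this, of "division_identity K d A u"]
  have "\<forall>\<^sub>F p in nhds 0. division_identity K d A u (quad_map K e p, fst (snd p))"
    using ev q0 by (simp flip: zero_prod_def)
  ultimately have main: "\<forall>\<^sub>F p in nhds 0. prepared K e d A w p"
  proof eventually_elim
    case (elim p)
    show ?case
      unfolding prepared_def
    proof (intro allI impI)
      fix \<eta> s X Y a0 a1 a2 assume p: "p = (\<eta>, s, X, Y)" and a: "A (quad_map K e p) = (a0, a1, a2)"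
      have Up: "U p > 0" using elim(1) by simp
      have "(s ^ d - a2 * s\<^sup>2 - a1 * s - a0) * u (A (quad_map K e p), s) = - e * (X\<^sup>2 - Y\<^sup>2)"
        using elim(2) a p by (auto simp: division_identity_def quad_map_def)
      moreover have "(s ^ d - a2 * s\<^sup>2 - a1 * s - a0) * U p
          = e * ((s ^ d - a2 * s\<^sup>2 - a1 * s - a0) * u (A (quad_map K e p), s))"
        by (simp add: U_def p)
      ultimately have "(s ^ d - a2 * s\<^sup>2 - a1 * s - a0) * U p = Y\<^sup>2 - X\<^sup>2" using e by auto
      then have "s ^ d - a2 * s\<^sup>2 - a1 * s - a0 = (Y\<^sup>2 - X\<^sup>2) / U p"
        using Up by (simp only: nonzero_eq_divide_eq)
      moreover have "(w p)\<^sup>2 = 1 / U p" using Up by (simp add: w_def power_divide)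
      ultimately have "s ^ d - a2 * s\<^sup>2 - a1 * s - a0 = (Y * w p)\<^sup>2 - (X * w p)\<^sup>2"
        by (simp only: power_mult_distrib) (simp add: diff_divide_distrib)
      then show "s ^ d - a2 * s\<^sup>2 - a1 * s - a0 = (Y * w p)\<^sup>2 - (X * w p)\<^sup>2 \<and> (d = 2 \<longrightarrow> a2 = 0)"
        using elim(2) a by (simp add: division_identity_def)
    qed
  qed
  show ?thesis
    by (rule that[OF A A' sw _ sAq dAq main]) (use U0 in \<open>simp_all add: w_def\<close>)
qed

lemma vector_4_nth:
  "(vector [a, b, c, d] :: 'a::zero ^ 4) $ 1 = a" "(vector [a, b, c, d] :: 'a::zero ^ 4) $ 2 = b"
  "(vector [a, b, c, d] :: 'a::zero ^ 4) $ 3 = c" "(vector [a, b, c, d] :: 'a::zero ^ 4) $ 4 = d"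
  unfolding vector_def by simp_all

definition vec4 :: "real \<times> real \<times> real \<times> real \<Rightarrow> real ^ 4" where
  "vec4 p = vector [fst p, fst (snd p), fst (snd (snd p)), snd (snd (snd p))]"

definition vec2 :: "real \<times> real \<Rightarrow> real ^ 2" where
  "vec2 p = vector [fst p, snd p]"

lemma bounded_linear_vec4: "bounded_linear vec4"
  unfolding linear_conv_bounded_linear[symmetric] vec4_def
  by (rule linearI) (auto simp: vec_eq_iff forall_4 vector_4_nth)

lemma bounded_linear_vec2: "bounded_linear vec2"
  unfolding linear_conv_bounded_linear[symmetric] vec2_def
  by (rule linearI) (auto simp: vec_eq_iff forall_2 vector_2)

lemma local_diffeo_at_vec4: "local_diffeo_at x vec4"
  by (rule local_diffeo_at_linear[OF bounded_linear_vec4])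
     (auto simp: vec4_def vec_eq_iff forall_4 vector_4_nth prod_eq_iff)

lemma local_diffeo_at_vec2: "local_diffeo_at x vec2"
  by (rule local_diffeo_at_linear[OF bounded_linear_vec2])
     (auto simp: vec2_def vec_eq_iff forall_2 vector_2 prod_eq_iff)

lemma vec_0: "vec4 0 = 0" "vec2 0 = 0"
  using bounded_linear_vec4 bounded_linear_vec2 linear_simps(3) by auto

text \<open>Completing the cube: with s' = s - a2/3 the prepared identity reads y2 = s'^3 + x1 s' +
  (X w)^2 - (Y w)^2, where x1 = - (a2^2/3 + a1) and y2 = 2 (a2/3)^3 + a1 a2/3 + a0. Both are
  functions of the target point alone, so x1 can serve as first coordinate in source and target at
  once.\<close>

lemma cusp_normal_form:
  fixes g :: "complex \<times> complex \<Rightarrow> complex"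
  assumes K: "K holomorphic_on ball 0 R" "R > 0"
    and K0: "K 0 = 0" "deriv K 0 = 0" "(deriv ^^ 2) K 0 = 0"
    and e: "e = 1 \<or> e = -1" and Kd: "e * Re ((deriv ^^ 3) K 0) > 0"
    and \<phi>: "local_diffeo_at x \<phi>" "\<phi> x = 0" and \<psi>: "local_diffeo_at (g x) \<psi>" "\<psi> (g x) = 0"
    and g: "isCont g x" and eq: "\<forall>\<^sub>F y in nhds x. \<psi> (g y) = quad_map K e (\<phi> y)"
  shows "has_local_form g cusp_minus_form x"
proof -
  obtain A A' w where A: "smooth_at 0 A" "A 0 = 0" "(A has_derivative A') (at 0)"
      "\<And>h. fst (A' h) = 0 \<Longrightarrow> fst (snd (A' h)) = 0 \<Longrightarrow> h = 0"
      "\<And>h. fst (A' h) = 0 \<longleftrightarrow> snd h = 0"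
      and w: "smooth_at 0 w" "w 0 \<noteq> 0"
      and Aq: "smooth_at 0 (\<lambda>p. A (quad_map K e p))" "((\<lambda>p. A (quad_map K e p)) has_derivative (\<lambda>h. A' (fst h, 0))) (at 0)"
      and ev: "\<forall>\<^sub>F p in nhds 0. prepared K e 3 A w p"
    by (rule prepared_quad_map[OF K K0(1,2) _ _ e Kd]) (use K0 in auto)
  have q0: "quad_map K e 0 = 0" using K0 by (simp add: quad_map_eq zero_prod_def)
  define \<Phi> where "\<Phi> p = (let \<alpha> = A (quad_map K e p) in
     (- ((snd (snd \<alpha>))\<^sup>2 / 3 + fst (snd \<alpha>)), fst (snd (snd p)) * w p, snd (snd (snd p)) * w p, fst (snd p) - snd (snd \<alpha>) / 3))" for p
  define T where "T y = (let \<alpha> = A y in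
     (- ((snd (snd \<alpha>))\<^sup>2 / 3 + fst (snd \<alpha>)), 2 * (snd (snd \<alpha>) / 3) ^ 3 + fst (snd \<alpha>) * snd (snd \<alpha>) / 3 + fst \<alpha>))" for y
  have dw: "(w has_derivative frechet_derivative w (at 0)) (at 0)" by (rule smooth_at_has_derivative[OF w(1)])
  have linA: "A' 0 = 0" using A(3) has_derivative_linear linear_0 by blast
  have "local_diffeo_at 0 \<Phi>"
  proof (rule local_diffeo_atI)
    show "smooth_at 0 \<Phi>"
      unfolding \<Phi>_def Let_def by (intro smooth_intros Aq w) auto
    show "(\<Phi> has_derivative (\<lambda>h. (- fst (snd (A' (fst h, 0))), fst (snd (snd h)) * w 0, snd (snd (snd h)) * w 0,
          fst (snd h) - snd (snd (A' (fst h, 0))) / 3))) (at 0)"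
      unfolding \<Phi>_def Let_def
      by (auto intro!: derivative_eq_intros Aq dw simp: q0 A)
    show "h = 0" if "(- fst (snd (A' (fst h, 0))), fst (snd (snd h)) * w 0, snd (snd (snd h)) * w 0,
          fst (snd h) - snd (snd (A' (fst h, 0))) / 3) = 0" for h
    proof -
      \<comment> \<open>The second component of the model map is stationary at 0, so a0 is
        stationary in the source; a direction in which a1 is stationary as well must therefore leave
        eta fixed.\<close>
      have "fst (snd (A' (fst h, 0))) = 0" using that by (simp add: prod_eq_iff)
      then have "(fst h, 0::real) = 0" using A(4,5)[of "(fst h, 0)"] by simp
      then show ?thesis using that w(2) linA by (simp add: prod_eq_iff zero_prod_def)
    qed
  qed
  then have l\<Phi>: "local_diffeo_at x (\<lambda>y. vec4 (\<Phi> (\<phi> y)))"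
    using local_diffeo_at_compose[OF local_diffeo_at_compose[OF \<phi>(1)] local_diffeo_at_vec4] \<phi>(2) by simp
  have "local_diffeo_at 0 T"
  proof (rule local_diffeo_atI)
    show "smooth_at 0 T"
      unfolding T_def Let_def by (intro smooth_intros A) auto
    show "(T has_derivative (\<lambda>h. (- fst (snd (A' h)), fst (A' h)))) (at 0)"
      unfolding T_def Let_def
      by (auto intro!: derivative_eq_intros A(3) simp: A(2))
    show "h = 0" if "(- fst (snd (A' h)), fst (A' h)) = 0" for h
      using A(4)[of h] that by (simp add: prod_eq_iff)
  qed
  then have lT: "local_diffeo_at (g x) (\<lambda>y. vec2 (T (\<psi> y)))"
    using local_diffeo_at_compose[OF local_diffeo_at_compose[OF \<psi>(1)] local_diffeo_at_vec2] \<psi>(2) by simp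
  show ?thesis
  proof (rule has_local_formI[OF l\<Phi> _ lT _ g])
    show "vec4 (\<Phi> (\<phi> x)) = 0"
      using \<phi>(2) vec_0 by (simp add: \<Phi>_def q0 A flip: zero_prod_def)
    show "vec2 (T (\<psi> (g x))) = 0"
      using \<psi>(2) vec_0 by (simp add: T_def A flip: zero_prod_def)
    have "smooth_at x \<phi>" using \<phi>(1) by (auto elim: local_diffeo_atE)
    then have "\<forall>\<^sub>F y in nhds x. prepared K e 3 A w (\<phi> y)"
      using eventually_nhds_isCont[OF smooth_at_isCont[of x \<phi>]] ev \<phi>(2) by simp
    with eq show "\<forall>\<^sub>F y in nhds x. vec2 (T (\<psi> (g y))) = cusp_minus_form (vec4 (\<Phi> (\<phi> y)))"
    proof eventually_elim
      case (elim y)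
      obtain \<eta> s X Y where p: "\<phi> y = (\<eta>, s, X, Y)" by (cases "\<phi> y") auto
      obtain a0 a1 a2 where a: "A (quad_map K e (\<phi> y)) = (a0, a1, a2)" by (cases "A (quad_map K e (\<phi> y))") auto
      have id: "s ^ 3 - a2 * s\<^sup>2 - a1 * s - a0 = (Y * w (\<phi> y))\<^sup>2 - (X * w (\<phi> y))\<^sup>2"
        using elim(2) p a by (auto simp: prepared_def)
      have "2 * (a2 / 3) ^ 3 + a1 * a2 / 3 + a0 = (X * w (\<phi> y))\<^sup>2 - (Y * w (\<phi> y))\<^sup>2
          + - (a2\<^sup>2 / 3 + a1) * (s - a2 / 3) + (s - a2 / 3) ^ 3"
        using id by (simp add: power2_eq_square power3_eq_cube field_simps)
      then show ?case
        unfolding elim(1) T_def \<Phi>_def Let_def a cusp_minus_form_def vec2_def vec4_def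
        by (simp add: p vector_4_nth vec_eq_iff forall_2)
    qed
  qed
qed

text \<open>Completing the square: with s' = s - a1/2 the target function a1^2/4 + a0 equals s'^2 +
  (X w)^2 - (Y w)^2. As e has the sign of Re K''(0), dividing by the unit always leaves two plus
  signs and one minus sign.\<close>

lemma fold_normal_form:
  fixes g :: "complex \<times> complex \<Rightarrow> complex"
  assumes K: "K holomorphic_on ball 0 R" "R > 0"
    and K0: "K 0 = 0" "deriv K 0 = 0"
    and e: "e = 1 \<or> e = -1" and Kd: "e * Re ((deriv ^^ 2) K 0) > 0"
    and \<phi>: "local_diffeo_at x \<phi>" "\<phi> x = 0" and \<psi>: "local_diffeo_at (g x) \<psi>" "\<psi> (g x) = 0"
    and g: "isCont g x" and eq: "\<forall>\<^sub>F y in nhds x. \<psi> (g y) = quad_map K e (\<phi> y)"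
  shows "has_local_form g indefinite_fold_form x"
proof -
  obtain A A' w where A: "smooth_at 0 A" "A 0 = 0" "(A has_derivative A') (at 0)"
      "\<And>h. fst (A' h) = 0 \<Longrightarrow> fst (snd (A' h)) = 0 \<Longrightarrow> h = 0"
      "\<And>h. fst (A' h) = 0 \<longleftrightarrow> snd h = 0"
      and w: "smooth_at 0 w" "w 0 \<noteq> 0"
      and Aq: "smooth_at 0 (\<lambda>p. A (quad_map K e p))" "((\<lambda>p. A (quad_map K e p)) has_derivative (\<lambda>h. A' (fst h, 0))) (at 0)"
      and ev: "\<forall>\<^sub>F p in nhds 0. prepared K e 2 A w p"
    by (rule prepared_quad_map[OF K K0(1,2) _ _ e Kd]) auto
  have q0: "quad_map K e 0 = 0" using K0 by (simp add: quad_map_eq zero_prod_def)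
  define \<Phi> where "\<Phi> p = (let \<alpha> = A (quad_map K e p) in
     (fst p, fst (snd p) - fst (snd \<alpha>) / 2, fst (snd (snd p)) * w p, snd (snd (snd p)) * w p))" for p
  define T where "T y = (let \<alpha> = A y in (fst y, (fst (snd \<alpha>))\<^sup>2 / 4 + fst \<alpha>))" for y
  have dw: "(w has_derivative frechet_derivative w (at 0)) (at 0)" by (rule smooth_at_has_derivative[OF w(1)])
  have linA: "A' 0 = 0" using A(3) has_derivative_linear linear_0 by blast
  have "local_diffeo_at 0 \<Phi>"
  proof (rule local_diffeo_atI)
    show "smooth_at 0 \<Phi>"
      unfolding \<Phi>_def Let_def by (intro smooth_intros Aq w) auto
    show "(\<Phi> has_derivative (\<lambda>h. (fst h, fst (snd h) - fst (snd (A' (fst h, 0))) / 2,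
          fst (snd (snd h)) * w 0, snd (snd (snd h)) * w 0))) (at 0)"
      unfolding \<Phi>_def Let_def
      by (auto intro!: derivative_eq_intros Aq dw simp: q0 A)
    show "h = 0" if "(fst h, fst (snd h) - fst (snd (A' (fst h, 0))) / 2,
          fst (snd (snd h)) * w 0, snd (snd (snd h)) * w 0) = 0" for h
    proof -
      have "(fst h, 0::real) = 0" using that by (simp add: prod_eq_iff)
      then show ?thesis using that w(2) linA by (simp add: prod_eq_iff zero_prod_def)
    qed
  qed
  then have l\<Phi>: "local_diffeo_at x (\<lambda>y. vec4 (\<Phi> (\<phi> y)))"
    using local_diffeo_at_compose[OF local_diffeo_at_compose[OF \<phi>(1)] local_diffeo_at_vec4] \<phi>(2) by simp
  have "local_diffeo_at 0 T"
  proof (rule local_diffeo_atI)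
    show "smooth_at 0 T"
      unfolding T_def Let_def by (intro smooth_intros A) auto
    show "(T has_derivative (\<lambda>h. (fst h, fst (A' h)))) (at 0)"
      unfolding T_def Let_def
      by (auto intro!: derivative_eq_intros A(3) simp: A(2))
    show "h = 0" if "(fst h, fst (A' h)) = 0" for h
      using A(5)[of h] that by (simp add: prod_eq_iff)
  qed
  then have lT: "local_diffeo_at (g x) (\<lambda>y. vec2 (T (\<psi> y)))"
    using local_diffeo_at_compose[OF local_diffeo_at_compose[OF \<psi>(1)] local_diffeo_at_vec2] \<psi>(2) by simp
  show ?thesis
  proof (rule has_local_formI[OF l\<Phi> _ lT _ g])
    show "vec4 (\<Phi> (\<phi> x)) = 0"
      using \<phi>(2) vec_0 by (simp add: \<Phi>_def q0 A flip: zero_prod_def)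
    show "vec2 (T (\<psi> (g x))) = 0"
      using \<psi>(2) vec_0 by (simp add: T_def A flip: zero_prod_def)
    have "smooth_at x \<phi>" using \<phi>(1) by (auto elim: local_diffeo_atE)
    then have "\<forall>\<^sub>F y in nhds x. prepared K e 2 A w (\<phi> y)"
      using eventually_nhds_isCont[OF smooth_at_isCont[of x \<phi>]] ev \<phi>(2) by simp
    with eq show "\<forall>\<^sub>F y in nhds x. vec2 (T (\<psi> (g y))) = indefinite_fold_form (vec4 (\<Phi> (\<phi> y)))"
    proof eventually_elim
      case (elim y)
      obtain \<eta> s X Y where p: "\<phi> y = (\<eta>, s, X, Y)" by (cases "\<phi> y") auto
      obtain a0 a1 a2 where a: "A (quad_map K e (\<phi> y)) = (a0, a1, a2)" by (cases "A (quad_map K e (\<phi> y))") auto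
      have id: "s ^ 2 - a2 * s\<^sup>2 - a1 * s - a0 = (Y * w (\<phi> y))\<^sup>2 - (X * w (\<phi> y))\<^sup>2" "a2 = 0"
        using elim(2) p a by (auto simp: prepared_def)
      have "a1\<^sup>2 / 4 + a0 = (s - a1 / 2)\<^sup>2 + (X * w (\<phi> y))\<^sup>2 - (Y * w (\<phi> y))\<^sup>2"
        using id by (simp add: power2_eq_square field_simps)
      then show ?case
        unfolding elim(1) T_def \<Phi>_def Let_def a indefinite_fold_form_def vec2_def vec4_def
        by (simp add: p vector_4_nth vec_eq_iff forall_2 quad_map_def)
    qed
  qed
qed

section \<open>The holomorphic Morse coordinates along the critical curve\<close>

text \<open>The power ((1 - is)/(1 + is))^l. For real s and l = 1/(p - 1) it is the factor by which
  the critical point z0 moves when c becomes c(1 + is), because conjugation turns 1 + is into 1 -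
  is. Separate logarithms keep it holomorphic in s on the unit disc.\<close>

definition cayley_pow :: "real \<Rightarrow> complex \<Rightarrow> complex" where
  "cayley_pow l s = exp (of_real l * (Ln (1 - \<i> * s) - Ln (1 + \<i> * s)))"

text \<open>The function (1 - is)^(1 + l) (1 + is)^(- l). For l = 1/(p - 1) it is (1 + is) times the
  p-th power of \<open>cayley_pow\<close>, and the critical value is a constant multiple of
  it.\<close>

definition crit_factor :: "real \<Rightarrow> complex \<Rightarrow> complex" where
  "crit_factor l s = exp (of_real (1 + l) * Ln (1 - \<i> * s) - of_real l * Ln (1 + \<i> * s))"

lemma one_pm_is_real: "1 + \<i> * of_real s \<noteq> 0" "1 - \<i> * of_real s \<noteq> 0"
  by (auto simp: complex_eq_iff)

lemma one_pm_is_ball: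
  assumes "s \<in> ball 0 1"
  shows "1 + \<i> * s \<notin> \<real>\<^sub>\<le>\<^sub>0" "1 - \<i> * s \<notin> \<real>\<^sub>\<le>\<^sub>0" "1 + \<i> * s \<noteq> 0" "1 - \<i> * s \<noteq> 0"
proof -
  have "\<bar>Im s\<bar> < 1" using assms abs_Im_le_cmod[of s] by simp
  then show "1 + \<i> * s \<notin> \<real>\<^sub>\<le>\<^sub>0" "1 - \<i> * s \<notin> \<real>\<^sub>\<le>\<^sub>0" "1 + \<i> * s \<noteq> 0" "1 - \<i> * s \<noteq> 0"
    by (auto simp: complex_nonpos_Reals_iff complex_eq_iff)
qed

lemma cayley_pow_0 [simp]: "cayley_pow l 0 = 1" and crit_factor_0 [simp]: "crit_factor l 0 = 1"
  by (simp_all add: cayley_pow_def crit_factor_def)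

lemma cayley_pow_nonzero [simp]: "cayley_pow l s \<noteq> 0"
  by (simp add: cayley_pow_def)

lemma cayley_pow_power:
  assumes "p \<ge> 2"
  shows "cayley_pow (1 / (real p - 1)) (of_real s) ^ (p - 1) = (1 - \<i> * of_real s) / (1 + \<i> * of_real s)"
proof -
  have "real (p - 1) * (1 / (real p - 1)) = 1"
    using assms by (simp add: of_nat_diff)
  then have e: "of_nat (p - 1) * complex_of_real (1 / (real p - 1)) = 1"
    by (metis of_real_1 of_real_mult of_real_of_nat_eq)
  have "cayley_pow (1 / (real p - 1)) (of_real s) ^ (p - 1) = exp (Ln (1 - \<i> * of_real s) - Ln (1 + \<i> * of_real s))"
    unfolding cayley_pow_def exp_of_nat_mult[symmetric] mult.assoc[symmetric] e by simp
  then show ?thesis using one_pm_is_real[of s] by (simp add: exp_diff)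
qed

lemma crit_factor_eq:
  assumes "p \<ge> 2"
  shows "(1 + \<i> * of_real s) * cayley_pow (1 / (real p - 1)) (of_real s) ^ p = crit_factor (1 / (real p - 1)) (of_real s)"
proof -
  let ?l = "1 / (real p - 1)"
  have "real p * ?l = 1 + ?l" using assms by (simp add: field_simps)
  then have e: "of_nat p * complex_of_real ?l = of_real (1 + ?l)"
    by (metis of_real_mult of_real_of_nat_eq)
  have "cayley_pow ?l (of_real s) ^ p = exp (of_real (1 + ?l) * (Ln (1 - \<i> * of_real s) - Ln (1 + \<i> * of_real s)))"
    unfolding cayley_pow_def exp_of_nat_mult[symmetric] mult.assoc[symmetric] e ..
  moreover have "1 + \<i> * of_real s = exp (Ln (1 + \<i> * of_real s))" using one_pm_is_real by simp
  ultimately have "(1 + \<i> * of_real s) * cayley_pow ?l (of_real s) ^ p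
      = exp (Ln (1 + \<i> * of_real s) + of_real (1 + ?l) * (Ln (1 - \<i> * of_real s) - Ln (1 + \<i> * of_real s)))"
    by (simp only: exp_add)
  moreover have "x + of_real (1 + l) * (y - x) = of_real (1 + l) * y - of_real l * x" for x y :: complex and l
    by (simp add: algebra_simps)
  ultimately show ?thesis unfolding crit_factor_def by (simp only:)
qed

lemma has_field_derivative_crit_factor:
  assumes "s \<in> ball 0 1"
  shows "(crit_factor l has_field_derivative
     - \<i> * (of_real (1 + l) / (1 - \<i> * s) + of_real l / (1 + \<i> * s)) * crit_factor l s) (at s)"
proof -
  note nz = one_pm_is_ball[OF assms]
  have "((\<lambda>s. Ln (1 - \<i> * s)) has_field_derivative - \<i> / (1 - \<i> * s)) (at s)"
    by (rule derivative_eq_intros refl | use nz in \<open>simp add: divide_inverse\<close>)+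
  moreover have "((\<lambda>s. Ln (1 + \<i> * s)) has_field_derivative \<i> / (1 + \<i> * s)) (at s)"
    by (rule derivative_eq_intros refl | use nz in \<open>simp add: divide_inverse\<close>)+
  ultimately have "((\<lambda>s. of_real (1 + l) * Ln (1 - \<i> * s) - of_real l * Ln (1 + \<i> * s)) has_field_derivative
      of_real (1 + l) * (- \<i> / (1 - \<i> * s)) - of_real l * (\<i> / (1 + \<i> * s))) (at s)"
    by (intro DERIV_diff DERIV_cmult)
  from DERIV_chain2[OF DERIV_exp this] show ?thesis
    unfolding crit_factor_def[abs_def] by (rule DERIV_cong) (simp add: algebra_simps add_divide_distrib)
qed

text \<open>With x = 1/(1 - is) and y = 1/(1 + is) the logarithmic derivative is - i((1 + l) x + l
  y), and the second derivative collapses to - l (1 + l) (x + y)^2 times the function. The relation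
  x + y = 2xy gives the closed form, which is easy to differentiate once more.\<close>

lemma has_field_derivative_crit_factor2:
  assumes "s \<in> ball 0 1"
  shows "((\<lambda>s. - \<i> * (of_real (1 + l) / (1 - \<i> * s) + of_real l / (1 + \<i> * s)) * crit_factor l s) has_field_derivative
     - 4 * of_real (l * (1 + l)) * crit_factor l s / ((1 - \<i> * s)\<^sup>2 * (1 + \<i> * s)\<^sup>2)) (at s)"
proof -
  define x y where "x = inverse (1 - \<i> * s)" and "y = inverse (1 + \<i> * s)"
  have nz: "1 + \<i> * s \<noteq> 0" "1 - \<i> * s \<noteq> 0" using one_pm_is_ball[OF assms] by auto
  have xy: "x + y = 2 * x * y" unfolding x_def y_def using nz by (simp add: field_simps)
  let ?L = "of_real l :: complex" and ?M = "crit_factor l s"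
  have "((\<lambda>s. - \<i> * (of_real (1 + l) / (1 - \<i> * s) + of_real l / (1 + \<i> * s)) * crit_factor l s) has_field_derivative
     - \<i> * (of_real (1 + l) * (\<i> * x\<^sup>2) + ?L * (- \<i> * y\<^sup>2)) * ?M
       + - \<i> * ((1 + ?L) * x + ?L * y) * (- \<i> * ((1 + ?L) * x + ?L * y) * ?M)) (at s)"
    by (rule derivative_eq_intros has_field_derivative_crit_factor[OF assms] refl |
        use nz in \<open>simp add: x_def y_def divide_inverse power2_eq_square\<close>)+
  moreover have "- \<i> * (of_real (1 + l) * (\<i> * x\<^sup>2) + ?L * (- \<i> * y\<^sup>2)) * ?M
       + - \<i> * ((1 + ?L) * x + ?L * y) * (- \<i> * ((1 + ?L) * x + ?L * y) * ?M)
     = - ?L * (1 + ?L) * (x + y)\<^sup>2 * ?M"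
    by (simp add: algebra_simps power2_eq_square)
  moreover have "- ?L * (1 + ?L) * (x + y)\<^sup>2 * ?M
     = - 4 * of_real (l * (1 + l)) * ?M / ((1 - \<i> * s)\<^sup>2 * (1 + \<i> * s)\<^sup>2)"
    unfolding xy by (simp add: x_def y_def divide_inverse power_mult_distrib power_inverse)
  ultimately show ?thesis by simp
qed

text \<open>The denominator (1 + s^2)^2 is stationary at 0, so only the derivative - i(1 + 2l) of
  \<open>crit_factor\<close> contributes.\<close>

lemma has_field_derivative_crit_factor3:
  "((\<lambda>s. - 4 * of_real (l * (1 + l)) * crit_factor l s / ((1 - \<i> * s)\<^sup>2 * (1 + \<i> * s)\<^sup>2)) has_field_derivative
     4 * \<i> * of_real (l * (1 + l) * (1 + 2 * l))) (at 0)"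
proof -
  have d: "(crit_factor l has_field_derivative - \<i> * (of_real (1 + l) + of_real l)) (at 0)"
    using has_field_derivative_crit_factor[of 0 l] by simp
  show ?thesis
    by (rule derivative_eq_intros d refl | simp add: algebra_simps)+
qed

text \<open>The quotient of Z^p - pZ + p - 1 by (Z - 1)^2, which is the second divided difference of
  Z^p with double node 1.\<close>

definition quot2 :: "nat \<Rightarrow> complex \<Rightarrow> complex" where
  "quot2 p Z = (\<Sum>k<p. \<Sum>j<k. Z ^ j)"

lemma quot2_eq: "Z ^ p - of_nat p * Z = 1 - of_nat p + (Z - 1)\<^sup>2 * quot2 p Z"
proof -
  have "Z ^ p - 1 = (Z - 1) * (\<Sum>k<p. Z ^ k)" by (rule power_diff_1_eq)
  moreover have "(\<Sum>k<p. Z ^ k) = (\<Sum>k<p. 1 + (Z - 1) * (\<Sum>j<k. Z ^ j))"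
    by (simp add: power_diff_1_eq[symmetric])
  moreover have "\<dots> = of_nat p + (Z - 1) * quot2 p Z"
    by (simp add: sum.distrib quot2_def sum_distrib_left)
  ultimately have "Z ^ p - 1 = (Z - 1) * (of_nat p + (Z - 1) * quot2 p Z)" by simp
  then show ?thesis by (simp add: algebra_simps power2_eq_square)
qed

lemma quot2_1: "quot2 p 1 = of_nat (p * (p - 1)) / 2"
proof -
  have "2 * (\<Sum>k<p. k) = p * (p - 1)" by (induction p) (auto simp: algebra_simps)
  then have "2 * quot2 p 1 = of_nat (p * (p - 1))"
    unfolding quot2_def by (simp flip: of_nat_sum of_nat_mult) (metis of_nat_mult of_nat_numeral)
  then show ?thesis by (simp add: field_simps)
qed


text \<open>With Z the ratio of z to its moved critical point, this is a scaled square root of (Z -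
  1)^2 times \<open>quot2\<close>. Dividing by the value at Z = 1 keeps the argument of
  \<open>csqrt\<close> near 1, away from its branch cut, so that k alone carries the choice of
  root.\<close>

definition root_coord :: "nat \<Rightarrow> complex \<Rightarrow> complex \<Rightarrow> real \<times> complex \<Rightarrow> complex" where
  "root_coord p z0 k y = (snd y / (z0 * cayley_pow (1 / (real p - 1)) (of_real (fst y))) - 1) * k *
     csqrt (crit_factor (1 / (real p - 1)) (of_real (fst y)) *
       quot2 p (snd y / (z0 * cayley_pow (1 / (real p - 1)) (of_real (fst y)))) / quot2 p 1)"

lemma analytic_cayley_pow: "cayley_pow l analytic_on {0}"
  unfolding cayley_pow_def by (intro analytic_intros) auto

lemma analytic_crit_factor: "crit_factor l analytic_on {0}"
  unfolding crit_factor_def by (intro analytic_intros) auto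

lemma smooth_at_root_coord_factors:
  assumes "p \<ge> 2" "z0 \<noteq> 0"
  shows "smooth_at (0, z0) (\<lambda>y. csqrt (crit_factor (1 / (real p - 1)) (of_real (fst y)) *
       quot2 p (snd y / (z0 * cayley_pow (1 / (real p - 1)) (of_real (fst y)))) / quot2 p 1))" (is ?W)
    and "smooth_at (0, z0) (\<lambda>y. snd y / (z0 * cayley_pow (1 / (real p - 1)) (of_real (fst y))))" (is ?Z)
proof -
  have c: "smooth_at (0, z0) (\<lambda>y. cayley_pow (1 / (real p - 1)) (of_real (fst y)))"
    by (intro smooth_at_analytic_compose[where h="cayley_pow l" for l] smooth_intros)
       (simp add: analytic_cayley_pow)
  have m: "smooth_at (0, z0) (\<lambda>y. crit_factor (1 / (real p - 1)) (of_real (fst y)))"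
    by (intro smooth_at_analytic_compose[where h="crit_factor l" for l] smooth_intros)
       (simp add: analytic_crit_factor)
  show Z: ?Z by (intro smooth_intros c) (use assms in auto)
  have q: "quot2 p 1 \<noteq> 0" using assms(1) by (auto simp: quot2_1)
  show ?W
  proof (rule smooth_at_analytic_compose[where h=csqrt])
    show "smooth_at (0, z0) (\<lambda>y. crit_factor (1 / (real p - 1)) (of_real (fst y)) *
       quot2 p (snd y / (z0 * cayley_pow (1 / (real p - 1)) (of_real (fst y)))) / quot2 p 1)"
      using q unfolding quot2_def by (intro smooth_intros m Z) auto
  qed (use assms q in \<open>auto intro!: analytic_intros\<close>)
qed

lemma smooth_at_root_coord:
  assumes "p \<ge> 2" "z0 \<noteq> 0"
  shows "smooth_at (0, z0) (root_coord p z0 k)"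
  unfolding root_coord_def by (intro smooth_intros smooth_at_root_coord_factors assms)

lemma has_derivative_cayley_pow:
  "((\<lambda>y::real \<times> complex. cayley_pow l (of_real (fst y))) has_derivative (\<lambda>h. - 2 * \<i> * of_real l * of_real (fst h))) (at (0, z0))"
proof -
  have "(cayley_pow l has_field_derivative - 2 * \<i> * of_real l) (at 0)"
    unfolding cayley_pow_def by (rule derivative_eq_intros refl | simp)+
  then have "(cayley_pow l has_derivative (*) (- 2 * \<i> * of_real l)) (at (of_real (fst (0::real, z0))))"
    by (simp add: has_field_derivative_def)
  moreover have "((\<lambda>y::real \<times> complex. complex_of_real (fst y)) has_derivative (\<lambda>h. of_real (fst h))) (at (0, z0))"
    by (auto intro!: derivative_eq_intros)
  ultimately show ?thesis
    using has_derivative_compose by fastforce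
qed

lemma has_derivative_root_coord:
  assumes "p \<ge> 2" "z0 \<noteq> 0"
  shows "(root_coord p z0 k has_derivative
     (\<lambda>h. k * (snd h / z0 + 2 * \<i> * of_real (1 / (real p - 1)) * of_real (fst h)))) (at (0, z0))"
proof -
  let ?l = "1 / (real p - 1)"
  define W where "W y = csqrt (crit_factor ?l (of_real (fst y)) *
       quot2 p (snd y / (z0 * cayley_pow ?l (of_real (fst y)))) / quot2 p 1)" for y :: "real \<times> complex"
  have "quot2 p 1 \<noteq> 0" using assms(1) by (auto simp: quot2_1)
  then have W0: "W (0, z0) = 1" using assms(2) by (simp add: W_def)
  have dW: "(W has_derivative frechet_derivative W (at (0, z0))) (at (0, z0))"
    unfolding W_def by (rule smooth_at_has_derivative[OF smooth_at_root_coord_factors(1)[OF assms]])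
  have dZ: "((\<lambda>y. snd y / (z0 * cayley_pow ?l (of_real (fst y)))) has_derivative
      (\<lambda>h. snd h / z0 + 2 * \<i> * of_real ?l * of_real (fst h))) (at (0, z0))"
    by (rule has_derivative_eq_rhs, (rule derivative_intros has_derivative_cayley_pow)+)
       (use assms(2) in \<open>auto simp: fun_eq_iff field_simps\<close>)
  have "((\<lambda>y. (snd y / (z0 * cayley_pow ?l (of_real (fst y))) - 1) * k * W y) has_derivative
     (\<lambda>h. k * (snd h / z0 + 2 * \<i> * of_real ?l * of_real (fst h)))) (at (0, z0))"
    by (rule has_derivative_eq_rhs, (rule has_derivative_mult has_derivative_diff has_derivative_const dZ dW)+)
       (use assms(2) in \<open>auto simp: fun_eq_iff W0 mult.commute\<close>)
  then show ?thesis unfolding W_def root_coord_def[abs_def] .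
qed

text \<open>Inside the real part the antiholomorphic term may be conjugated; as z0 R is the critical
  point belonging to C, it becomes - C p (z0 R)^(p - 1) z. The sum is then C (z0 R)^p (Z^p - p Z),
  which \<open>quot2_eq\<close> splits into the critical value and a square. The factor j is left
  open so that the two variables can be normalized differently.\<close>

lemma critical_expansion:
  assumes p: "p \<ge> 2" and z0: "z0 \<noteq> 0" and crit: "c * of_nat p * z0 ^ (p - 1) = - cnj (c * a)"
    and k: "j * k\<^sup>2 = c * z0 ^ p * quot2 p 1"
  shows "Re (c * (1 + \<i> * of_real s) * (z ^ p + a * cnj z)) =
     Re ((1 - of_nat p) * (c * z0 ^ p) * crit_factor (1 / (real p - 1)) (of_real s)) + Re (j * (root_coord p z0 k (s, z))\<^sup>2)"
proof -
  let ?l = "1 / (real p - 1)"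
  define R where "R = cayley_pow ?l (of_real s)"
  define Z where "Z = z / (z0 * R)"
  define C where "C = c * (1 + \<i> * of_real s)"
  have R: "R \<noteq> 0" by (simp add: R_def)
  have q: "quot2 p 1 \<noteq> 0" using p by (auto simp: quot2_1)
  have pp: "x ^ p = x * x ^ (p - 1)" for x :: complex using p by (cases p) auto
  have "C * of_nat p * (z0 * R) ^ (p - 1) = (c * of_nat p * z0 ^ (p - 1)) * (1 - \<i> * of_real s)"
    using one_pm_is_real[of s] unfolding C_def R_def power_mult_distrib cayley_pow_power[OF p] by simp
  also have "\<dots> = - cnj (C * a)"
    unfolding crit by (simp add: C_def)
  finally have crit': "C * of_nat p * (z0 * R) ^ (p - 1) = - cnj (C * a)" .
  have M: "C * (z0 * R) ^ p = c * z0 ^ p * crit_factor ?l (of_real s)"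
    unfolding C_def R_def power_mult_distrib crit_factor_eq[OF p, symmetric] by simp
  have "Re (C * a * cnj z) = Re (cnj (C * a) * z)"
    by (metis cnj.simps(1) complex_cnj_cnj complex_cnj_mult)
  also have "\<dots> = - Re (C * of_nat p * (z0 * R) ^ (p - 1) * z)"
    unfolding crit' by simp
  finally have "Re (C * (z ^ p + a * cnj z)) = Re (C * z ^ p - C * of_nat p * (z0 * R) ^ (p - 1) * z)"
    by (simp add: distrib_left mult.assoc)
  also have "C * z ^ p - C * of_nat p * (z0 * R) ^ (p - 1) * z = C * (z0 * R) ^ p * (Z ^ p - of_nat p * Z)"
  proof -
    have "z = z0 * R * Z" using z0 R by (simp add: Z_def)
    then show ?thesis
      by (simp only:) (simp add: power_mult_distrib pp[of "z0"] pp[of R] algebra_simps)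
  qed
  also have "\<dots> = (1 - of_nat p) * (c * z0 ^ p) * crit_factor ?l (of_real s)
      + (Z - 1)\<^sup>2 * (c * z0 ^ p * crit_factor ?l (of_real s) * quot2 p Z)"
    unfolding quot2_eq M by (simp add: algebra_simps)
  also have "(Z - 1)\<^sup>2 * (c * z0 ^ p * crit_factor ?l (of_real s) * quot2 p Z) = j * (root_coord p z0 k (s, z))\<^sup>2"
  proof -
    have "j * (root_coord p z0 k (s, z))\<^sup>2 = (Z - 1)\<^sup>2 * (j * k\<^sup>2) * (crit_factor ?l (of_real s) * quot2 p Z / quot2 p 1)"
      by (simp add: root_coord_def power_mult_distrib Z_def R_def)
    then show ?thesis unfolding k using q by (simp add: field_simps)
  qed
  finally show ?thesis unfolding C_def by (simp add: mult.assoc)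
qed

section \<open>The germ at a singular point\<close>

text \<open>Division requires K to vanish at 0 as a complex function, whereas only real parts are
  known to vanish. Subtracting i times a real quadratic polynomial removes the imaginary parts and
  leaves Re K on the real axis unchanged. A negative leading derivative is treated with e = -1,
  which means interchanging X and Y.\<close>

lemma normal_form_of_quad_germ:
  fixes g :: "complex \<times> complex \<Rightarrow> complex"
  assumes K: "\<And>s. s \<in> ball 0 1 \<Longrightarrow> (K has_field_derivative K1 s) (at s)"
      "\<And>s. s \<in> ball 0 1 \<Longrightarrow> (K1 has_field_derivative K2 s) (at s)"
      "(K2 has_field_derivative k3) (at 0)"
    and K0: "Re (K 0) = 0" "Re (K1 0) = 0"
    and \<phi>: "local_diffeo_at x \<phi>" "\<phi> x = 0" and \<psi>: "local_diffeo_at (g x) \<psi>" "\<psi> (g x) = 0"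
    and g: "isCont g x" and eq: "\<forall>\<^sub>F y in nhds x. \<psi> (g y) = quad_map K 1 (\<phi> y)"
  shows "Re (K2 0) \<noteq> 0 \<Longrightarrow> has_local_form g indefinite_fold_form x"
    and "Re (K2 0) = 0 \<Longrightarrow> Re k3 \<noteq> 0 \<Longrightarrow> has_local_form g cusp_minus_form x"
proof -
  define L where "L s = K s - \<i> * (of_real (Im (K 0)) + of_real (Im (K1 0)) * s + of_real (Im (K2 0) / 2) * s\<^sup>2)" for s
  define L1 where "L1 s = K1 s - \<i> * (of_real (Im (K1 0)) + of_real (Im (K2 0)) * s)" for s
  define L2 where "L2 s = K2 s - \<i> * of_real (Im (K2 0))" for s
  have L: "(L has_field_derivative L1 s) (at s)" if "s \<in> ball 0 1" for s
    unfolding L_def L1_def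
    by (rule derivative_eq_intros K(1)[OF that] refl | simp)+
  have L1: "(L1 has_field_derivative L2 s) (at s)" if "s \<in> ball 0 1" for s
    unfolding L1_def L2_def
    by (rule derivative_eq_intros K(2)[OF that] refl | simp)+
  have L2: "(L2 has_field_derivative k3) (at 0)"
    unfolding L2_def by (rule derivative_eq_intros K(3) refl | simp)+
  have hol: "L holomorphic_on ball 0 1"
    unfolding holomorphic_on_open[OF open_ball] using L by blast
  have d1: "deriv L s = L1 s" if "s \<in> ball 0 1" for s using L[OF that] DERIV_imp_deriv by blast
  have d2: "deriv (deriv L) s = L2 s" if "s \<in> ball 0 1" for s
    by (rule DERIV_imp_deriv) (rule has_field_derivative_transform_within_open[OF L1[OF that] open_ball that], simp add: d1)
  have d3: "deriv (deriv (deriv L)) 0 = k3"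
    by (rule DERIV_imp_deriv) (rule has_field_derivative_transform_within_open[OF L2 open_ball, of 0 1], simp_all add: d2)
  have L0: "L 0 = 0" "deriv L 0 = 0" "(deriv ^^ 2) L 0 = of_real (Re (K2 0))"
    using K0 by (auto simp: L_def L1_def L2_def d1 d2 complex_eq_iff numeral_2_eq_2)
  have L3: "(deriv ^^ 3) L 0 = k3" using d3 by (simp add: numeral_3_eq_3)
  define sw where "sw = (\<lambda>p::real \<times> real \<times> real \<times> real. (fst p, fst (snd p), snd (snd (snd p)), fst (snd (snd p))))"
  have "bounded_linear sw"
    unfolding sw_def linear_conv_bounded_linear[symmetric] by (rule linearI) auto
  then have lsw: "local_diffeo_at y sw" for y
    by (rule local_diffeo_at_linear) (auto simp: sw_def prod_eq_iff)
  have KL: "quad_map K 1 = quad_map L 1"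
    by (auto simp: quad_map_def L_def fun_eq_iff simp flip: of_real_power)
  have KLsw: "quad_map K 1 p = quad_map L (-1) (sw p)" for p
    unfolding KL by (auto simp: quad_map_eq sw_def)
  have \<phi>sw: "local_diffeo_at x (\<lambda>y. sw (\<phi> y))" "sw (\<phi> x) = 0"
    using local_diffeo_at_compose[OF \<phi>(1) lsw] \<phi>(2) by (auto simp: sw_def zero_prod_def)
  show "has_local_form g indefinite_fold_form x" if "Re (K2 0) \<noteq> 0"
  proof (cases "Re (K2 0) > 0")
    case True
    show ?thesis
      by (rule fold_normal_form[OF hol _ L0(1,2) _ _ \<phi> \<psi> g, where e=1]) (use True eq KL L0 in auto)
  next
    case False
    show ?thesis
      by (rule fold_normal_form[OF hol _ L0(1,2) _ _ \<phi>sw \<psi> g, where e="-1"]) (use False that eq KLsw L0 in auto)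
  qed
  show "has_local_form g cusp_minus_form x" if "Re (K2 0) = 0" "Re k3 \<noteq> 0"
  proof (cases "Re k3 > 0")
    case True
    show ?thesis
      by (rule cusp_normal_form[OF hol _ L0(1,2) _ _ _ \<phi> \<psi> g, where e=1]) (use True that eq KL L0 L3 in auto)
  next
    case False
    show ?thesis
      by (rule cusp_normal_form[OF hol _ L0(1,2) _ _ _ \<phi>sw \<psi> g, where e="-1"]) (use False that eq KLsw L0 L3 in auto)
  qed
qed

text \<open>The implicit function theorem for Re (root_coord (s, w)) = 0 solved for s. The
  derivative in s at the base point is - 2 Im k / (q - 1), which is nonzero because k is not real.
  The derivative of S is recorded only through the linearized equation.\<close>

lemma slope_function:
  assumes q: "q \<ge> 2" and w0: "w0 \<noteq> 0" and k: "Im k \<noteq> 0"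
  obtains S S' where "smooth_at w0 S" "S w0 = (0::real)" "(S has_derivative S') (at w0)"
    "\<And>h. Re (k * (h / w0 + 2 * \<i> * of_real (1 / (real q - 1)) * of_real (S' h))) = 0"
    "\<forall>\<^sub>F w in nhds w0. Re (root_coord q w0 k (S w, w)) = 0"
proof -
  let ?l = "1 / (real q - 1)"
  define F where "F y = (Re (root_coord q w0 k y), snd y)" for y
  define F' where "F' h = (Re (k * (snd h / w0 + 2 * \<i> * of_real ?l * of_real (fst h))), snd h)" for h :: "real \<times> complex"
  have dF: "(F has_derivative F') (at (0, w0))"
    unfolding F_def F'_def by (intro derivative_intros has_derivative_root_coord q w0)
  have ldF: "local_diffeo_at (0, w0) F"
  proof (rule local_diffeo_atI[OF _ dF])
    show "smooth_at (0, w0) F"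
      unfolding F_def by (intro smooth_intros smooth_at_root_coord q w0)
    show "h = 0" if "F' h = 0" for h
    proof -
      have "snd h = 0" "Re (k * (2 * \<i> * of_real ?l * of_real (fst h))) = 0"
        using that by (auto simp: F'_def prod_eq_iff)
      moreover have "Re (k * (2 * \<i> * of_real m * of_real t)) = - 2 * m * t * Im k" for m t
        by simp
      from this[of ?l "fst h"]
      have "Re (k * (2 * \<i> * of_real ?l * of_real (fst h))) = - 2 * ?l * fst h * Im k" .
      ultimately show ?thesis using k q by (auto simp: prod_eq_iff)
    qed
  qed
  have F0: "F (0, w0) = (0, w0)" using w0 by (simp add: F_def root_coord_def)
  obtain B where B: "local_diffeo_at (0, w0) B" "B (0, w0) = (0, w0)"
      and FB: "\<forall>\<^sub>F y in nhds (0, w0). F (B y) = y"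
    by (rule local_diffeo_at_inverse[OF ldF refl]) (auto simp: F0)
  obtain B' where B': "smooth_at (0, w0) B" "(B has_derivative B') (at (0, w0))"
    using B(1) by (auto elim: local_diffeo_atE)
  define S where "S w = fst (B (0, w))" for w
  define S' where "S' h = fst (B' (0, h))" for h
  have FBw: "\<forall>\<^sub>F w in nhds w0. F (B (0, w)) = (0, w)"
    by (rule eventually_nhds_isCont[where f="\<lambda>w. (0, w)" and P="\<lambda>y. F (B y) = y"])
       (use FB in \<open>auto intro!: continuous_intros\<close>)
  have dB: "((\<lambda>w. B (0, w)) has_derivative (\<lambda>h. B' (0, h))) (at w0)"
    by (rule has_derivative_compose[of "\<lambda>w. (0, w)", OF _ B'(2)]) (auto intro!: derivative_eq_intros)
  show ?thesis
  proof
    show "smooth_at w0 S"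
      unfolding S_def
      by (intro smooth_intros smooth_at_compose[where g=B and f="\<lambda>w. (0, w)"] B')
    show "S w0 = 0" by (simp add: S_def B)
    show "(S has_derivative S') (at w0)"
      unfolding S_def S'_def by (intro derivative_intros dB)
    have "((\<lambda>w. F (B (0, w))) has_derivative (\<lambda>h. F' (B' (0, h)))) (at w0)"
      by (rule has_derivative_compose[OF dB]) (simp add: B(2) dF)
    moreover obtain T where T: "open T" "w0 \<in> T" "\<And>w. w \<in> T \<Longrightarrow> F (B (0, w)) = (0, w)"
      using FBw unfolding eventually_nhds by blast
    ultimately have "((\<lambda>w. (0, w)) has_derivative (\<lambda>h. F' (B' (0, h)))) (at w0)"
      by (rule has_derivative_transform_within_open)
    moreover have "((\<lambda>w. (0::real, w)) has_derivative (\<lambda>h. (0, h))) (at w0)"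
      by (auto intro!: derivative_eq_intros)
    ultimately have "(\<lambda>h. F' (B' (0, h))) = (\<lambda>h. (0, h))"
      using has_derivative_unique by blast
    then have "F' (B' (0, h)) = (0, h)" for h by meson
    then show "Re (k * (h / w0 + 2 * \<i> * of_real ?l * of_real (S' h))) = 0" for h
      unfolding F'_def S'_def by (metis fst_conv snd_conv)
    show "\<forall>\<^sub>F w in nhds w0. Re (root_coord q w0 k (S w, w)) = 0"
      using FBw
    proof eventually_elim
      case (elim w)
      then have "snd (B (0, w)) = w" by (simp add: F_def)
      then have "B (0, w) = (S w, w)" by (simp add: S_def prod_eq_iff)
      then show ?case using elim by (simp add: F_def)
    qed
  qed
qed

section \<open>The mixed polynomial and its reduction to the model germ\<close>

definition mixed_map :: "nat \<Rightarrow> nat \<Rightarrow> complex \<Rightarrow> complex \<Rightarrow> complex \<times> complex \<Rightarrow> complex" where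
  "mixed_map p q a b = (\<lambda>(z, w). z ^ p + w ^ q + a * cnj z + b * cnj w)"

lemma has_derivative_mixed_map:
  "(mixed_map p q a b has_derivative (\<lambda>h. of_nat p * z ^ (p - 1) * fst h + a * cnj (fst h)
      + (of_nat q * w ^ (q - 1) * snd h + b * cnj (snd h)))) (at (z, w))"
  unfolding mixed_map_def case_prod_unfold
  by (rule has_derivative_eq_rhs, (rule derivative_intros)+) (auto simp: fun_eq_iff algebra_simps)

lemma smooth_at_mixed_map: "smooth_at x (mixed_map p q a b)"
  unfolding mixed_map_def case_prod_unfold by (intro smooth_intros)


lemma isCont_mixed_map: "isCont (mixed_map p q a b) x"
  by (rule smooth_at_isCont[OF smooth_at_mixed_map])

text \<open>If the root k belonging to j = i happens to be real, then i k with j = - i is a root off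
  the real axis. For both values of j the number j omega^2 has zero real part when omega is purely
  imaginary.\<close>

lemma square_root_off_real:
  assumes "x \<noteq> (0::complex)"
  obtains j k where "j = \<i> \<or> j = - \<i>" "j * k\<^sup>2 = x" "Im k \<noteq> 0"
proof -
  define k where "k = csqrt (x / \<i>)"
  have k: "\<i> * k\<^sup>2 = x" by (simp add: k_def)
  have "k \<noteq> 0" using k assms by auto
  show ?thesis
  proof (cases "Im k = 0")
    case False
    then show ?thesis using that[of \<i> k] k by simp
  next
    case True
    then have "Re k \<noteq> 0" using \<open>k \<noteq> 0\<close> by (simp add: complex_eq_iff)
    then show ?thesis using that[of "- \<i>" "\<i> * k"] k by (simp add: power_mult_distrib)
  qed
qed

text \<open>Setting s = S(w) removes the square belonging to w, so the w-plane survives as the pair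
  formed by Im (c (g - g0)) and s, and the z-plane as X and Y. The term - c (1 + is) g0 in K shifts
  the base value to 0: its real part supplies both Re (c g0) and the product of s with Im (c
  g0).\<close>

lemma reduced_germ:
  assumes p: "p \<ge> 2" and q: "q \<ge> 2" and c: "c \<noteq> 0" and z0: "z0 \<noteq> 0" and w0: "w0 \<noteq> 0"
    and critz: "c * of_nat p * z0 ^ (p - 1) = - cnj (c * a)"
    and critw: "c * of_nat q * w0 ^ (q - 1) = - cnj (c * b)"
  defines "K \<equiv> \<lambda>s. (1 - of_nat p) * (c * z0 ^ p) * crit_factor (1 / (real p - 1)) s
       + (1 - of_nat q) * (c * w0 ^ q) * crit_factor (1 / (real q - 1)) s
       - c * (1 + \<i> * s) * mixed_map p q a b (z0, w0)"
  obtains \<phi> \<psi> where "local_diffeo_at (z0, w0) \<phi>" "\<phi> (z0, w0) = 0"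
    "local_diffeo_at (mixed_map p q a b (z0, w0)) \<psi>" "\<psi> (mixed_map p q a b (z0, w0)) = 0"
    "\<forall>\<^sub>F y in nhds (z0, w0). \<psi> (mixed_map p q a b y) = quad_map K 1 (\<phi> y)"
proof -
  let ?l = "1 / (real p - 1)" and ?m = "1 / (real q - 1)"
  let ?g = "mixed_map p q a b"
  define g0 where "g0 = ?g (z0, w0)"
  define kz where "kz = csqrt (c * z0 ^ p * quot2 p 1)"
  have kz: "1 * kz\<^sup>2 = c * z0 ^ p * quot2 p 1" by (simp add: kz_def)
  have q1: "quot2 p 1 \<noteq> 0" "quot2 q 1 \<noteq> 0" using p q by (auto simp: quot2_1)
  have kz0: "kz \<noteq> 0" using kz q1 c z0 by auto
  have "c * w0 ^ q * quot2 q 1 \<noteq> 0" using q1 c w0 by simp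
  then obtain j k where j: "j = \<i> \<or> j = - \<i>" and k: "j * k\<^sup>2 = c * w0 ^ q * quot2 q 1" and Imk: "Im k \<noteq> 0"
    by (rule square_root_off_real)
  obtain S S' where S: "smooth_at w0 S" "S w0 = (0::real)" "(S has_derivative S') (at w0)"
    and S': "\<And>h. Re (k * (h / w0 + 2 * \<i> * of_real ?m * of_real (S' h))) = 0"
    and S0: "\<forall>\<^sub>F w in nhds w0. Re (root_coord q w0 k (S w, w)) = 0"
    by (rule slope_function[OF q w0 Imk]) auto
  define \<zeta> where "\<zeta> y = root_coord p z0 kz (S (snd y), fst y)" for y :: "complex \<times> complex"
  define \<zeta>' where "\<zeta>' h = kz * (fst h / z0 + 2 * \<i> * of_real ?l * of_real (S' (snd h)))" for h :: "complex \<times> complex"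
  have sS: "smooth_at (z0, w0) (\<lambda>y. S (snd y))"
    by (rule smooth_at_compose[where g=S and f=snd]) (auto intro!: smooth_intros S)
  have dS: "((\<lambda>y. S (snd y)) has_derivative (\<lambda>h. S' (snd h))) (at (z0, w0))"
    by (rule has_derivative_compose[where g=S and f=snd]) (auto intro!: derivative_eq_intros S)
  have s\<zeta>: "smooth_at (z0, w0) \<zeta>"
    unfolding \<zeta>_def
    by (rule smooth_at_compose[where g="root_coord p z0 kz" and f="\<lambda>y. (S (snd y), fst y)"])
       (auto intro!: smooth_intros sS smooth_at_root_coord p z0 simp: S)
  have d\<zeta>: "(\<zeta> has_derivative \<zeta>') (at (z0, w0))"
  proof -
    have d1: "((\<lambda>y. (S (snd y), fst y)) has_derivative (\<lambda>h. (S' (snd h), fst h))) (at (z0, w0))"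
      by (intro derivative_intros dS)
    have d2: "(root_coord p z0 kz has_derivative (\<lambda>h. kz * (snd h / z0 + 2 * \<i> * of_real ?l * of_real (fst h))))
        (at (S (snd (z0, w0)), fst (z0, w0)))"
      using has_derivative_root_coord[OF p z0, of kz] by (simp only: S fst_conv snd_conv)
    show ?thesis
      unfolding \<zeta>_def[abs_def] \<zeta>'_def[abs_def] using has_derivative_compose[OF d1 d2] by (simp only: fst_conv snd_conv)
  qed
  define \<phi> where "\<phi> y = (Im (c * (?g y - g0)), S (snd y), Re (\<zeta> y), Im (\<zeta> y))" for y
  define \<psi> where "\<psi> y = (Im (c * (y - g0)), Re (c * (y - g0)))" for y
  define Dg where "Dg h = of_nat p * z0 ^ (p - 1) * fst h + a * cnj (fst h)
      + (of_nat q * w0 ^ (q - 1) * snd h + b * cnj (snd h))" for h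
  have dg: "(?g has_derivative Dg) (at (z0, w0))"
    unfolding Dg_def by (rule has_derivative_mixed_map)
  \<comment> \<open>By the critical equations the antiholomorphic part of c Dg is minus the
    conjugate of the holomorphic part: real parts cancel and imaginary parts double.\<close>
  have ImDg: "Im (c * Dg h) = 2 * Im (c * of_nat p * z0 ^ (p - 1) * fst h) + 2 * Im (c * of_nat q * w0 ^ (q - 1) * snd h)" for h
  proof -
    have *: "c * a * cnj x = cnj (- (c * of_nat p * z0 ^ (p - 1) * x))" for x
      unfolding critz by simp
    have **: "c * b * cnj x = cnj (- (c * of_nat q * w0 ^ (q - 1) * x))" for x
      unfolding critw by simp
    have "c * Dg h = c * of_nat p * z0 ^ (p - 1) * fst h + c * a * cnj (fst h)
      + (c * of_nat q * w0 ^ (q - 1) * snd h + c * b * cnj (snd h))"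
      by (simp add: Dg_def distrib_left mult.assoc)
    moreover have "Im (x + cnj (- x) + (y + cnj (- y))) = 2 * Im x + 2 * Im y" for x y by simp
    ultimately show ?thesis by (simp only: * **)
  qed
  have "local_diffeo_at (z0, w0) \<phi>"
  proof (rule local_diffeo_atI)
    show "smooth_at (z0, w0) \<phi>"
      unfolding \<phi>_def by (intro smooth_intros sS s\<zeta> smooth_at_mixed_map)
    show "(\<phi> has_derivative (\<lambda>h. (Im (c * Dg h), S' (snd h), Re (\<zeta>' h), Im (\<zeta>' h)))) (at (z0, w0))"
      unfolding \<phi>_def[abs_def]
      by (rule has_derivative_eq_rhs, (rule derivative_intros dS d\<zeta> dg)+) (auto simp: fun_eq_iff)
    show "h = 0" if "(Im (c * Dg h), S' (snd h), Re (\<zeta>' h), Im (\<zeta>' h)) = 0" for h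
    proof -
      have h: "Im (c * Dg h) = 0" "S' (snd h) = 0" "\<zeta>' h = 0"
        using that by (auto simp: prod_eq_iff complex_eq_iff)
      then have f: "fst h = 0" using kz0 z0 by (simp add: \<zeta>'_def)
      define \<delta> where "\<delta> = snd h / w0"
      have sh: "snd h = w0 * \<delta>" using w0 by (simp add: \<delta>_def)
      \<comment> \<open>A direction that keeps s fixed makes k \<delta> purely imaginary. Then Im (j
        k (k \<delta>)) is plus or minus Im k times the imaginary part of k \<delta>, so Im k
        \<noteq> 0 decides a second time.\<close>
      have re: "Re (k * \<delta>) = 0" using S'[of "snd h"] h(2) by (simp add: \<delta>_def)
      have "c * of_nat q * w0 ^ (q - 1) * snd h = of_nat q * (c * w0 ^ q) * \<delta>"
        using q unfolding sh by (cases q) auto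
      also have "\<dots> = 2 / of_nat (q - 1) * (j * k\<^sup>2) * \<delta>"
        unfolding k quot2_1 using q by (simp add: field_simps)
      also have "\<dots> = of_real (2 / real (q - 1)) * (j * k * (k * \<delta>))"
        by (simp add: power2_eq_square)
      finally have "c * of_nat q * w0 ^ (q - 1) * snd h = of_real (2 / real (q - 1)) * (j * k * (k * \<delta>))" .
      moreover have gen: "Im (of_real r * x) = r * Im x" for r x by simp
      ultimately have "Im (c * of_nat q * w0 ^ (q - 1) * snd h) = 2 / real (q - 1) * Im (j * k * (k * \<delta>))"
        by (simp only: gen)
      moreover have "Im (c * of_nat q * w0 ^ (q - 1) * snd h) = 0"
        using h(1) f unfolding ImDg by simp
      ultimately have "Im (j * k * (k * \<delta>)) = 0" using q by simp
      moreover have kd: "k * \<delta> = \<i> * of_real (Im (k * \<delta>))" using re by (simp add: complex_eq_iff)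
      moreover have "Im (j * k * (\<i> * of_real t)) = 0 \<longleftrightarrow> Im k * t = 0" for t using j by auto
      ultimately have "Im k * Im (k * \<delta>) = 0" by metis
      then have "k * \<delta> = 0" using Imk kd by auto
      then have "\<delta> = 0" using Imk by auto
      then show ?thesis using f sh by (simp add: prod_eq_iff)
    qed
  qed
  moreover have "\<phi> (z0, w0) = 0"
    using S(2) z0 by (simp add: \<phi>_def g0_def \<zeta>_def root_coord_def zero_prod_def)
  moreover have "local_diffeo_at g0 \<psi>"
  proof (rule local_diffeo_atI)
    show "smooth_at g0 \<psi>" unfolding \<psi>_def by (intro smooth_intros)
    show "(\<psi> has_derivative (\<lambda>h. (Im (c * h), Re (c * h)))) (at g0)"
      unfolding \<psi>_def[abs_def] by (rule has_derivative_eq_rhs, (rule derivative_intros)+) auto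
    show "h = 0" if "(Im (c * h), Re (c * h)) = 0" for h
    proof -
      have "c * h = 0" using that by (auto simp: prod_eq_iff complex_eq_iff simp del: times_complex.sel)
      then show ?thesis using c by simp
    qed
  qed
  moreover have "\<psi> g0 = 0" by (simp add: \<psi>_def zero_prod_def)
  moreover have "\<forall>\<^sub>F y in nhds (z0, w0). \<psi> (?g y) = quad_map K 1 (\<phi> y)"
  proof -
    have "\<forall>\<^sub>F y in nhds (z0, w0). Re (root_coord q w0 k (S (snd y), snd y)) = 0"
      by (rule eventually_nhds_isCont[where f=snd and P="\<lambda>w. Re (root_coord q w0 k (S w, w)) = 0"])
         (use S0 in \<open>auto intro!: continuous_intros\<close>)
    then show ?thesis
    proof eventually_elim
      case (elim y)
      obtain z w where y: "y = (z, w)" by (cases y)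
      define s where "s = S w"
      define \<omega> where "\<omega> = root_coord q w0 k (s, w)"
      have "Re \<omega> = 0" using elim by (simp add: \<omega>_def s_def y)
      then have r: "Re (j * \<omega>\<^sup>2) = 0" using j by (auto simp: power2_eq_square)
      have "Re (c * (1 + \<i> * of_real s) * ?g y) = Re (c * (1 + \<i> * of_real s) * (z ^ p + a * cnj z))
          + Re (c * (1 + \<i> * of_real s) * (w ^ q + b * cnj w))"
        unfolding y mixed_map_def by (simp only: prod.case flip: plus_complex.sel distrib_left) (simp add: algebra_simps)
      also have "Re (c * (1 + \<i> * of_real s) * (z ^ p + a * cnj z)) =
          Re ((1 - of_nat p) * (c * z0 ^ p) * crit_factor ?l (of_real s)) + Re (1 * (root_coord p z0 kz (s, z))\<^sup>2)"
        by (rule critical_expansion[OF p z0 critz kz])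
      also have "Re (c * (1 + \<i> * of_real s) * (w ^ q + b * cnj w)) =
          Re ((1 - of_nat q) * (c * w0 ^ q) * crit_factor ?m (of_real s)) + Re (j * \<omega>\<^sup>2)"
        unfolding \<omega>_def by (rule critical_expansion[OF q w0 critw k])
      finally have e: "Re (c * (1 + \<i> * of_real s) * ?g y) - Re (c * (1 + \<i> * of_real s) * g0) = Re (K (of_real s)) + Re ((\<zeta> y)\<^sup>2)"
        unfolding K_def g0_def \<zeta>_def y using r by (simp add: s_def del: times_complex.sel)
      have C: "Re (c * (1 + \<i> * of_real s) * x) = Re (c * x) - s * Im (c * x)" for x
        by (simp add: algebra_simps)
      have "Re (c * (?g y - g0)) = s * Im (c * (?g y - g0)) + Re (K (of_real s)) + Re ((\<zeta> y)\<^sup>2)"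
        using e[unfolded C] by (simp only: right_diff_distrib minus_complex.sel)
      moreover have "Re ((\<zeta> y)\<^sup>2) = (Re (\<zeta> y))\<^sup>2 - (Im (\<zeta> y))\<^sup>2" by (simp add: power2_eq_square)
      ultimately show ?case
        by (simp add: \<psi>_def \<phi>_def quad_map_def y s_def del: times_complex.sel)
    qed
  qed
  ultimately show ?thesis using that unfolding g0_def by blast
qed


lemma critical_point_nonzero:
  assumes "p \<ge> 2" "c \<noteq> 0" "a \<noteq> 0" "c * of_nat p * z ^ (p - 1) = - cnj (c * a)"
  shows "z \<noteq> 0"
proof
  assume "z = 0"
  then have "cnj (c * a) = 0" using assms(1,4) by (simp add: power_0_left)
  then show False using assms(2,3) by simp
qed

text \<open>\<open>h2\<close> and \<open>h3\<close> are one quarter of Re K''(0) and Re K'''(0).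
  That Re K and its first derivative vanish at 0 follows from c g = A + B - p cnj A - q cnj B at a
  critical point, where A = c z0^p and B = c w0^q.\<close>

lemma singular_point_normal_form:
  assumes p: "p \<ge> 2" and q: "q \<ge> 2" and c: "c \<noteq> 0" and a: "a \<noteq> 0" and b: "b \<noteq> 0"
    and critz: "c * of_nat p * z0 ^ (p - 1) = - cnj (c * a)"
    and critw: "c * of_nat q * w0 ^ (q - 1) = - cnj (c * b)"
  defines "h2 \<equiv> real p / (real p - 1) * Re (c * z0 ^ p) + real q / (real q - 1) * Re (c * w0 ^ q)"
    and "h3 \<equiv> real p * (real p + 1) / (real p - 1)\<^sup>2 * Im (c * z0 ^ p)
             + real q * (real q + 1) / (real q - 1)\<^sup>2 * Im (c * w0 ^ q)"
  shows "h2 \<noteq> 0 \<Longrightarrow> has_local_form (mixed_map p q a b) indefinite_fold_form (z0, w0)"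
    and "h2 = 0 \<Longrightarrow> h3 \<noteq> 0 \<Longrightarrow> has_local_form (mixed_map p q a b) cusp_minus_form (z0, w0)"
proof -
  let ?l = "1 / (real p - 1)" and ?m = "1 / (real q - 1)"
  let ?g = "mixed_map p q a b"
  have z0: "z0 \<noteq> 0" and w0: "w0 \<noteq> 0"
    by (rule critical_point_nonzero[OF p c a critz] critical_point_nonzero[OF q c b critw])+
  define A where "A = c * z0 ^ p"
  define B where "B = c * w0 ^ q"
  define K where "K s = (1 - of_nat p) * (c * z0 ^ p) * crit_factor ?l s
       + (1 - of_nat q) * (c * w0 ^ q) * crit_factor ?m s - c * (1 + \<i> * s) * ?g (z0, w0)" for s
  define M1 where "M1 l s = - \<i> * (of_real (1 + l) / (1 - \<i> * s) + of_real l / (1 + \<i> * s)) * crit_factor l s" for l s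
  define M2 where "M2 l s = - 4 * of_real (l * (1 + l)) * crit_factor l s / ((1 - \<i> * s)\<^sup>2 * (1 + \<i> * s)\<^sup>2)" for l s
  define K1 where "K1 s = (1 - of_nat p) * (c * z0 ^ p) * M1 ?l s
       + (1 - of_nat q) * (c * w0 ^ q) * M1 ?m s - c * \<i> * ?g (z0, w0)" for s
  define K2 where "K2 s = (1 - of_nat p) * (c * z0 ^ p) * M2 ?l s
       + (1 - of_nat q) * (c * w0 ^ q) * M2 ?m s" for s
  define k3 where "k3 = (1 - of_nat p) * (c * z0 ^ p) * (4 * \<i> * of_real (?l * (1 + ?l) * (1 + 2 * ?l)))
       + (1 - of_nat q) * (c * w0 ^ q) * (4 * \<i> * of_real (?m * (1 + ?m) * (1 + 2 * ?m)))"
  have dM: "(crit_factor l has_field_derivative M1 l s) (at s)" "(M1 l has_field_derivative M2 l s) (at s)"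
    if "s \<in> ball 0 1" for l s
    unfolding M1_def M2_def
    by (rule has_field_derivative_crit_factor[OF that] has_field_derivative_crit_factor2[OF that])+
  have dM2: "(M2 l has_field_derivative 4 * \<i> * of_real (l * (1 + l) * (1 + 2 * l))) (at 0)" for l
    unfolding M2_def by (rule has_field_derivative_crit_factor3)
  have dK: "(K has_field_derivative K1 s) (at s)" if "s \<in> ball 0 1" for s
    unfolding K_def[abs_def] K1_def
    by (rule DERIV_cong, (rule derivative_intros dM(1)[OF that])+) simp
  have dK1: "(K1 has_field_derivative K2 s) (at s)" if "s \<in> ball 0 1" for s
    unfolding K1_def[abs_def] K2_def
    by (rule DERIV_cong, (rule derivative_intros dM(2)[OF that])+) simp
  have dK2: "(K2 has_field_derivative k3) (at 0)"
    unfolding K2_def[abs_def] k3_def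
    by (intro DERIV_add DERIV_cmult dM2)
  have gen: "(1 - of_nat n) * y * of_real x = of_real ((1 - real n) * x) * y"
    "(1 - of_nat n) * y * (\<i> * of_real x) = of_real ((1 - real n) * x) * (\<i> * y)" for n x and y :: complex by auto
  have M0: "M1 l 0 = \<i> * of_real (- (1 + 2 * l))" "M2 l 0 = of_real (- 4 * (l * (1 + l)))" for l
    by (auto simp: M1_def M2_def algebra_simps)
  have pm: "x ^ n = x ^ (n - 1) * x" if "n \<ge> 2" for x :: complex and n using that by (cases n) auto
  have "c * a * cnj z0 = cnj (- (c * of_nat p * z0 ^ (p - 1) * z0))" unfolding critz by simp
  moreover have "c * b * cnj w0 = cnj (- (c * of_nat q * w0 ^ (q - 1) * w0))" unfolding critw by simp
  ultimately have cg: "c * ?g (z0, w0) = A + B - of_nat p * cnj A - of_nat q * cnj B"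
    by (simp add: mixed_map_def A_def B_def algebra_simps pm[OF p] pm[OF q])
  have lp: "(1 - real p) * (1 + 2 * ?l) = - (real p + 1)" "(1 - real q) * (1 + 2 * ?m) = - (real q + 1)"
    using p q by (auto simp: field_simps)
  have K0: "Re (K 0) = 0"
  proof -
    have e: "K 0 = (1 - of_nat p) * A + (1 - of_nat q) * B - c * ?g (z0, w0)" by (simp add: K_def A_def B_def)
    show ?thesis unfolding e cg by (simp add: algebra_simps)
  qed
  have K10: "Re (K1 0) = 0"
  proof -
    have "K1 0 = of_real ((1 - real p) * - (1 + 2 * ?l)) * (\<i> * A) + of_real ((1 - real q) * - (1 + 2 * ?m)) * (\<i> * B)
       - \<i> * (c * ?g (z0, w0))" unfolding K1_def M0 gen A_def B_def by (simp only: mult.assoc mult.left_commute)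
    also have "\<dots> = of_real (real p + 1) * (\<i> * A) + of_real (real q + 1) * (\<i> * B) - \<i> * (c * ?g (z0, w0))"
      using lp by (simp only: mult_minus_right minus_minus)
    finally have e: "K1 0 = of_real (real p + 1) * (\<i> * A) + of_real (real q + 1) * (\<i> * B) - \<i> * (c * ?g (z0, w0))" .
    show ?thesis unfolding e cg by (simp add: algebra_simps)
  qed
  have K20: "Re (K2 0) = 4 * h2"
  proof -
    have "(1 - real p) * (- 4 * (?l * (1 + ?l))) = 4 * (real p / (real p - 1))"
      "(1 - real q) * (- 4 * (?m * (1 + ?m))) = 4 * (real q / (real q - 1))"
    proof -
      have "- x * (- 4 * (1 / x * (1 + 1 / x))) = 4 * ((x + 1) / x)" if "x \<noteq> 0" for x :: real
        using that by (simp add: field_simps)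
      from this[of "real p - 1"] this[of "real q - 1"] p q
      show "(1 - real p) * (- 4 * (?l * (1 + ?l))) = 4 * (real p / (real p - 1))"
        "(1 - real q) * (- 4 * (?m * (1 + ?m))) = 4 * (real q / (real q - 1))" by auto
    qed
    moreover have "K2 0 = of_real ((1 - real p) * (- 4 * (?l * (1 + ?l)))) * A + of_real ((1 - real q) * (- 4 * (?m * (1 + ?m)))) * B"
      unfolding K2_def M0 gen A_def B_def ..
    ultimately have "K2 0 = of_real (4 * (real p / (real p - 1))) * A + of_real (4 * (real q / (real q - 1))) * B"
      by (simp only:)
    moreover have "Re (of_real x * A + of_real y * B) = x * Re A + y * Re B" for x y by simp
    ultimately show ?thesis unfolding h2_def A_def[symmetric] B_def[symmetric] by (simp only:) simp
  qed
  have k3: "Re k3 = 4 * h3"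
  proof -
    have "(1 - real p) * (?l * (1 + ?l) * (1 + 2 * ?l)) = - (real p * (real p + 1) / (real p - 1)\<^sup>2)"
      "(1 - real q) * (?m * (1 + ?m) * (1 + 2 * ?m)) = - (real q * (real q + 1) / (real q - 1)\<^sup>2)"
    proof -
      have "- x * (1 / x * (1 + 1 / x) * (1 + 2 * (1 / x))) = - ((x + 1) * ((x + 1) + 1) / x\<^sup>2)" if "x \<noteq> 0" for x :: real
        using that by (simp add: field_simps power2_eq_square)
      from this[of "real p - 1"] this[of "real q - 1"] p q
      show "(1 - real p) * (?l * (1 + ?l) * (1 + 2 * ?l)) = - (real p * (real p + 1) / (real p - 1)\<^sup>2)"
        "(1 - real q) * (?m * (1 + ?m) * (1 + 2 * ?m)) = - (real q * (real q + 1) / (real q - 1)\<^sup>2)" by auto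
    qed
    moreover have "k3 = 4 * (of_real ((1 - real p) * (?l * (1 + ?l) * (1 + 2 * ?l))) * (\<i> * A)
        + of_real ((1 - real q) * (?m * (1 + ?m) * (1 + 2 * ?m))) * (\<i> * B))"
    proof -
      have "x * (4 * \<i> * y) = 4 * (x * (\<i> * y))" for x y :: complex by simp
      then show ?thesis unfolding k3_def A_def B_def by (simp only: gen distrib_left)
    qed
    ultimately have "k3 = 4 * (of_real (- (real p * (real p + 1) / (real p - 1)\<^sup>2)) * (\<i> * A)
        + of_real (- (real q * (real q + 1) / (real q - 1)\<^sup>2)) * (\<i> * B))"
      by (simp only:)
    moreover have "Re (4 * (of_real (- x) * (\<i> * A) + of_real (- y) * (\<i> * B))) = 4 * (x * Im A + y * Im B)" for x y
      by simp
    ultimately show ?thesis unfolding h3_def A_def[symmetric] B_def[symmetric] by (simp only:)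
  qed
  obtain \<phi> \<psi> where germ: "local_diffeo_at (z0, w0) \<phi>" "\<phi> (z0, w0) = 0"
    "local_diffeo_at (?g (z0, w0)) \<psi>" "\<psi> (?g (z0, w0)) = 0"
    "\<forall>\<^sub>F y in nhds (z0, w0). \<psi> (?g y) = quad_map K 1 (\<phi> y)"
    unfolding K_def[abs_def] by (rule reduced_germ[OF p q c z0 w0 critz critw]) blast
  note nf = normal_form_of_quad_germ[OF dK dK1 dK2 K0 K10 germ(1-4) isCont_mixed_map germ(5)]
  show "has_local_form ?g indefinite_fold_form (z0, w0)" if "h2 \<noteq> 0"
    by (rule nf(1)) (use that K20 in auto)
  show "has_local_form ?g cusp_minus_form (z0, w0)" if "h2 = 0" "h3 \<noteq> 0"
    by (rule nf(2)) (use that K20 k3 in auto)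
qed

section \<open>Excellence of the nondegenerate maps\<close>

text \<open>Since D is onto, its kernel is the orthogonal complement of the range of its injective
  adjoint and has dimension 4 - 2 = 2. An isometry of the kernel onto the plane supplies the two
  coordinates that the map itself does not.\<close>

lemma kernel_coordinates:
  fixes D :: "complex \<times> complex \<Rightarrow> complex"
  assumes lin: "linear D" and dim: "\<not> dim (range D) < 2"
  obtains l :: "complex \<times> complex \<Rightarrow> real \<times> real" where "linear l" "\<And>h. D h = 0 \<Longrightarrow> l h = 0 \<Longrightarrow> h = 0"
proof -
  have "dim (range D) = DIM(complex)"
    using dim dim_subset_UNIV[of "range D"] by simp
  then have surj: "surj D"
    using dim_eq_full[of "range D"] linear_subspace_image[OF lin subspace_UNIV] span_eq_iff by metis
  define N where "N = {h. D h = 0}"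
  have subN: "subspace N" unfolding N_def by (rule linear_subspace_kernel[OF lin])
  have lin': "linear (adjoint D)" by (rule adjoint_linear[OF lin])
  have inj: "inj (adjoint D)"
    unfolding linear_injective_0[OF lin']
  proof (intro allI impI)
    fix y assume "adjoint D y = 0"
    then have "D x \<bullet> y = 0" for x using adjoint_works[OF lin, of x y] by simp
    then show "y = 0" using surj by (metis inner_eq_zero_iff surjD)
  qed
  have "dim {y \<in> UNIV. \<forall>x \<in> range (adjoint D). orthogonal x y} + dim (range (adjoint D)) = dim (UNIV :: (complex \<times> complex) set)"
    by (rule dim_subspace_orthogonal_to_vectors) (auto intro: linear_subspace_image[OF lin'] subspace_UNIV)
  moreover have "{y \<in> UNIV. \<forall>x \<in> range (adjoint D). orthogonal x y} = N"
    unfolding N_def orthogonal_def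
    by (auto simp: adjoint_clauses[OF lin]) (metis inner_eq_zero_iff)
  moreover have "dim (range (adjoint D)) = dim (UNIV :: complex set)"
    by (rule dim_image_eq[OF lin']) (use inj in auto)
  ultimately have "dim N = dim (UNIV :: (real \<times> real) set)" by simp
  then obtain f :: "complex \<times> complex \<Rightarrow> real \<times> real" where f: "linear f" "f ` N = UNIV"
     "\<And>x. x \<in> N \<Longrightarrow> norm (f x) = norm x"
    by (rule isometry_subspaces[OF subN subspace_UNIV]) blast
  have "l = 0" if "D l = 0" "f l = 0" for l
    using f(3)[of l] that unfolding N_def by simp
  then show ?thesis using that[OF f(1)] by blast
qed

lemma regular_point_normal_form:
  assumes sm: "smooth_at x g" and reg: "\<not> singular_point g x"
  shows "has_local_form g regular_form x"
proof -
  define D where "D = frechet_derivative g (at x)"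
  have dg: "(g has_derivative D) (at x)" unfolding D_def by (rule smooth_at_has_derivative[OF sm])
  have lin: "linear D" by (rule has_derivative_linear[OF dg])
  obtain l :: "complex \<times> complex \<Rightarrow> real \<times> real" where l: "linear l" "\<And>h. D h = 0 \<Longrightarrow> l h = 0 \<Longrightarrow> h = 0"
    by (rule kernel_coordinates[OF lin]) (use reg in \<open>auto simp: singular_point_def D_def\<close>)
  have bl: "bounded_linear l" using l(1) by (simp add: linear_conv_bounded_linear)
  define \<phi> where "\<phi> y = (Re (g y - g x), Im (g y - g x), l (y - x))" for y
  define \<psi> where "\<psi> y = (Re (y - g x), Im (y - g x))" for y
  have "local_diffeo_at x \<phi>"
  proof (rule local_diffeo_atI)
    show "smooth_at x \<phi>"
      unfolding \<phi>_def by (intro smooth_intros sm smooth_at_linear_compose[OF bl])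
    show "(\<phi> has_derivative (\<lambda>h. (Re (D h), Im (D h), l h))) (at x)"
      unfolding \<phi>_def[abs_def]
      by (rule has_derivative_eq_rhs, (rule derivative_intros dg bounded_linear.has_derivative[OF bl])+) auto
    show "h = 0" if "(Re (D h), Im (D h), l h) = 0" for h
      using that l(2)[of h] by (auto simp: prod_eq_iff complex_eq_iff)
  qed
  then have 1: "local_diffeo_at x (\<lambda>y. vec4 (\<phi> y))"
    by (rule local_diffeo_at_compose[OF _ local_diffeo_at_vec4])
  have "local_diffeo_at (g x) \<psi>"
  proof (rule local_diffeo_atI)
    show "smooth_at (g x) \<psi>" unfolding \<psi>_def by (intro smooth_intros)
    show "(\<psi> has_derivative (\<lambda>h. (Re h, Im h))) (at (g x))"
      unfolding \<psi>_def[abs_def] by (rule has_derivative_eq_rhs, (rule derivative_intros)+) auto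
  qed (auto simp: prod_eq_iff complex_eq_iff)
  then have 2: "local_diffeo_at (g x) (\<lambda>y. vec2 (\<psi> y))"
    by (rule local_diffeo_at_compose[OF _ local_diffeo_at_vec2])
  show ?thesis
  proof (rule has_local_formI[OF 1 _ 2 _ smooth_at_isCont[OF sm]])
    show "vec4 (\<phi> x) = 0" "vec2 (\<psi> (g x)) = 0"
      using vec_0 linear_0[OF l(1)] by (simp_all add: \<phi>_def \<psi>_def zero_prod_def)
    show "\<forall>\<^sub>F y in nhds x. vec2 (\<psi> (g y)) = regular_form (vec4 (\<phi> y))"
      by (simp add: vec2_def vec4_def \<phi>_def \<psi>_def regular_form_def vector_4_nth)
  qed
qed

lemma Re_linear_form_eq_0:
  assumes "\<And>h. Re (u * h + v * cnj h) = 0"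
  shows "u = - cnj v"
  using assms[of 1] assms[of \<i>] by (simp add: complex_eq_iff)

text \<open>A range of dimension below 2 has a nonzero normal n. With c its normalized conjugate, Re
  (c D h) is a multiple of the inner product of n and D h; testing h in each variable separately
  gives the two equations.\<close>

lemma singular_point_mixed_mapD:
  assumes "singular_point (mixed_map p q a b) (z, w)"
  obtains c where "cmod c = 1" "c * of_nat p * z ^ (p - 1) = - cnj (c * a)" "c * of_nat q * w ^ (q - 1) = - cnj (c * b)"
proof -
  define D where "D h = of_nat p * z ^ (p - 1) * fst h + a * cnj (fst h)
      + (of_nat q * w ^ (q - 1) * snd h + b * cnj (snd h))" for h
  have "(mixed_map p q a b has_derivative D) (at (z, w))"
    unfolding D_def by (rule has_derivative_mixed_map)
  then have "frechet_derivative (mixed_map p q a b) (at (z, w)) = D"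
    by (rule frechet_derivative_at[symmetric])
  then have "dim (range D) < DIM(complex)" using assms by (simp add: singular_point_def)
  then obtain n where n: "n \<noteq> 0" "\<And>y. y \<in> span (range D) \<Longrightarrow> orthogonal n y"
    using orthogonal_to_subspace_exists by blast
  define c where "c = cnj n / of_real (cmod n)"
  have "cmod c = 1" using n(1) by (simp add: c_def norm_divide)
  have cD: "Re (c * D h) = 0" for h
  proof -
    have "n \<bullet> D h = 0" using n(2)[of "D h"] span_base[of "D h" "range D"] by (simp add: orthogonal_def)
    moreover have "Re (c * D h) = (n \<bullet> D h) / cmod n"
      by (simp add: c_def inner_complex_def add_divide_distrib)
    ultimately show ?thesis by simp
  qed
  have "Re (c * of_nat p * z ^ (p - 1) * h + c * a * cnj h) = 0" for h
    using cD[of "(h, 0)"] by (simp add: D_def distrib_left mult.assoc)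
  moreover have "Re (c * of_nat q * w ^ (q - 1) * h + c * b * cnj h) = 0" for h
    using cD[of "(0, h)"] by (simp add: D_def distrib_left mult.assoc)
  ultimately show ?thesis
    using that[OF \<open>cmod c = 1\<close>] Re_linear_form_eq_0 by blast
qed

text \<open>The last two equations say \<open>h2 = 0\<close> and \<open>h3 = 0\<close> in the
  notation of \<open>singular_point_normal_form\<close>: the case that neither the fold nor the cusp
  covers.\<close>

definition degenerate_crit :: "nat \<Rightarrow> nat \<Rightarrow> complex \<Rightarrow> complex \<Rightarrow> bool" where
  "degenerate_crit p q a b \<longleftrightarrow> (\<exists>c z w. cmod c = 1
     \<and> c * of_nat p * z ^ (p - 1) = - cnj (c * a) \<and> c * of_nat q * w ^ (q - 1) = - cnj (c * b)
     \<and> real p / (real p - 1) * Re (c * z ^ p) + real q / (real q - 1) * Re (c * w ^ q) = 0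
     \<and> real p * (real p + 1) / (real p - 1)\<^sup>2 * Im (c * z ^ p)
       + real q * (real q + 1) / (real q - 1)\<^sup>2 * Im (c * w ^ q) = 0)"

lemma mixed_map_excellent:
  assumes p: "p \<ge> 2" and q: "q \<ge> 2" and a: "a \<noteq> 0" and b: "b \<noteq> 0" and nd: "\<not> degenerate_crit p q a b"
  shows "excellent_map (mixed_map p q a b)"
    and "singular_point (mixed_map p q a b) x \<Longrightarrow>
      has_local_form (mixed_map p q a b) indefinite_fold_form x \<or> is_cusp (mixed_map p q a b) x"
proof -
  have sing: "has_local_form (mixed_map p q a b) indefinite_fold_form x \<or> is_cusp (mixed_map p q a b) x"
    if sp: "singular_point (mixed_map p q a b) x" for x
  proof -
    obtain z w where x: "x = (z, w)" by (cases x)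
    obtain c where c: "cmod c = 1" "c * of_nat p * z ^ (p - 1) = - cnj (c * a)" "c * of_nat q * w ^ (q - 1) = - cnj (c * b)"
      by (rule singular_point_mixed_mapD[OF sp[unfolded x]]) blast
    have "c \<noteq> 0" using c(1) by auto
    note nf = singular_point_normal_form[OF p q this a b c(2,3)]
    show ?thesis
      using nf nd c unfolding degenerate_crit_def is_cusp_def x by blast
  qed
  then show "singular_point (mixed_map p q a b) x \<Longrightarrow>
      has_local_form (mixed_map p q a b) indefinite_fold_form x \<or> is_cusp (mixed_map p q a b) x" .
  have "k_smooth k UNIV (mixed_map p q a b)" for k
  proof (rule k_smooth_local[OF open_UNIV])
    show "\<exists>T. open T \<and> x \<in> T \<and> k_smooth k T (mixed_map p q a b)" for x
      by (rule smooth_atE[OF smooth_at_mixed_map[of x p q a b]]) blast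
  qed
  then have "smooth_on UNIV (mixed_map p q a b)" unfolding smooth_on_iff_k_smooth by simp
  then show "excellent_map (mixed_map p q a b)"
    unfolding excellent_map_def using sing regular_point_normal_form[OF smooth_at_mixed_map] by blast
qed

text \<open>Weighted homogeneity: z^p and w^q both acquire the factor t^(pq), and the two degeneracy
  equations are linear in c z^p and c w^q, so the factor cancels. The angle c is left
  untouched.\<close>

lemma degenerate_crit_scale:
  assumes p: "p \<ge> 2" and q: "q \<ge> 2" and t: "t > 0"
    and deg: "degenerate_crit p q (of_real (t ^ (q * (p - 1))) * a) (of_real (t ^ (p * (q - 1))) * b)"
  shows "degenerate_crit p q a b"
proof -
  obtain c z w where c: "cmod c = 1"
     and z: "c * of_nat p * z ^ (p - 1) = - cnj (c * (of_real (t ^ (q * (p - 1))) * a))"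
     and w: "c * of_nat q * w ^ (q - 1) = - cnj (c * (of_real (t ^ (p * (q - 1))) * b))"
     and h: "real p / (real p - 1) * Re (c * z ^ p) + real q / (real q - 1) * Re (c * w ^ q) = 0"
      "real p * (real p + 1) / (real p - 1)\<^sup>2 * Im (c * z ^ p)
       + real q * (real q + 1) / (real q - 1)\<^sup>2 * Im (c * w ^ q) = 0"
    using deg unfolding degenerate_crit_def by blast
  define z' w' where "z' = z / of_real (t ^ q)" and "w' = w / of_real (t ^ p)"
  have nz: "complex_of_real (t ^ k) \<noteq> 0" for k using t by simp
  have zz: "z = of_real (t ^ q) * z'" "w = of_real (t ^ p) * w'" using t by (auto simp: z'_def w'_def)
  have "of_real (t ^ (q * (p - 1))) * (c * of_nat p * z' ^ (p - 1)) = of_real (t ^ (q * (p - 1))) * (- cnj (c * a))"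
    using z unfolding zz by (simp add: power_mult_distrib power_mult mult_ac)
  then have 1: "c * of_nat p * z' ^ (p - 1) = - cnj (c * a)" by (rule mult_left_cancel[OF nz, THEN iffD1])
  have "of_real (t ^ (p * (q - 1))) * (c * of_nat q * w' ^ (q - 1)) = of_real (t ^ (p * (q - 1))) * (- cnj (c * b))"
    using w unfolding zz by (simp add: power_mult_distrib power_mult mult_ac)
  then have 2: "c * of_nat q * w' ^ (q - 1) = - cnj (c * b)" by (rule mult_left_cancel[OF nz, THEN iffD1])
  have zp: "c * z ^ p = of_real (t ^ (p * q)) * (c * z' ^ p)" "c * w ^ q = of_real (t ^ (p * q)) * (c * w' ^ q)"
    unfolding zz by (simp_all add: power_mult_distrib power_mult[symmetric] mult_ac)
  have sc: "Re (of_real r * x) = r * Re x" "Im (of_real r * x) = r * Im x" for r x by simp_all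
  have "t ^ (p * q) * (real p / (real p - 1) * Re (c * z' ^ p) + real q / (real q - 1) * Re (c * w' ^ q)) = 0"
    using h(1) unfolding zp sc by (simp only: distrib_left mult.left_commute)
  moreover have "t ^ (p * q) * (real p * (real p + 1) / (real p - 1)\<^sup>2 * Im (c * z' ^ p)
       + real q * (real q + 1) / (real q - 1)\<^sup>2 * Im (c * w' ^ q)) = 0"
    using h(2) unfolding zp sc by (simp only: distrib_left mult.left_commute)
  ultimately show ?thesis
    unfolding degenerate_crit_def using c 1 2 t
    by (intro exI[of _ c] exI[of _ z'] exI[of _ w']) simp
qed

lemma linear_deformation_coeff_monomial:
  assumes "n > 0"
  shows "is_linear_deformation_coeffs (\<lambda>t. of_real (t ^ n) * a)"
proof -
  have "real_analytic_fun_on UNIV (\<lambda>t. of_real (t ^ n) * a)"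
    unfolding real_analytic_fun_on_def
  proof (intro ballI exI[of _ "1::real"] conjI)
    fix t0 t :: real
    define C where "C k = (if k \<le> n then of_real (real (n choose k) * t0 ^ (n - k)) * a else 0)" for k
    have "\<forall>t\<in>ball t0 1. ((\<lambda>k. C k * of_real ((t - t0) ^ k)) has_sum of_real (t ^ n) * a) UNIV"
    proof
      fix t assume "t \<in> ball t0 1"
      have "t ^ n = (\<Sum>k\<le>n. real (n choose k) * (t - t0) ^ k * t0 ^ (n - k))"
        using binomial_ring[of "t - t0" t0 n] by simp
      then have "of_real (t ^ n) * a = (\<Sum>k\<le>n. C k * of_real ((t - t0) ^ k))"
        by (simp add: C_def sum_distrib_left mult_ac)
      moreover have "((\<lambda>k. C k * of_real ((t - t0) ^ k)) has_sum (\<Sum>k\<le>n. C k * of_real ((t - t0) ^ k))) {..n}"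
        by (rule has_sum_finite) simp
      ultimately show "((\<lambda>k. C k * of_real ((t - t0) ^ k)) has_sum of_real (t ^ n) * a) UNIV"
        by (subst has_sum_cong_neutral[where T="{..n}" and g="\<lambda>k. C k * of_real ((t - t0) ^ k)"]) (auto simp: C_def)
    qed
    then show "\<exists>c. \<forall>t\<in>ball t0 1. ((\<lambda>k. c k * of_real ((t - t0) ^ k)) has_sum of_real (t ^ n) * a) UNIV"
      by blast
  qed simp
  then show ?thesis
    unfolding is_linear_deformation_coeffs_def real_analytic_on_unit_interval_def
    using assms by (auto intro!: exI[of _ UNIV] simp: power_0_left)
qed

lemma linear_deformation_coeff_0: "is_linear_deformation_coeffs (\<lambda>t. 0)"
  using linear_deformation_coeff_monomial[of 1 0] by simp

section \<open>Real-analytic functions of several variables\<close>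

text \<open>Unordered summability of reals is absolute, which is what permits summation over all
  pairs of indices.\<close>

lemma has_sum_product_real:
  fixes x y :: "_ \<Rightarrow> real"
  assumes x: "(x has_sum X) A" and y: "(y has_sum Y) B"
  shows "((\<lambda>(\<alpha>, \<beta>). x \<alpha> * y \<beta>) has_sum X * Y) (A \<times> B)"
proof (rule has_sum_SigmaI)
  show "((\<lambda>\<beta>. case (\<alpha>, \<beta>) of (\<alpha>, \<beta>) \<Rightarrow> x \<alpha> * y \<beta>) has_sum x \<alpha> * Y) B" for \<alpha>
    using has_sum_cmult_right[OF y] by simp
  show "((\<lambda>\<alpha>. x \<alpha> * Y) has_sum X * Y) A" by (rule has_sum_cmult_left[OF x])
  have ax: "(\<lambda>\<alpha>. \<bar>x \<alpha>\<bar>) summable_on A" and ay: "(\<lambda>\<beta>. \<bar>y \<beta>\<bar>) summable_on B"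
    using x y summable_on_iff_abs_summable_on_real by (auto simp: summable_on_def)
  have "(\<lambda>(\<alpha>, \<beta>). \<bar>x \<alpha>\<bar> * \<bar>y \<beta>\<bar>) summable_on A \<times> B"
  proof (rule summable_on_SigmaI)
    show "((\<lambda>\<beta>. case (\<alpha>, \<beta>) of (\<alpha>, \<beta>) \<Rightarrow> \<bar>x \<alpha>\<bar> * \<bar>y \<beta>\<bar>) has_sum \<bar>x \<alpha>\<bar> * infsum (\<lambda>\<beta>. \<bar>y \<beta>\<bar>) B) B" for \<alpha>
      using has_sum_cmult_right[OF has_sum_infsum[OF ay]] by simp
    show "(\<lambda>\<alpha>. \<bar>x \<alpha>\<bar> * infsum (\<lambda>\<beta>. \<bar>y \<beta>\<bar>) B) summable_on A"
      by (rule summable_on_cmult_left[OF ax])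
  qed auto
  then have "(\<lambda>p. norm (case p of (\<alpha>, \<beta>) \<Rightarrow> x \<alpha> * y \<beta>)) summable_on A \<times> B"
    by (simp add: case_prod_unfold abs_mult)
  then show "(\<lambda>(\<alpha>, \<beta>). x \<alpha> * y \<beta>) summable_on A \<times> B"
    by (rule abs_summable_summable)
qed

lemma real_analytic_multi_on_add:
  assumes "real_analytic_multi_on U f" "real_analytic_multi_on U g"
  shows "real_analytic_multi_on U (\<lambda>y. f y + g y)"
  unfolding real_analytic_multi_on_def
proof
  fix x assume "x \<in> U"
  obtain r1 c1 where r1: "r1 > 0"
    and f: "\<And>y. y \<in> ball x r1 \<Longrightarrow> ((\<lambda>\<alpha>. c1 \<alpha> * (\<Prod>i\<in>UNIV. (y $ i - x $ i) ^ \<alpha> i)) has_sum f y) UNIV"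
    using assms(1) \<open>x \<in> U\<close> unfolding real_analytic_multi_on_def by blast
  obtain r2 c2 where r2: "r2 > 0"
    and g: "\<And>y. y \<in> ball x r2 \<Longrightarrow> ((\<lambda>\<alpha>. c2 \<alpha> * (\<Prod>i\<in>UNIV. (y $ i - x $ i) ^ \<alpha> i)) has_sum g y) UNIV"
    using assms(2) \<open>x \<in> U\<close> unfolding real_analytic_multi_on_def by blast
  show "\<exists>r>0. \<exists>c. \<forall>y\<in>ball x r. ((\<lambda>\<alpha>. c \<alpha> * (\<Prod>i\<in>UNIV. (y $ i - x $ i) ^ \<alpha> i)) has_sum f y + g y) UNIV"
  proof (intro exI[of _ "min r1 r2"] exI[of _ "\<lambda>\<alpha>. c1 \<alpha> + c2 \<alpha>"] conjI ballI)
    fix y assume "y \<in> ball x (min r1 r2)"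
    then show "((\<lambda>\<alpha>. (c1 \<alpha> + c2 \<alpha>) * (\<Prod>i\<in>UNIV. (y $ i - x $ i) ^ \<alpha> i)) has_sum f y + g y) UNIV"
      using has_sum_add[OF f[of y] g[of y]] by (simp add: distrib_right)
  qed (use r1 r2 in auto)
qed

lemma finite_multi_index_splittings: "finite {(\<alpha>, \<beta>). (\<lambda>i. \<alpha> i + \<beta> i) = (\<gamma> :: 'n::finite \<Rightarrow> nat)}"
proof (rule finite_subset)
  have "finite (PiE UNIV (\<lambda>i. {..\<gamma> i}))" by (intro finite_PiE) auto
  moreover have "{\<alpha>. \<forall>i. \<alpha> i \<le> \<gamma> i} = PiE UNIV (\<lambda>i. {..\<gamma> i})" by (auto simp: PiE_def Pi_def)
  ultimately show "finite ({\<alpha>. \<forall>i. \<alpha> i \<le> \<gamma> i} \<times> {\<alpha>. \<forall>i. \<alpha> i \<le> \<gamma> i})" by simp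
  show "{(\<alpha>, \<beta>). (\<lambda>i. \<alpha> i + \<beta> i) = \<gamma>} \<subseteq> {\<alpha>. \<forall>i. \<alpha> i \<le> \<gamma> i} \<times> {\<alpha>. \<forall>i. \<alpha> i \<le> \<gamma> i}"
    by auto
qed

text \<open>The Cauchy product: pairs of multi-indices are grouped by their sum, and each group is
  finite.\<close>

lemma real_analytic_multi_on_mult:
  fixes f g :: "real ^ 'n \<Rightarrow> real"
  assumes "real_analytic_multi_on U f" "real_analytic_multi_on U g"
  shows "real_analytic_multi_on U (\<lambda>y. f y * g y)"
  unfolding real_analytic_multi_on_def
proof
  fix x assume "x \<in> U"
  obtain r1 c1 where r1: "r1 > 0"
    and f: "\<And>y. y \<in> ball x r1 \<Longrightarrow> ((\<lambda>\<alpha>. c1 \<alpha> * (\<Prod>i\<in>UNIV. (y $ i - x $ i) ^ \<alpha> i)) has_sum f y) UNIV"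
    using assms(1) \<open>x \<in> U\<close> unfolding real_analytic_multi_on_def by blast
  obtain r2 c2 where r2: "r2 > 0"
    and g: "\<And>y. y \<in> ball x r2 \<Longrightarrow> ((\<lambda>\<alpha>. c2 \<alpha> * (\<Prod>i\<in>UNIV. (y $ i - x $ i) ^ \<alpha> i)) has_sum g y) UNIV"
    using assms(2) \<open>x \<in> U\<close> unfolding real_analytic_multi_on_def by blast
  define F where "F \<gamma> = {(\<alpha>, \<beta>). (\<lambda>i. \<alpha> i + \<beta> i) = (\<gamma> :: 'n \<Rightarrow> nat)}" for \<gamma>
  define c where "c \<gamma> = (\<Sum>(\<alpha>, \<beta>)\<in>F \<gamma>. c1 \<alpha> * c2 \<beta>)" for \<gamma>
  show "\<exists>r>0. \<exists>c. \<forall>y\<in>ball x r. ((\<lambda>\<alpha>. c \<alpha> * (\<Prod>i\<in>UNIV. (y $ i - x $ i) ^ \<alpha> i)) has_sum f y * g y) UNIV"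
  proof (intro exI[of _ "min r1 r2"] exI[of _ c] conjI ballI)
    fix y assume y: "y \<in> ball x (min r1 r2)"
    define m where "m \<alpha> = (\<Prod>i\<in>UNIV. (y $ i - x $ i) ^ \<alpha> i)" for \<alpha> :: "'n \<Rightarrow> nat"
    have mm: "m (\<lambda>i. \<alpha> i + \<beta> i) = m \<alpha> * m \<beta>" for \<alpha> \<beta>
      by (simp add: m_def power_add prod.distrib)
    have "((\<lambda>(\<alpha>, \<beta>). (c1 \<alpha> * m \<alpha>) * (c2 \<beta> * m \<beta>)) has_sum f y * g y) (UNIV \<times> UNIV)"
      using f[of y] g[of y] y unfolding m_def by (intro has_sum_product_real) auto
    also have "?this \<longleftrightarrow> ((\<lambda>(\<gamma>, (\<alpha>, \<beta>)). (c1 \<alpha> * m \<alpha>) * (c2 \<beta> * m \<beta>)) has_sum f y * g y) (Sigma UNIV F)"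
      by (rule has_sum_reindex_bij_witness[where i=snd and j="\<lambda>p. (\<lambda>i. fst p i + snd p i, p)"])
         (auto simp: F_def)
    finally have "((\<lambda>\<gamma>. \<Sum>(\<alpha>, \<beta>)\<in>F \<gamma>. (c1 \<alpha> * m \<alpha>) * (c2 \<beta> * m \<beta>)) has_sum f y * g y) UNIV"
    proof (rule has_sum_SigmaD)
      show "((\<lambda>p. case (\<gamma>, p) of (\<gamma>, \<alpha>, \<beta>) \<Rightarrow> c1 \<alpha> * m \<alpha> * (c2 \<beta> * m \<beta>)) has_sum
          (\<Sum>(\<alpha>, \<beta>)\<in>F \<gamma>. c1 \<alpha> * m \<alpha> * (c2 \<beta> * m \<beta>))) (F \<gamma>)" for \<gamma>
        by (rule has_sum_finiteI) (auto simp: F_def finite_multi_index_splittings)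
    qed
    moreover have "(\<Sum>(\<alpha>, \<beta>)\<in>F \<gamma>. (c1 \<alpha> * m \<alpha>) * (c2 \<beta> * m \<beta>)) = c \<gamma> * m \<gamma>" for \<gamma>
      unfolding c_def sum_distrib_right by (rule sum.cong) (auto simp: F_def mm)
    ultimately show "((\<lambda>\<alpha>. c \<alpha> * (\<Prod>i\<in>UNIV. (y $ i - x $ i) ^ \<alpha> i)) has_sum f y * g y) UNIV"
      unfolding m_def by simp
  qed (use r1 r2 in auto)
qed

text \<open>A series in one variable is a multivariate series supported on the multi-indices
  concentrated at i. The one-variable series converges everywhere, so the radius 1 is an arbitrary
  choice.\<close>

lemma real_analytic_multi_on_coordinate:
  fixes f :: "real \<Rightarrow> real" and i :: "'n::finite"
  assumes "\<And>t0. \<exists>c. \<forall>t. ((\<lambda>n. c n * (t - t0) ^ n) has_sum f t) UNIV"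
  shows "real_analytic_multi_on U (\<lambda>y :: real ^ 'n. f (y $ i))"
  unfolding real_analytic_multi_on_def
proof
  fix x :: "real ^ 'n"
  obtain c where c: "\<And>t. ((\<lambda>n. c n * (t - x $ i) ^ n) has_sum f t) UNIV" using assms by metis
  define e where "e n = (\<lambda>j. if j = i then n else (0::nat))" for n
  define c' where "c' \<alpha> = (if \<alpha> = e (\<alpha> i) then c (\<alpha> i) else 0)" for \<alpha>
  have ei: "e n i = n" for n by (simp add: e_def)
  show "\<exists>r>0. \<exists>c. \<forall>y\<in>ball x r. ((\<lambda>\<alpha>. c \<alpha> * (\<Prod>j\<in>UNIV. (y $ j - x $ j) ^ \<alpha> j)) has_sum f (y $ i)) UNIV"
  proof (intro exI[of _ 1] exI[of _ c'] conjI ballI)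
    fix y assume "y \<in> ball x 1"
    have pr: "(\<Prod>j\<in>UNIV. (y $ j - x $ j) ^ e n j) = (y $ i - x $ i) ^ n" for n
    proof -
      have "(\<Prod>j\<in>UNIV. (y $ j - x $ j) ^ e n j) = (\<Prod>j\<in>UNIV. if j = i then (y $ i - x $ i) ^ n else 1)"
        by (rule prod.cong) (auto simp: e_def)
      then show ?thesis by simp
    qed
    have "((\<lambda>n. c n * (y $ i - x $ i) ^ n) has_sum f (y $ i)) UNIV" by (rule c)
    also have "?this \<longleftrightarrow> ((\<lambda>\<alpha>. c' \<alpha> * (\<Prod>j\<in>UNIV. (y $ j - x $ j) ^ \<alpha> j)) has_sum f (y $ i)) (range e)"
      by (rule has_sum_reindex_bij_witness[where i="\<lambda>\<alpha>. \<alpha> i" and j=e]) (auto simp: ei c'_def pr)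
    also have "\<dots> \<longleftrightarrow> ((\<lambda>\<alpha>. c' \<alpha> * (\<Prod>j\<in>UNIV. (y $ j - x $ j) ^ \<alpha> j)) has_sum f (y $ i)) UNIV"
      by (rule has_sum_cong_neutral) (auto simp: c'_def)
    finally show "((\<lambda>\<alpha>. c' \<alpha> * (\<Prod>j\<in>UNIV. (y $ j - x $ j) ^ \<alpha> j)) has_sum f (y $ i)) UNIV" .
  qed simp
qed

lemma real_analytic_multi_on_const: "real_analytic_multi_on U (\<lambda>y :: real ^ 'n. k)"
proof (rule real_analytic_multi_on_coordinate[where f="\<lambda>_. k"])
  fix t0 :: real
  show "\<exists>c. \<forall>t. ((\<lambda>n. c n * (t - t0) ^ n) has_sum k) UNIV"
    by (intro exI[of _ "\<lambda>n. if n = 0 then k else 0"] allI has_sum_finite_neutralI[where B="{0}"]) auto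
qed

lemma real_analytic_multi_on_nth: "real_analytic_multi_on U (\<lambda>y :: real ^ 'n. y $ i)"
proof (rule real_analytic_multi_on_coordinate[where f="\<lambda>t. t"])
  fix t0 :: real
  show "\<exists>c. \<forall>t. ((\<lambda>n. c n * (t - t0) ^ n) has_sum t) UNIV"
    by (intro exI[of _ "\<lambda>n. if n = 0 then t0 else if n = 1 then 1 else 0"] allI has_sum_finite_neutralI[where B="{0, 1}"]) auto
qed

lemma has_sum_cos_sin:
  fixes h :: real
  shows "((\<lambda>n. cos_coeff n * h ^ n) has_sum cos h) UNIV" "((\<lambda>n. sin_coeff n * h ^ n) has_sum sin h) UNIV"
  using norm_summable_imp_has_sum[OF summable_norm_cos[of h] cos_converges[of h]]
    norm_summable_imp_has_sum[OF summable_norm_sin[of h] sin_converges[of h]] by simp_all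

lemma expand_coefficients:
  "a * (c * (k * h) ^ n) + b * (d * (k * h) ^ n) = (a * c + b * d) * k ^ n * (h::real) ^ n"
  by (simp add: power_mult_distrib algebra_simps)

lemma real_analytic_multi_on_cos: "real_analytic_multi_on U (\<lambda>y :: real ^ 'n. cos (k * y $ i + s))"
proof (rule real_analytic_multi_on_coordinate[where f="\<lambda>t. cos (k * t + s)"])
  fix t0 :: real
  show "\<exists>c. \<forall>t. ((\<lambda>n. c n * (t - t0) ^ n) has_sum cos (k * t + s)) UNIV"
  proof (intro exI[of _ "\<lambda>n. (cos (k * t0 + s) * cos_coeff n + - sin (k * t0 + s) * sin_coeff n) * k ^ n"] allI)
    fix t
    have e: "(k * t0 + s) + k * (t - t0) = k * t + s" by (simp add: algebra_simps)
    have "cos (k * t + s) = cos (k * t0 + s) * cos (k * (t - t0)) + - sin (k * t0 + s) * sin (k * (t - t0))"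
      using cos_add[of "k * t0 + s" "k * (t - t0)"] unfolding e by simp
    moreover have "((\<lambda>n. cos (k * t0 + s) * (cos_coeff n * (k * (t - t0)) ^ n) + - sin (k * t0 + s) * (sin_coeff n * (k * (t - t0)) ^ n))
       has_sum cos (k * t0 + s) * cos (k * (t - t0)) + - sin (k * t0 + s) * sin (k * (t - t0))) UNIV"
      by (intro has_sum_add has_sum_cmult_right has_sum_cos_sin)
    ultimately show "((\<lambda>n. (cos (k * t0 + s) * cos_coeff n + - sin (k * t0 + s) * sin_coeff n) * k ^ n * (t - t0) ^ n) has_sum cos (k * t + s)) UNIV"
      by (simp only: expand_coefficients)
  qed
qed

lemma real_analytic_multi_on_cos_sin:
  "real_analytic_multi_on U (\<lambda>y :: real ^ 'n. cos (k * y $ i))" "real_analytic_multi_on U (\<lambda>y :: real ^ 'n. sin (k * y $ i))"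
  using real_analytic_multi_on_cos[of U k i 0] real_analytic_multi_on_cos[of U k i "- pi / 2"]
  by (simp_all add: cos_diff)

lemma real_analytic_multi_on_power:
  "real_analytic_multi_on U f \<Longrightarrow> real_analytic_multi_on U (\<lambda>y. f y ^ n)"
  by (induction n) (auto intro: real_analytic_multi_on_mult real_analytic_multi_on_const)

lemma real_analytic_multi_on_sum:
  "(\<And>i. i \<in> I \<Longrightarrow> real_analytic_multi_on U (f i)) \<Longrightarrow> real_analytic_multi_on U (\<lambda>y. \<Sum>i\<in>I. f i y)"
  by (induction I rule: infinite_finite_induct) (auto intro: real_analytic_multi_on_add real_analytic_multi_on_const)

lemmas real_analytic_intros = real_analytic_multi_on_add real_analytic_multi_on_mult real_analytic_multi_on_const
  real_analytic_multi_on_nth real_analytic_multi_on_cos_sin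
  real_analytic_multi_on_power real_analytic_multi_on_sum

section \<open>The degenerate parameters\<close>

text \<open>The norm from C[x] down to C[x^N]: the product over the conjugates of x is invariant
  under multiplication of x by the root of unity, so only powers of x^N survive. It replaces a
  quantity known only through its N-th power by that power.\<close>

lemma norm_polynomial:
  fixes A0 A1 A2 :: "complex poly"
  assumes N: "N \<ge> 1"
  defines "\<zeta> \<equiv> exp (2 * of_real pi * \<i> / of_nat N)"
  obtains D d and h :: "nat \<Rightarrow> nat \<Rightarrow> complex" where
    "\<And>c x. (\<Sum>j\<le>D. \<Sum>k\<le>d. h j k * c ^ k * (x ^ N) ^ j)
       = (\<Prod>k<N. poly A0 (\<zeta> ^ k * x) + c * poly A1 (\<zeta> ^ k * x) + c\<^sup>2 * poly A2 (\<zeta> ^ k * x))"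
proof -
  define f where "f c x = poly A0 x + c * poly A1 x + c\<^sup>2 * poly A2 x" for c x
  \<comment> \<open>The outer variable is c and the inner one x, so the coefficients of the product
    and its degree in c do not depend on the value of c.\<close>
  define F where "F k = [:pcompose A0 [:0, \<zeta> ^ k:], pcompose A1 [:0, \<zeta> ^ k:], pcompose A2 [:0, \<zeta> ^ k:]:]" for k
  define G where "G = (\<Prod>k<N. F k)"
  define P where "P c = poly G [:c:]" for c
  have evF: "poly (poly (F k) [:c:]) x = f c (\<zeta> ^ k * x)" for k c x
    by (simp add: F_def f_def poly_pcompose algebra_simps power2_eq_square)
  have evP: "poly (P c) x = (\<Prod>k<N. f c (\<zeta> ^ k * x))" for c x
    by (simp add: P_def G_def poly_prod evF)
  have \<zeta>_pow: "\<zeta> ^ i = exp (2 * of_real pi * \<i> * of_nat i / of_nat N)" for i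
    unfolding \<zeta>_def by (simp add: exp_of_nat_mult[symmetric] mult_ac)
  have \<zeta>1: "\<zeta> ^ i = 1 \<longleftrightarrow> N dvd i" for i
    unfolding \<zeta>_pow by (rule complex_root_unity_eq_1[OF N])
  have "pcompose (P c) [:0, \<zeta>:] = P c" for c
  proof -
    have "poly (pcompose (P c) [:0, \<zeta>:]) x = poly (P c) x" for x
    proof -
      have "poly (pcompose (P c) [:0, \<zeta>:]) x = (\<Prod>k<N. f c (\<zeta> ^ Suc k * x))"
        by (simp add: poly_pcompose evP mult_ac)
      also have "\<dots> = poly (P c) x"
      proof -
        obtain M where M: "N = Suc M" using N by (cases N) auto
        have "(\<Prod>k<N. f c (\<zeta> ^ Suc k * x)) = (\<Prod>k<M. f c (\<zeta> ^ Suc k * x)) * f c (\<zeta> ^ N * x)"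
          unfolding M by simp
        also have "\<zeta> ^ N = \<zeta> ^ 0" using \<zeta>1[of N] by simp
        also have "(\<Prod>k<M. f c (\<zeta> ^ Suc k * x)) * f c (\<zeta> ^ 0 * x) = (\<Prod>k<N. f c (\<zeta> ^ k * x))"
          unfolding M prod.lessThan_Suc_shift by (simp add: mult.commute)
        finally show ?thesis by (simp only: evP)
      qed
      finally show ?thesis .
    qed
    then show ?thesis by (intro poly_eq_poly_eq_iff[THEN iffD1]) auto
  qed
  then have co: "coeff (P c) i = 0" if "\<not> N dvd i" for c i
  proof -
    have "\<zeta> ^ i * coeff (P c) i = coeff (P c) i"
      using coeff_pcompose_linear[of "P c" \<zeta> i] \<open>\<And>c. pcompose (P c) [:0, \<zeta>:] = P c\<close> by simp
    then show ?thesis using \<zeta>1[of i] that by auto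
  qed
  define d where "d = degree G"
  define D where "D = (\<Sum>k\<le>d. degree (coeff G k))"
  have Pc: "P c = (\<Sum>k\<le>d. coeff G k * [:c ^ k:])" for c
    unfolding P_def poly_altdef d_def by (simp add: poly_const_pow)
  have degk: "degree (coeff G k) \<le> N * D" if "k \<le> d" for k
  proof -
    have "degree (coeff G k) \<le> D" unfolding D_def using that by (intro member_le_sum) auto
    also have "D \<le> N * D" using N by simp
    finally show ?thesis .
  qed
  have coP: "coeff (P c) i = (\<Sum>k\<le>d. coeff (coeff G k) i * c ^ k)" for c i
    unfolding Pc by (simp add: coeff_sum mult.commute)
  have "degree (P c) \<le> N * D" for c
    unfolding Pc by (intro degree_sum_le) (auto intro: order_trans[OF degree_mult_le] degk)
  then have ev: "poly (P c) x = (\<Sum>i\<le>N * D. coeff (P c) i * x ^ i)" for c x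
    by (simp add: poly_as_sum_of_monoms'[symmetric] poly_altdef)
       (rule sum.mono_neutral_left, auto simp: coeff_eq_0)
  have "(\<Sum>j\<le>D. \<Sum>k\<le>d. coeff (coeff G k) (N * j) * c ^ k * (x ^ N) ^ j) = (\<Prod>k<N. f c (\<zeta> ^ k * x))" for c x
  proof -
    have "poly (P c) x = (\<Sum>i\<in>(\<lambda>j. N * j) ` {..D}. coeff (P c) i * x ^ i)"
      unfolding ev
    proof (rule sum.mono_neutral_right)
      show "\<forall>i\<in>{..N * D} - (\<lambda>j. N * j) ` {..D}. coeff (P c) i * x ^ i = 0"
      proof
        fix i assume "i \<in> {..N * D} - (\<lambda>j. N * j) ` {..D}"
        then have "\<not> N dvd i" using N by (auto elim!: dvdE)
        then show "coeff (P c) i * x ^ i = 0" by (simp add: co)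
      qed
    qed auto
    also have "\<dots> = (\<Sum>j\<le>D. coeff (P c) (N * j) * x ^ (N * j))"
      by (subst sum.reindex) (use N in \<open>auto simp: inj_on_def\<close>)
    also have "\<dots> = (\<Sum>j\<le>D. \<Sum>k\<le>d. coeff (coeff G k) (N * j) * c ^ k * (x ^ N) ^ j)"
      unfolding coP by (simp add: sum_distrib_right power_mult)
    finally show ?thesis by (simp only: evP)
  qed
  then show ?thesis
    using that[where D=D and d=d and h="\<lambda>j k. coeff (coeff G k) (N * j)"] unfolding f_def by blast
qed

text \<open>The recursion u^(m + 2) + u^m = 2 (Re u) u^(m + 1) on the unit circle involves two
  earlier exponents, hence the induction over consecutive pairs.\<close>

lemma Chebyshev_exists:
  obtains T :: "complex poly" where "\<And>u. cmod u = 1 \<Longrightarrow> poly T (of_real (Re u)) = of_real (Re (u ^ m))"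
proof -
  have "\<exists>(T :: complex poly) (T' :: complex poly). \<forall>u. cmod u = 1 \<longrightarrow> poly T (of_real (Re u)) = of_real (Re (u ^ m))
      \<and> poly T' (of_real (Re u)) = of_real (Re (u ^ Suc m))"
  proof (induction m)
    case 0
    show ?case by (rule exI[of _ 1], rule exI[of _ "[:0, 1:]"]) auto
  next
    case (Suc m)
    then obtain T T' :: "complex poly" where T: "\<And>u. cmod u = 1 \<Longrightarrow> poly T (of_real (Re u)) = of_real (Re (u ^ m))"
      "\<And>u. cmod u = 1 \<Longrightarrow> poly T' (of_real (Re u)) = of_real (Re (u ^ Suc m))" by blast
    have rec: "Re (u ^ Suc (Suc m)) = 2 * Re u * Re (u ^ Suc m) - Re (u ^ m)" if "cmod u = 1" for u
    proof -
      have "u * cnj u = 1" using that by (metis complex_norm_square of_real_1 one_power2)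
      then have "u ^ Suc (Suc m) + u ^ m = (u + cnj u) * u ^ Suc m" by (simp add: algebra_simps)
      also have "\<dots> = of_real (2 * Re u) * u ^ Suc m" by (simp add: complex_add_cnj)
      finally have "Re (u ^ Suc (Suc m) + u ^ m) = 2 * Re u * Re (u ^ Suc m)" by simp
      then show ?thesis by simp
    qed
    have "poly ([:0, 2:] * T' - T) (of_real (Re u)) = of_real (Re (u ^ Suc (Suc m)))" if u: "cmod u = 1" for u
    proof -
      have "poly ([:0, 2:] * T' - T) (of_real (Re u)) = 2 * of_real (Re u) * poly T' (of_real (Re u)) - poly T (of_real (Re u))"
        by simp
      then show ?thesis
        unfolding T(1)[OF u] T(2)[OF u] rec[OF u] by (simp only: of_real_mult of_real_diff of_real_numeral)
    qed
    then show ?case using T(2) by blast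
  qed
  then show ?thesis using that by blast
qed


text \<open>The equation gives s^(p - 1) = - (cnj c)^2 cnj \<tau>, hence (c s^p)^(p - 1) = (-1)^p
  (cnj c)^(p + 1) (cnj \<tau>)^p. The further power 2 (q + 1) removes the sign and makes the
  exponent of cnj c symmetric in p and q, so that c will cancel between the two variables.\<close>

lemma unit_elimination:
  assumes p: "p \<ge> 2" and c: "cmod c = 1" and crit: "c * s ^ (p - 1) = - (cnj c * cnj \<tau>)"
  shows "(c * s ^ p) ^ (2 * ((p - 1) * (q + 1))) = cnj c ^ (2 * ((p + 1) * (q + 1))) * cnj \<tau> ^ (2 * (p * (q + 1)))"
proof -
  have cc: "c * cnj c = 1" using c by (metis complex_norm_square of_real_1 one_power2)
  have "s ^ (p - 1) = (c * cnj c) * s ^ (p - 1)" using cc by simp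
  also have "\<dots> = cnj c * (c * s ^ (p - 1))" by (simp only: mult_ac)
  also have "\<dots> = - 1 * (cnj c)\<^sup>2 * cnj \<tau>" unfolding crit by (simp add: power2_eq_square)
  finally have s: "s ^ (p - 1) = - 1 * (cnj c)\<^sup>2 * cnj \<tau>" .
  have "(c * s ^ p) ^ (p - 1) = c ^ (p - 1) * (s ^ (p - 1)) ^ p"
    by (simp add: power_mult_distrib flip: power_mult) (simp add: mult.commute)
  also have "\<dots> = (- 1) ^ p * (c ^ (p - 1) * cnj c ^ (2 * p)) * cnj \<tau> ^ p"
    unfolding s power_mult_distrib power_mult[of "cnj c" 2 p] by (simp only: mult_ac)
  also have "cnj c ^ (2 * p) = cnj c ^ (p - 1) * cnj c ^ (p + 1)"
  proof -
    have "2 * p = (p - 1) + (p + 1)" using p by simp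
    then show ?thesis by (simp only: power_add)
  qed
  also have "c ^ (p - 1) * (cnj c ^ (p - 1) * cnj c ^ (p + 1)) = cnj c ^ (p + 1)"
    using cc by (simp add: mult.assoc[symmetric] power_mult_distrib[symmetric])
  finally have "((c * s ^ p) ^ (p - 1)) ^ (2 * (q + 1)) = ((- 1) ^ p * cnj c ^ (p + 1) * cnj \<tau> ^ p) ^ (2 * (q + 1))"
    by simp
  also have "\<dots> = ((- 1) ^ (2 * (p * (q + 1)))) * cnj c ^ ((p + 1) * (2 * (q + 1))) * cnj \<tau> ^ (p * (2 * (q + 1)))"
    by (simp only: power_mult_distrib power_mult[symmetric]) (simp only: mult_ac)
  also have "(- 1 :: complex) ^ (2 * (p * (q + 1))) = 1" by (simp add: power_mult)
  finally show ?thesis by (simp only: power_mult[symmetric] mult_ac mult_1)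
qed

lemma crit_modulus:
  assumes p: "p \<ge> 2" and c: "cmod c = 1" and crit: "c * of_nat p * z ^ (p - 1) = - cnj (c * a)"
  shows "((real p / (real p - 1) * cmod (c * z ^ p))\<^sup>2) ^ (p - 1)
     = (real p / (real p - 1)) ^ (2 * (p - 1)) / real p ^ (2 * p) * cmod a ^ (2 * p)"
proof -
  have "cmod (c * of_nat p * z ^ (p - 1)) = cmod (- cnj (c * a))" using crit by simp
  then have "cmod z ^ (p - 1) = cmod a / real p"
    using c p by (simp add: norm_mult norm_power field_simps)
  then have "(cmod z ^ (p - 1)) ^ (2 * p) = cmod a ^ (2 * p) / real p ^ (2 * p)" by (simp add: power_divide)
  moreover have "((cmod z ^ p)\<^sup>2) ^ (p - 1) = (cmod z ^ (p - 1)) ^ (2 * p)"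
    by (simp flip: power_mult) (simp add: mult_ac)
  moreover have "cmod (c * z ^ p) = cmod z ^ p" using c by (simp add: norm_mult norm_power)
  moreover have "((k * m)\<^sup>2) ^ n = k ^ (2 * n) * (m\<^sup>2) ^ n" for k m :: real and n
    by (simp only: power_mult_distrib power_mult)
  ultimately have "((real p / (real p - 1) * cmod (c * z ^ p))\<^sup>2) ^ (p - 1)
     = (real p / (real p - 1)) ^ (2 * (p - 1)) * (cmod a ^ (2 * p) / real p ^ (2 * p))" by (simp only:)
  then show ?thesis by simp
qed

lemma sgn_crit:
  assumes c: "cmod c = 1" and p: "p \<ge> 2" and crit: "c * of_nat p * z ^ (p - 1) = - cnj (c * a)"
  shows "c * sgn z ^ (p - 1) = - (cnj c * cnj (sgn a))"
proof -
  have pw: "sgn (x ^ n) = sgn x ^ n" for x :: complex and n by (induction n) (auto simp: sgn_mult)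
  have "sgn (cnj a) = cnj (sgn a)" by (simp add: sgn_eq)
  moreover have "sgn c = c" "sgn (cnj c) = cnj c" using c by (simp_all add: sgn_eq)
  moreover have "sgn (of_nat p :: complex) = 1" using p by (simp add: sgn_eq)
  moreover have "sgn (c * of_nat p * z ^ (p - 1)) = sgn (- cnj (c * a))" using crit by simp
  ultimately show ?thesis by (simp add: sgn_mult pw sgn_minus)
qed

text \<open>With Z = p/(p - 1) c z^p and W = q/(q - 1) c w^q the degeneracy reads Re W = - Re Z and
  \<nu> Im W = - \<mu> Im Z. After squaring, these are linear relations between squared real and
  imaginary parts, hence between the squared moduli u, v and the cosines of the doubled arguments;
  \<zeta> and \<omega> are the directions of Z^2 and W^2. The angle relation comes from cancelling
  c.\<close>

lemma degenerate_crit_elimination: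
  fixes p q :: nat and a b :: complex
  assumes p: "p \<ge> 2" and q: "q \<ge> 2" and a: "a \<noteq> 0" and b: "b \<noteq> 0" and deg: "degenerate_crit p q a b"
  defines "\<mu> \<equiv> (real p + 1) / (real p - 1)" and "\<nu> \<equiv> (real q + 1) / (real q - 1)"
  obtains u v \<zeta> \<omega> where "u > 0" "v > 0" "cmod \<zeta> = 1" "cmod \<omega> = 1"
    "u ^ (p - 1) = (real p / (real p - 1)) ^ (2 * (p - 1)) / real p ^ (2 * p) * cmod a ^ (2 * p)"
    "v ^ (q - 1) = (real q / (real q - 1)) ^ (2 * (q - 1)) / real q ^ (2 * q) * cmod b ^ (2 * q)"
    "(\<nu>\<^sup>2 - \<mu>\<^sup>2) * u * Re \<zeta> = 2 * \<nu>\<^sup>2 * v - (\<mu>\<^sup>2 + \<nu>\<^sup>2) * u"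
    "(\<nu>\<^sup>2 - \<mu>\<^sup>2) * v * Re \<omega> = (\<mu>\<^sup>2 + \<nu>\<^sup>2) * v - 2 * \<mu>\<^sup>2 * u"
    "\<zeta> ^ ((p - 1) * (q + 1)) * cnj (\<omega> ^ ((q - 1) * (p + 1)))
        = cis (real (2 * (q * (p + 1))) * Arg b - real (2 * (p * (q + 1))) * Arg a)"
    "\<mu> = \<nu> \<Longrightarrow> u = v"
proof -
  obtain c z w where c: "cmod c = 1"
     and z: "c * of_nat p * z ^ (p - 1) = - cnj (c * a)" and w: "c * of_nat q * w ^ (q - 1) = - cnj (c * b)"
     and h2: "real p / (real p - 1) * Re (c * z ^ p) + real q / (real q - 1) * Re (c * w ^ q) = 0"
     and h3: "real p * (real p + 1) / (real p - 1)\<^sup>2 * Im (c * z ^ p)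
       + real q * (real q + 1) / (real q - 1)\<^sup>2 * Im (c * w ^ q) = 0"
    using deg unfolding degenerate_crit_def by blast
  have cc: "c * cnj c = 1" using c by (metis complex_norm_square of_real_1 one_power2)
  have c0: "c \<noteq> 0" using c by auto
  have z0: "z \<noteq> 0" and w0: "w \<noteq> 0"
    by (rule critical_point_nonzero[OF p c0 a z] critical_point_nonzero[OF q c0 b w])+
  define Z where "Z = of_real (real p / (real p - 1)) * (c * z ^ p)"
  define W where "W = of_real (real q / (real q - 1)) * (c * w ^ q)"
  have sc: "Re (of_real r * x) = r * Re x" "Im (of_real r * x) = r * Im x" for r x by simp_all
  have ReZW: "Re W = - Re Z" using h2 unfolding Z_def W_def sc by simp
  have ImZW: "\<nu> * Im W = - (\<mu> * Im Z)"
  proof -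
    have "\<mu> * (real p / (real p - 1) * x) = real p * (real p + 1) / (real p - 1)\<^sup>2 * x"
      "\<nu> * (real q / (real q - 1) * x) = real q * (real q + 1) / (real q - 1)\<^sup>2 * x" for x
      by (simp_all add: \<mu>_def \<nu>_def power2_eq_square mult.commute)
    then show ?thesis using h3 unfolding Z_def W_def sc by (simp only:)
  qed
  have pq: "real p / (real p - 1) > 0" "real q / (real q - 1) > 0" using p q by auto
  have mn: "\<mu> > 0" "\<nu> > 0" using p q by (auto simp: \<mu>_def \<nu>_def)
  define u where "u = (cmod Z)\<^sup>2"
  define v where "v = (cmod W)\<^sup>2"
  define \<zeta> where "\<zeta> = (c * sgn z ^ p)\<^sup>2"
  define \<omega> where "\<omega> = (c * sgn w ^ q)\<^sup>2"
  have cz: "cmod Z = real p / (real p - 1) * cmod (c * z ^ p)" "cmod W = real q / (real q - 1) * cmod (c * w ^ q)"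
    unfolding Z_def W_def norm_mult[of "of_real _"] norm_of_real using pq by auto
  have uv: "u > 0" "v > 0" using z0 w0 c0 p q unfolding u_def v_def cz by auto
  have ur: "u = (Re Z)\<^sup>2 + (Im Z)\<^sup>2" "v = (Re W)\<^sup>2 + (Im W)\<^sup>2" by (simp_all add: u_def v_def cmod_power2)
  have square: "(of_real r * (c * x ^ n))\<^sup>2 = of_real ((r * cmod (c * x ^ n))\<^sup>2) * (c * sgn x ^ n)\<^sup>2"
    if "x \<noteq> 0" for r x n
  proof -
    have "x ^ n = of_real (cmod x ^ n) * sgn x ^ n" using that by (simp add: sgn_eq power_divide)
    then have "of_real r * (c * x ^ n) = of_real (r * cmod x ^ n) * (c * sgn x ^ n)"
      by (simp only: of_real_mult mult_ac)
    moreover have "cmod (c * x ^ n) = cmod x ^ n" using c by (simp add: norm_mult norm_power)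
    ultimately show ?thesis by (metis of_real_power power_mult_distrib)
  qed
  have Z2: "Z\<^sup>2 = of_real u * \<zeta>" and W2: "W\<^sup>2 = of_real v * \<omega>"
    unfolding u_def v_def cz unfolding Z_def W_def \<zeta>_def \<omega>_def by (rule square[OF z0] square[OF w0])+
  have ReZ: "u * Re \<zeta> = (Re Z)\<^sup>2 - (Im Z)\<^sup>2"
    using arg_cong[OF Z2, of Re] by (simp add: power2_eq_square)
  have ReW: "v * Re \<omega> = (Re W)\<^sup>2 - (Im W)\<^sup>2"
    using arg_cong[OF W2, of Re] by (simp add: power2_eq_square)
  have imsq: "\<nu>\<^sup>2 * (Im W)\<^sup>2 = \<mu>\<^sup>2 * (Im Z)\<^sup>2"
    using arg_cong[OF ImZW, of "\<lambda>x. x\<^sup>2"] by (simp add: power_mult_distrib)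
  have resq: "(Re W)\<^sup>2 = (Re Z)\<^sup>2" using ReZW by simp
  have 1: "(\<nu>\<^sup>2 - \<mu>\<^sup>2) * u * Re \<zeta> = 2 * \<nu>\<^sup>2 * v - (\<mu>\<^sup>2 + \<nu>\<^sup>2) * u"
  proof -
    have "(\<nu>\<^sup>2 - \<mu>\<^sup>2) * u * Re \<zeta> = (\<nu>\<^sup>2 - \<mu>\<^sup>2) * ((Re Z)\<^sup>2 - (Im Z)\<^sup>2)" using ReZ by simp
    also have "\<dots> = 2 * (\<nu>\<^sup>2 * (Re Z)\<^sup>2 + \<mu>\<^sup>2 * (Im Z)\<^sup>2) - (\<mu>\<^sup>2 + \<nu>\<^sup>2) * u"
      unfolding ur by (simp add: algebra_simps)
    also have "\<nu>\<^sup>2 * (Re Z)\<^sup>2 + \<mu>\<^sup>2 * (Im Z)\<^sup>2 = \<nu>\<^sup>2 * v"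
      unfolding ur imsq[symmetric] resq by (simp add: algebra_simps)
    finally show ?thesis by simp
  qed
  have 2: "(\<nu>\<^sup>2 - \<mu>\<^sup>2) * v * Re \<omega> = (\<mu>\<^sup>2 + \<nu>\<^sup>2) * v - 2 * \<mu>\<^sup>2 * u"
  proof -
    have "(\<nu>\<^sup>2 - \<mu>\<^sup>2) * v * Re \<omega> = (\<nu>\<^sup>2 - \<mu>\<^sup>2) * ((Re W)\<^sup>2 - (Im W)\<^sup>2)" using ReW by simp
    also have "\<dots> = (\<mu>\<^sup>2 + \<nu>\<^sup>2) * v - 2 * (\<mu>\<^sup>2 * (Re W)\<^sup>2 + \<nu>\<^sup>2 * (Im W)\<^sup>2)"
      unfolding ur by (simp add: algebra_simps)
    also have "\<mu>\<^sup>2 * (Re W)\<^sup>2 + \<nu>\<^sup>2 * (Im W)\<^sup>2 = \<mu>\<^sup>2 * u"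
      unfolding ur imsq resq by (simp add: algebra_simps)
    finally show ?thesis by simp
  qed
  have sg: "cmod (sgn z) = 1" "cmod (sgn w) = 1" using z0 w0 by (auto simp: norm_sgn)
  have ab: "sgn a = cis (Arg a)" "sgn b = cis (Arg b)" using a b by (auto simp: cis_Arg)
  have "\<zeta> ^ ((p - 1) * (q + 1)) * cnj (\<omega> ^ ((q - 1) * (p + 1)))
        = cis (real (2 * (q * (p + 1))) * Arg b - real (2 * (p * (q + 1))) * Arg a)"
  proof -
    have "\<zeta> ^ ((p - 1) * (q + 1)) = cnj c ^ (2 * ((p + 1) * (q + 1))) * cnj (sgn a) ^ (2 * (p * (q + 1)))"
      unfolding \<zeta>_def power_mult[symmetric] by (rule unit_elimination[OF p c sgn_crit[OF c p z]])
    moreover have "\<omega> ^ ((q - 1) * (p + 1)) = cnj c ^ (2 * ((q + 1) * (p + 1))) * cnj (sgn b) ^ (2 * (q * (p + 1)))"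
      unfolding \<omega>_def power_mult[symmetric] by (rule unit_elimination[OF q c sgn_crit[OF c q w]])
    ultimately have "\<zeta> ^ ((p - 1) * (q + 1)) * cnj (\<omega> ^ ((q - 1) * (p + 1)))
        = (c * cnj c) ^ (2 * ((p + 1) * (q + 1))) * (cnj (sgn a) ^ (2 * (p * (q + 1))) * sgn b ^ (2 * (q * (p + 1))))"
      by (simp add: power_mult_distrib mult_ac)
    also have "\<dots> = cnj (cis (Arg a)) ^ (2 * (p * (q + 1))) * cis (Arg b) ^ (2 * (q * (p + 1)))"
      unfolding cc ab by simp
    also have "\<dots> = cis (real (2 * (q * (p + 1))) * Arg b - real (2 * (p * (q + 1))) * Arg a)"
      by (simp only: cis_cnj Complex.DeMoivre cis_mult mult_minus_right) (simp only: diff_conv_add_uminus add.commute)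
    finally show ?thesis .
  qed
  moreover have "u = v" if "\<mu> = \<nu>"
  proof -
    have "(Im W)\<^sup>2 = (Im Z)\<^sup>2" using imsq that mn by simp
    then show ?thesis unfolding ur resq by simp
  qed
  moreover have "u ^ (p - 1) = (real p / (real p - 1)) ^ (2 * (p - 1)) / real p ^ (2 * p) * cmod a ^ (2 * p)"
    unfolding u_def cz by (rule crit_modulus[OF p c z])
  moreover have "v ^ (q - 1) = (real q / (real q - 1)) ^ (2 * (q - 1)) / real q ^ (2 * q) * cmod b ^ (2 * q)"
    unfolding v_def cz by (rule crit_modulus[OF q c w])
  moreover have "cmod \<zeta> = 1" "cmod \<omega> = 1" using c sg by (simp_all add: \<zeta>_def \<omega>_def norm_mult norm_power)
  ultimately show ?thesis using that[OF uv _ _ _ _ 1 2] by blast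
qed


text \<open>With R = u/v, Re \<zeta> is affine in 1/R and Re \<omega> affine in R, which divides by
  \<nu>^2 - \<mu>^2 and so needs p \<noteq> q. Hence s = Re (\<zeta>^m) and t = Re (\<omega>^n) are
  polynomials in 1/R and R, and the cosine C of the angle satisfies (C - s t)^2 = (1 - s^2)(1 -
  t^2). Only R^N is a monomial in the moduli, so the norm is taken.\<close>

lemma degenerate_locus_distinct:
  assumes p: "p \<ge> 2" and q: "q \<ge> 2" and pq: "p \<noteq> q"
  obtains g :: "real ^ 4 \<Rightarrow> real" where "real_analytic_multi_on UNIV g" "\<exists>a b. g (polar_coords a b) \<noteq> 0"
    "\<And>a b. a \<noteq> 0 \<Longrightarrow> b \<noteq> 0 \<Longrightarrow> degenerate_crit p q a b \<Longrightarrow> g (polar_coords a b) = 0"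
proof -
  define \<mu> \<nu> where "\<mu> = (real p + 1) / (real p - 1)" and "\<nu> = (real q + 1) / (real q - 1)"
  define e where "e = \<nu>\<^sup>2 - \<mu>\<^sup>2"
  have mn: "\<mu> > 0" "\<nu> > 0" using p q by (auto simp: \<mu>_def \<nu>_def)
  have "\<mu> \<noteq> \<nu>" using p q pq by (auto simp: \<mu>_def \<nu>_def field_simps)
  then have e: "e \<noteq> 0" using mn by (auto simp: e_def power2_eq_iff_nonneg)
  \<comment> \<open>Since u^(p - 1) and v^(q - 1) are monomials in |a| and |b|, this exponent gives
    R^N = \<kappa> |a|^M / |b|^L.\<close>
  define N where "N = (p - 1) * (q - 1)"
  have N: "N \<ge> 1" using p q by (simp add: N_def Suc_le_eq)
  define kp where "kp = (real p / (real p - 1)) ^ (2 * (p - 1)) / real p ^ (2 * p)"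
  define kq where "kq = (real q / (real q - 1)) ^ (2 * (q - 1)) / real q ^ (2 * q)"
  have k0: "kp > 0" "kq > 0" using p q by (auto simp: kp_def kq_def)
  define \<kappa> where "\<kappa> = kp ^ (q - 1) / kq ^ (p - 1)"
  have \<kappa>: "\<kappa> > 0" using k0 by (simp add: \<kappa>_def)
  define m n where "m = (p - 1) * (q + 1)" and "n = (q - 1) * (p + 1)"
  obtain Tm :: "complex poly" where Tm: "\<And>u. cmod u = 1 \<Longrightarrow> poly Tm (of_real (Re u)) = of_real (Re (u ^ m))"
    by (rule Chebyshev_exists[of m]) blast
  obtain Tn :: "complex poly" where Tn: "\<And>u. cmod u = 1 \<Longrightarrow> poly Tn (of_real (Re u)) = of_real (Re (u ^ n))"
    by (rule Chebyshev_exists[of n]) blast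
  define T1 where "T1 = pcompose Tm [:of_real (- (\<mu>\<^sup>2 + \<nu>\<^sup>2) / e), of_real (2 * \<nu>\<^sup>2 / e):]"
  define T2 where "T2 = pcompose Tn [:of_real ((\<mu>\<^sup>2 + \<nu>\<^sup>2) / e), of_real (- 2 * \<mu>\<^sup>2 / e):]"
  \<comment> \<open>Reversing T1 clears the powers of 1/R: \<tau>(R) = s X(R). Below,
    \<open>F\<close> is X^2 ((c - s t)^2 - (1 - s^2)(1 - t^2)), a quadratic in c with leading
    coefficient \<open>A2\<close>.\<close>
  define X where "X = monom (1::complex) (degree T1)"
  define \<tau> where "\<tau> = reflect_poly T1"
  define A0 where "A0 = \<tau>\<^sup>2 * T2\<^sup>2 - (X\<^sup>2 - \<tau>\<^sup>2) * (1 - T2\<^sup>2)"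
  define A1 where "A1 = - 2 * X * \<tau> * T2"
  define A2 where "A2 = X\<^sup>2"
  define F where "F c x = poly A0 x + c * poly A1 x + c\<^sup>2 * poly A2 x" for c x
  define \<zeta> where "\<zeta> = exp (2 * of_real pi * \<i> / of_nat N :: complex)"
  obtain D d and h :: "nat \<Rightarrow> nat \<Rightarrow> complex" where norm:
    "\<And>c x. (\<Sum>j\<le>D. \<Sum>k\<le>d. h j k * c ^ k * (x ^ N) ^ j)
       = (\<Prod>k<N. F c (\<zeta> ^ k * x))"
    unfolding \<zeta>_def F_def by (rule norm_polynomial[OF N, of A0 A1 A2]) blast
  have X: "poly X x = x ^ degree T1" for x by (simp add: X_def poly_monom)
  \<comment> \<open>The cosine of the angle difference, written out by the addition formula so that
    analyticity reduces to functions of single coordinates.\<close>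
  define C where "C y = cos (real (2 * (q * (p + 1))) * y $ 4) * cos (real (2 * (p * (q + 1))) * y $ 2)
      + sin (real (2 * (q * (p + 1))) * y $ 4) * sin (real (2 * (p * (q + 1))) * y $ 2)" for y :: "real ^ 4"
  define M L where "M = 2 * p * (q - 1)" and "L = 2 * q * (p - 1)"
  \<comment> \<open>A term of the norm multiplied by |b|^(L D), which clears the denominator of
    (R^N)^j.\<close>
  define w where "w j k y = \<kappa> ^ j * C y ^ k * (y $ 1) ^ (M * j) * (y $ 3) ^ (L * (D - j))" for j k and y :: "real ^ 4"
  define G where "G y = (\<Sum>j\<le>D. \<Sum>k\<le>d. h j k * of_real (w j k y))" for y
  have an: "real_analytic_multi_on UNIV (\<lambda>y. \<Sum>j\<le>D. \<Sum>k\<le>d. r j k * w j k y)" for r :: "nat \<Rightarrow> nat \<Rightarrow> real"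
    unfolding w_def C_def by (intro real_analytic_intros)
  have ReG: "(\<lambda>y. Re (G y)) = (\<lambda>y. \<Sum>j\<le>D. \<Sum>k\<le>d. Re (h j k) * w j k y)"
    and ImG: "(\<lambda>y. Im (G y)) = (\<lambda>y. \<Sum>j\<le>D. \<Sum>k\<le>d. Im (h j k) * w j k y)"
    by (auto simp: G_def)
  have Geq: "G y = of_real ((y $ 3) ^ (L * D)) *
      (\<Prod>k<N. F (of_real (C y)) (\<zeta> ^ k * of_real R))"
    if y3: "(y :: real ^ 4) $ 3 \<noteq> 0" and R: "R ^ N * (y $ 3) ^ L = \<kappa> * (y $ 1) ^ M" for y :: "real ^ 4" and R
  proof -
    have "h j k * of_real (w j k y) = of_real ((y $ 3) ^ (L * D)) * (h j k * of_real (C y) ^ k * (of_real R ^ N) ^ j)"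
      if "j \<le> D" for j k
    proof -
      have e1: "(y $ 3) ^ (L * j) * (y $ 3) ^ (L * (D - j)) = (y $ 3) ^ (L * D)"
        using that by (simp flip: power_add distrib_left)
      have e2: "\<kappa> ^ j * (y $ 1) ^ (M * j) = (R ^ N) ^ j * (y $ 3) ^ (L * j)"
        using arg_cong[OF R, of "\<lambda>x. x ^ j"] by (simp only: power_mult_distrib power_mult)
      have "w j k y = (\<kappa> ^ j * (y $ 1) ^ (M * j)) * C y ^ k * (y $ 3) ^ (L * (D - j))"
        by (simp add: w_def)
      also have "\<dots> = ((y $ 3) ^ (L * j) * (y $ 3) ^ (L * (D - j))) * (C y ^ k * (R ^ N) ^ j)"
        unfolding e2 by (simp only: mult_ac)
      finally have "w j k y = (y $ 3) ^ (L * D) * (C y ^ k * (R ^ N) ^ j)" unfolding e1 .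
      then show ?thesis by simp
    qed
    then have "G y = of_real ((y $ 3) ^ (L * D)) * (\<Sum>j\<le>D. \<Sum>k\<le>d. h j k * of_real (C y) ^ k * (of_real R ^ N) ^ j)"
      unfolding G_def sum_distrib_left by (intro sum.cong) auto
    then show ?thesis unfolding norm .
  qed
  have vanish: "G (polar_coords a b) = 0" if a: "a \<noteq> 0" and b: "b \<noteq> 0" and deg: "degenerate_crit p q a b" for a b
  proof -
    define y where "y = polar_coords a b"
    have y: "y $ 1 = cmod a" "y $ 2 = Arg a" "y $ 3 = cmod b" "y $ 4 = Arg b"
      by (simp_all add: y_def polar_coords_def vector_4_nth)
    obtain u v z w where u: "u > 0" "v > 0" and zw: "cmod z = 1" "cmod w = 1"
      and up: "u ^ (p - 1) = kp * cmod a ^ (2 * p)" "v ^ (q - 1) = kq * cmod b ^ (2 * q)"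
      and E: "e * u * Re z = 2 * \<nu>\<^sup>2 * v - (\<mu>\<^sup>2 + \<nu>\<^sup>2) * u" "e * v * Re w = (\<mu>\<^sup>2 + \<nu>\<^sup>2) * v - 2 * \<mu>\<^sup>2 * u"
      and cis: "z ^ m * cnj (w ^ n) = cis (real (2 * (q * (p + 1))) * Arg b - real (2 * (p * (q + 1))) * Arg a)"
      unfolding kp_def kq_def e_def \<mu>_def \<nu>_def m_def n_def
      by (rule degenerate_crit_elimination[OF p q a b deg]) blast
    define R where "R = u / v"
    have R0: "R > 0" using u by (simp add: R_def)
    have Rz: "Re z = - (\<mu>\<^sup>2 + \<nu>\<^sup>2) / e + 2 * \<nu>\<^sup>2 / e * inverse R"
    proof -
      have "Re z = (2 * \<nu>\<^sup>2 * v - (\<mu>\<^sup>2 + \<nu>\<^sup>2) * u) / (e * u)"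
        unfolding E(1)[symmetric] using u e by simp
      also have "\<dots> = - (\<mu>\<^sup>2 + \<nu>\<^sup>2) / e + 2 * \<nu>\<^sup>2 / e * (v / u)"
        using u e by (simp add: diff_divide_distrib add_divide_distrib)
      finally show ?thesis by (simp add: R_def)
    qed
    have Rw: "Re w = (\<mu>\<^sup>2 + \<nu>\<^sup>2) / e + - 2 * \<mu>\<^sup>2 / e * R"
    proof -
      have "Re w = ((\<mu>\<^sup>2 + \<nu>\<^sup>2) * v - 2 * \<mu>\<^sup>2 * u) / (e * v)"
        unfolding E(2)[symmetric] using u e by simp
      also have "\<dots> = (\<mu>\<^sup>2 + \<nu>\<^sup>2) / e + - 2 * \<mu>\<^sup>2 / e * (u / v)"
        using u e by (simp add: diff_divide_distrib add_divide_distrib)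
      finally show ?thesis by (simp add: R_def)
    qed
    have t1: "poly T1 (inverse (of_real R)) = of_real (Re (z ^ m))"
    proof -
      have "poly T1 (inverse (of_real R)) = poly Tm (of_real (Re z))"
        unfolding T1_def poly_pcompose Rz by (simp add: mult.commute)
      then show ?thesis using Tm[OF zw(1)] by simp
    qed
    have t2: "poly T2 (of_real R) = of_real (Re (w ^ n))"
    proof -
      have "poly T2 (of_real R) = poly Tn (of_real (Re w))"
        unfolding T2_def poly_pcompose Rw by (simp add: mult.commute)
      then show ?thesis using Tn[OF zw(2)] by simp
    qed
    have \<tau>: "poly \<tau> (of_real R) = of_real R ^ degree T1 * of_real (Re (z ^ m))"
      unfolding \<tau>_def using R0 by (simp add: poly_reflect_poly_nz t1)
    have Cy: "C y = Re (z ^ m) * Re (w ^ n) + Im (z ^ m) * Im (w ^ n)"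
    proof -
      have "C y = Re (cis (real (2 * (q * (p + 1))) * Arg b - real (2 * (p * (q + 1))) * Arg a))"
        unfolding C_def y by (simp only: cis.sel cos_diff)
      then show ?thesis
        unfolding cis[symmetric] by (simp only: times_complex.sel cnj.sel mult_minus_right diff_minus_eq_add)
    qed
    have unit: "(Re x)\<^sup>2 + (Im x)\<^sup>2 = 1" if "cmod x = 1" for x using that by (metis cmod_power2 one_power2)
    have z1: "(Im (z ^ m))\<^sup>2 = 1 - (Re (z ^ m))\<^sup>2" "(Im (w ^ n))\<^sup>2 = 1 - (Re (w ^ n))\<^sup>2"
      using unit[of "z ^ m"] unit[of "w ^ n"] zw by (auto simp: norm_power)
    define s t where "s = Re (z ^ m)" and "t = Re (w ^ n)"
    \<comment> \<open>The product of the two imaginary parts has a sign that s and t do not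
      determine; squaring eliminates it.\<close>
    have "(C y - s * t)\<^sup>2 = (1 - s\<^sup>2) * (1 - t\<^sup>2)"
      unfolding Cy s_def t_def z1[symmetric] by (simp add: power_mult_distrib)
    then have key: "s\<^sup>2 * t\<^sup>2 - (1 - s\<^sup>2) * (1 - t\<^sup>2) + C y * (- 2 * s * t) + (C y)\<^sup>2 = 0"
      by (simp add: algebra_simps power2_eq_square)
    have "F (of_real (C y)) (of_real R)
      = of_real ((R ^ degree T1)\<^sup>2) * of_real (s\<^sup>2 * t\<^sup>2 - (1 - s\<^sup>2) * (1 - t\<^sup>2) + C y * (- 2 * s * t) + (C y)\<^sup>2)"
      unfolding F_def A0_def A1_def A2_def using \<tau> t2 X[of "of_real R"]
      by (simp add: s_def[symmetric] t_def[symmetric] poly_monom algebra_simps power2_eq_square)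
    then have f0: "F (of_real (C y)) (of_real R) = 0"
      unfolding key by simp
    have "R ^ N * (y $ 3) ^ L = \<kappa> * (y $ 1) ^ M"
    proof -
      have "u ^ N = (u ^ (p - 1)) ^ (q - 1)" "v ^ N = (v ^ (q - 1)) ^ (p - 1)"
        unfolding N_def by (simp_all flip: power_mult add: mult.commute)
      then have uN: "u ^ N = kp ^ (q - 1) * cmod a ^ M" and vN: "v ^ N = kq ^ (p - 1) * cmod b ^ L"
        unfolding up M_def L_def power_mult_distrib by (simp_all only: power_mult)
      show ?thesis
        unfolding R_def power_divide uN vN y \<kappa>_def using b k0 by (simp add: field_simps)
    qed
    then have "G y = of_real ((y $ 3) ^ (L * D)) *
      (\<Prod>k<N. F (of_real (C y)) (\<zeta> ^ k * of_real R))"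
      using b y by (intro Geq) auto
    moreover have "(\<Prod>k<N. F (of_real (C y)) (\<zeta> ^ k * of_real R)) = 0"
      by (rule prod_zero) (use N f0 in \<open>auto intro!: bexI[of _ 0]\<close>)
    ultimately show ?thesis by (simp add: y_def)
  qed
  have nonvanish: "\<exists>a b. G (polar_coords a b) \<noteq> 0"
  proof -
    \<comment> \<open>At b = 1, with |a| chosen so that R = 1 is admissible, each factor of the norm
      is a quadratic in c whose leading coefficient is a power of a root of unity. Only finitely
      many cosines are therefore bad, and one in [-1, 1] can be avoided by none of them.\<close>
    have A2nz: "poly A2 (\<zeta> ^ k * 1) \<noteq> 0" for k by (simp add: A2_def X \<zeta>_def)
    have "finite (\<Union>k<N. {c. poly [:poly A0 (\<zeta> ^ k * 1), poly A1 (\<zeta> ^ k * 1), poly A2 (\<zeta> ^ k * 1):] c = 0})"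
      by (intro finite_UN_I poly_roots_finite) (use A2nz in auto)
    moreover have "infinite (complex_of_real ` {-1..1})"
      by (subst finite_image_iff) (auto simp: inj_on_def infinite_Icc)
    ultimately obtain c0 where c0: "c0 \<in> {-1..1}" and
        nr: "complex_of_real c0 \<notin> (\<Union>k<N. {c. poly [:poly A0 (\<zeta> ^ k * 1), poly A1 (\<zeta> ^ k * 1), poly A2 (\<zeta> ^ k * 1):] c = 0})"
      by (metis (no_types, lifting) finite_subset image_subsetI)
    have M0: "M > 0" using p q by (simp add: M_def)
    define r where "r = root M (1 / \<kappa>)"
    have r: "r > 0" "\<kappa> * r ^ M = 1" using \<kappa> M0 by (auto simp: r_def)
    \<comment> \<open>As Arg b = 0, only Arg a enters the cosine. Dividing arccos c0 by 2p(q + 1)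
      stays in [0, pi], so \<theta> is a principal argument.\<close>
    define \<theta> where "\<theta> = arccos c0 / real (2 * (p * (q + 1)))"
    have "1 \<le> 2 * (p * (q + 1))" using p by (simp add: Suc_le_eq)
    then have pq0: "real (2 * (p * (q + 1))) \<ge> 1" by (metis of_nat_1 of_nat_mono)
    have \<theta>: "0 \<le> \<theta>" "\<theta> \<le> pi"
    proof -
      have ac: "0 \<le> arccos c0" "arccos c0 \<le> pi" using c0 by (auto intro: arccos_lbound arccos_ubound)
      show "0 \<le> \<theta>" using ac pq0 by (simp add: \<theta>_def)
      have "arccos c0 \<le> pi * real (2 * (p * (q + 1)))" using ac pq0 mult_left_mono[OF pq0, of pi] by linarith
      then show "\<theta> \<le> pi" unfolding \<theta>_def using pq0 by (subst pos_divide_le_eq) auto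
    qed
    define a where "a = of_real r * cis \<theta>"
    have ca: "cmod a = r" using r by (simp add: a_def norm_mult)
    have aa: "Arg a = \<theta>"
    proof (rule Arg_unique[of r \<theta>])
      show "- pi < \<theta>" using \<theta> pi_gt_zero by linarith
    qed (use r \<theta> in \<open>auto simp: a_def cis_conv_exp\<close>)
    define y where "y = polar_coords a 1"
    have y: "y $ 1 = r" "y $ 2 = \<theta>" "y $ 3 = 1" "y $ 4 = 0"
      by (simp_all add: y_def polar_coords_def vector_4_nth ca aa)
    have "real (2 * (p * (q + 1))) * \<theta> = arccos c0" using pq0 by (simp add: \<theta>_def)
    then have "C y = c0" unfolding C_def y using c0 by (simp only: mult_zero_right) simp
    moreover have "G y = of_real ((y $ 3) ^ (L * D)) *
      (\<Prod>k<N. F (of_real (C y)) (\<zeta> ^ k * of_real 1))"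
      by (rule Geq) (use y r in auto)
    moreover have "(\<Prod>k<N. F (of_real c0) (\<zeta> ^ k * 1)) \<noteq> 0"
      using nr by (auto simp: F_def algebra_simps power2_eq_square)
    ultimately have "G y \<noteq> 0" using y by simp
    then show ?thesis unfolding y_def by blast
  qed
  then obtain a b where "G (polar_coords a b) \<noteq> 0" by blast
  \<comment> \<open>The coefficients of G are complex. Both its real and imaginary parts vanish on
    the degenerate parameters, so whichever is nonzero at this point can be used.\<close>
  then have "Re (G (polar_coords a b)) \<noteq> 0 \<or> Im (G (polar_coords a b)) \<noteq> 0" by (simp add: complex_eq_iff)
  then show ?thesis
  proof
    assume "Re (G (polar_coords a b)) \<noteq> 0"
    then show ?thesis
      by (intro that[of "\<lambda>y. Re (G y)"]) (use vanish an ReG in auto)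
  next
    assume "Im (G (polar_coords a b)) \<noteq> 0"
    then show ?thesis
      by (intro that[of "\<lambda>y. Im (G y)"]) (use vanish an ImG in auto)
  qed
qed


text \<open>For p = q the constants \<mu> and \<nu> agree, the cosines can no longer be solved for,
  and the degeneracy forces u = v directly; the monomials in |a| and |b| then have the same
  coefficient and exponent.\<close>

lemma degenerate_locus_equal:
  assumes p: "p \<ge> 2" and a: "a \<noteq> 0" and b: "b \<noteq> 0" and deg: "degenerate_crit p p a b"
  shows "cmod a = cmod b"
proof -
  obtain u v where "u > 0" "v > 0" "u = v"
    and u: "u ^ (p - 1) = (real p / (real p - 1)) ^ (2 * (p - 1)) / real p ^ (2 * p) * cmod a ^ (2 * p)"
    and v: "v ^ (p - 1) = (real p / (real p - 1)) ^ (2 * (p - 1)) / real p ^ (2 * p) * cmod b ^ (2 * p)"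
    by (rule degenerate_crit_elimination[OF p p a b deg]) blast
  have "(real p / (real p - 1)) ^ (2 * (p - 1)) / real p ^ (2 * p) \<noteq> 0" using p by auto
  then have "cmod a ^ (2 * p) = cmod b ^ (2 * p)" using u v \<open>u = v\<close> by (metis mult_left_cancel)
  then show ?thesis
    by (rule power_eq_imp_eq_base) (use p in auto)
qed

lemma degenerate_locus:
  assumes p: "p \<ge> 2" and q: "q \<ge> 2"
  obtains g :: "real ^ 4 \<Rightarrow> real" where "real_analytic_multi_on UNIV g" "\<exists>a b. g (polar_coords a b) \<noteq> 0"
    "\<And>a b. a \<noteq> 0 \<Longrightarrow> b \<noteq> 0 \<Longrightarrow> degenerate_crit p q a b \<Longrightarrow> g (polar_coords a b) = 0"
proof (cases "p = q")
  case False
  show ?thesis by (rule degenerate_locus_distinct[OF p q False]) (rule that)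
next
  case True
  define g :: "real ^ 4 \<Rightarrow> real" where "g y = y $ 1 + (- 1) * y $ 3" for y
  show ?thesis
  proof (rule that[of g])
    show "real_analytic_multi_on UNIV g" unfolding g_def by (intro real_analytic_intros)
    show "\<exists>a b. g (polar_coords a b) \<noteq> 0"
      by (rule exI[of _ 1], rule exI[of _ 0]) (simp add: g_def polar_coords_def vector_4_nth)
    show "g (polar_coords a b) = 0" if "a \<noteq> 0" "b \<noteq> 0" "degenerate_crit p q a b" for a b
      using degenerate_locus_equal[of p a b] p that True by (simp add: g_def polar_coords_def vector_4_nth)
  qed
qed

theorem theorem1p1:
  fixes p q :: nat
  assumes "p \<ge> 2" and "q \<ge> 2"
  defines "f \<equiv> (\<lambda>(z, w). z ^ p + w ^ q :: complex)"
  shows "\<exists>B :: (complex \<times> complex) set. \<exists>gs :: (real ^ 4 \<Rightarrow> real) set.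
     finite gs
     \<and> (\<forall>g\<in>gs. real_analytic_multi_on UNIV g \<and> (\<exists>a b. g (polar_coords a b) \<noteq> 0))
     \<and> B \<subseteq> {(a, b). \<exists>g\<in>gs. g (polar_coords a b) = 0}
     \<and> (\<forall>a b. (a, b) \<notin> B \<longrightarrow>
          (\<exists>a1 b1 a2 b2.
             is_linear_deformation_coeffs a1 \<and> is_linear_deformation_coeffs b1
           \<and> is_linear_deformation_coeffs a2 \<and> is_linear_deformation_coeffs b2
           \<and> lin_deform f a1 b1 a2 b2 1 = (\<lambda>(z, w). f (z, w) + a * cnj z + b * cnj w)
           \<and> (\<forall>t\<in>{0<..1}. excellent_map (lin_deform f a1 b1 a2 b2 t)
                 \<and> (\<forall>x. singular_point (lin_deform f a1 b1 a2 b2 t) x \<longrightarrow>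
                        has_local_form (lin_deform f a1 b1 a2 b2 t) indefinite_fold_form x
                        \<or> is_cusp (lin_deform f a1 b1 a2 b2 t) x))))"
proof -
  obtain g :: "real ^ 4 \<Rightarrow> real" where g: "real_analytic_multi_on UNIV g" "\<exists>a b. g (polar_coords a b) \<noteq> 0"
    "\<And>a b. a \<noteq> 0 \<Longrightarrow> b \<noteq> 0 \<Longrightarrow> degenerate_crit p q a b \<Longrightarrow> g (polar_coords a b) = 0"
    by (rule degenerate_locus[OF assms(1,2)]) blast
  define B where "B = {(a, b). a = 0 \<or> b = 0 \<or> degenerate_crit p q a b}"
  \<comment> \<open>The coordinates |a| and |b| account for the two axes, where
    \<open>critical_point_nonzero\<close> cannot exclude a critical point at 0.\<close>
  define gs where "gs = {g, \<lambda>y. y $ 1, \<lambda>y. y $ 3}"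
  have gs: "real_analytic_multi_on UNIV g' \<and> (\<exists>a b. g' (polar_coords a b) \<noteq> 0)" if "g' \<in> gs" for g'
  proof -
    have "polar_coords 1 1 $ 1 \<noteq> 0" "polar_coords 1 1 $ 3 \<noteq> 0"
      by (simp_all add: polar_coords_def vector_4_nth)
    then show ?thesis using that g real_analytic_multi_on_nth unfolding gs_def by blast
  qed
  have B: "B \<subseteq> {(a, b). \<exists>g\<in>gs. g (polar_coords a b) = 0}"
    using g(3) by (auto simp: B_def gs_def polar_coords_def vector_4_nth)
  have deform: "\<exists>a1 b1 a2 b2.
             is_linear_deformation_coeffs a1 \<and> is_linear_deformation_coeffs b1
           \<and> is_linear_deformation_coeffs a2 \<and> is_linear_deformation_coeffs b2
           \<and> lin_deform f a1 b1 a2 b2 1 = (\<lambda>(z, w). f (z, w) + a * cnj z + b * cnj w)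
           \<and> (\<forall>t\<in>{0<..1}. excellent_map (lin_deform f a1 b1 a2 b2 t)
                 \<and> (\<forall>x. singular_point (lin_deform f a1 b1 a2 b2 t) x \<longrightarrow>
                        has_local_form (lin_deform f a1 b1 a2 b2 t) indefinite_fold_form x
                        \<or> is_cusp (lin_deform f a1 b1 a2 b2 t) x))"
    if ab: "(a, b) \<notin> B" for a b
  proof -
    define a2 b2 where "a2 = (\<lambda>t. of_real (t ^ (q * (p - 1))) * a)" and "b2 = (\<lambda>t. of_real (t ^ (p * (q - 1))) * b)"
    have mm: "lin_deform f (\<lambda>t. 0) (\<lambda>t. 0) a2 b2 t = mixed_map p q (a2 t) (b2 t)" for t
      by (auto simp: lin_deform_def mixed_map_def f_def)
    have "is_linear_deformation_coeffs a2" "is_linear_deformation_coeffs b2"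
      unfolding a2_def b2_def by (rule linear_deformation_coeff_monomial, use assms in simp)+
    moreover have "lin_deform f (\<lambda>t. 0) (\<lambda>t. 0) a2 b2 1 = (\<lambda>(z, w). f (z, w) + a * cnj z + b * cnj w)"
      by (auto simp: lin_deform_def a2_def b2_def)
    moreover have "excellent_map (mixed_map p q (a2 t) (b2 t)) \<and> (\<forall>x. singular_point (mixed_map p q (a2 t) (b2 t)) x \<longrightarrow>
        has_local_form (mixed_map p q (a2 t) (b2 t)) indefinite_fold_form x \<or> is_cusp (mixed_map p q (a2 t) (b2 t)) x)"
      if t: "t \<in> {0<..1}" for t
    proof -
      have nz: "a2 t \<noteq> 0" "b2 t \<noteq> 0" using ab t by (auto simp: B_def a2_def b2_def)
      \<comment> \<open>A degenerate parameter met along the path would scale back to degeneracy of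
        (a, b), which lies outside B.\<close>
      have "\<not> degenerate_crit p q (a2 t) (b2 t)"
        using degenerate_crit_scale[OF assms(1,2), of t a b] ab t unfolding a2_def b2_def B_def by auto
      from mixed_map_excellent[OF assms(1,2) nz this] show ?thesis by blast
    qed
    ultimately show ?thesis
      using linear_deformation_coeff_0 mm
      by (intro exI[of _ "\<lambda>t. 0"] exI[of _ a2] exI[of _ b2]) simp
  qed
  show ?thesis
    by (rule exI[of _ B], rule exI[of _ gs]) (use gs B deform in \<open>auto simp: gs_def\<close>)
qed

end
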